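(* Each element of $\mathrm{stab}(C)$ acts on $\partial C$ (identified with the unit circle via the dyadic labels of the central arcs) as an element of Thompson's group $T$. In particular, $\mathrm{rist}(C)$ acts on $\partial C$ as an isomorphic copy of $T$; that is, the action defines an isomorphism from $\mathrm{rist}(C)$ onto $T$.
   Context: Identify the unit circle $S^1$ with $\mathbb{R}/\mathbb{Z}$. An arc $\{a,b\}$ is a hyperbolic geodesic of the closed unit disk joining two distinct points $a,b\in S^1$. The primary arc of a closed interval $[a,b]$ of the circle is the arc joining $a+\tfrac14(b-a)$ and $b-\tfrac14(b-a)$ (so it cuts the interval into three pieces with length ratio $1:2:1$). Arc diagrams: start with the two arcs $\{1/3,2/3\}$ and $\{1/6,5/6\}$, whose endpoints divide the circle into the four intervals $[1/6,1/3]$, $[1/3,2/3]$, $[2/3,5/6]$, $[-1/6,1/6]$. Finitely many times (possibly zero), choose one of the current intervals and add its primary arc, which replaces that interval by three intervals. Any finite collection of arcs obtained this way is an arc diagram. It is regarded as a 2-complex on the closed disk: the vertices are the arc endpoints, the edges are the arcs and the circle intervals between consecutive endpoints, and the faces are the complementary regions. Two arc diagrams are isomorphic if there is an orientation-preserving isomorphism of these 2-complexes (so circle intervals go to circle intervals and arcs to arcs). Given an isomorphism $\varphi\colon\mathcal{D}\to\mathcal{R}$ of arc diagrams (an arc pair diagram), let $f\colon S^1\to S^1$ be the orientation-preserving piecewise-linear homeomorphism sending each interval of $\mathcal{D}$ linearly onto the corresponding interval of $\mathcal{R}$. Such an $f$ is called a dyadic rearrangement of the basilica (with arc pair diagram $\varphi$),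 and $T_B$ is the set of all of them; it is a group under composition. The basilica lamination consists of all arcs that occur in some arc diagram; its gaps are the complementary components of the union of these arcs in the open disk. Elements of $T_B$ permute the arcs of the lamination and hence the gaps (a gap with set of bordering arcs $L$ is sent to the gap with set of bordering arcs $f(L)$). The basilica Julia set is the quotient of $S^1$ identifying the endpoints of each arc; its components (bounded complementary regions) correspond to gaps. The central component $C$ corresponds to the central gap, the one containing the center of the disk; the arcs bordering it are the central arcs. Central arcs are labeled bijectively by the dyadic rationals in $\mathbb{R}/\mathbb{Z}$: $\{1/6,5/6\}$ has label $0$, $\{1/3,2/3\}$ has label $1/2$, and recursively, if two already labeled central arcs have labels $k/2^m$ and $(k+1)/2^m$ (cyclically consecutive), and $[x,y]$ is the circle interval running counterclockwise from the former to the latter and meeting each arc in one endpoint, then the primary arc of $[x,y]$ has label $(2k+1)/2^{m+1}$. Each central arc collapses to a single point of $\partial C$; these points are dense in $\partial C$, and the labels induce a homeomorphism $\partial C\to\mathbb{R}/\mathbb{Z}$ sending the point of the arc with label $d$ to $d$. $\mathrm{stab}(C)$ is the group of all elements of $T_B$ that map $C$ to itself; it acts on $\partial C$ by homeomorphisms. Under the identification $\partial C\cong\mathbb{R}/\mathbb{Z}$, $f\in\mathrm{stab}(C)$ acts as the homeomorphism that sends $d$ to $d'$ whenever $f$ sends the central arc labeled $d$ to the central arc labeled $d'$. $\mathrm{rist}(C)$ is the group of all elements of $T_B$ that have an arc pair diagram consisting solely of central arcs (in both domain and range); it is a subgroup of $\mathrm{stab}(C)$. Thompson's group $T$ is the group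 of all orientation-preserving piecewise-linear homeomorphisms of $\mathbb{R}/\mathbb{Z}$ that map linearly between the intervals of two dyadic subdivisions, where a dyadic subdivision is a subdivision of the circle into finitely many intervals of the form $[k/2^m,(k+1)/2^m]$. *)

theory Defs
  imports "HOL-Analysis.Analysis" "HOL-Algebra.Bij"
begin

section \<open>The circle\<close>

text \<open>The circle \<open>\<real>/\<int>\<close> is realised as the unit circle of the complex plane through
  \<open>t \<mapsto> exp (2 \<pi> i t)\<close>.  A pair \<open>(a, b)\<close> of reals with \<open>a < b \<le> a + 1\<close> stands for the circle
  interval running counterclockwise from \<^term>\<open>circ a\<close> to \<^term>\<open>circ b\<close>, that is, for the image of
  \<open>{a..b}\<close>.\<close>

abbreviation circle :: "complex set" where
  "circle \<equiv> sphere 0 1"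

definition circ :: "real \<Rightarrow> complex" where
  "circ t = cis (2 * pi * t)"

definition ends :: "real \<times> real \<Rightarrow> complex \<times> complex" where
  "ends = map_prod circ circ"

text \<open>Self-maps of the circle are extensional, so that they live in \<^term>\<open>BijGroup circle\<close>.\<close>

definition circle_homeo :: "(complex \<Rightarrow> complex) \<Rightarrow> bool" where
  "circle_homeo f \<longleftrightarrow>
     f \<in> extensional circle \<and> homeomorphic_map (top_of_set circle) (top_of_set circle) f"

text \<open>The start of the first interval goes to the start of the second one; a circle homeomorphism
  that is linear in this sense on some interval is orientation preserving.\<close>

definition maps_linearly :: "(complex \<Rightarrow> complex) \<Rightarrow> real \<times> real \<Rightarrow> real \<times> real \<Rightarrow> bool" where
  "maps_linearly f p q \<longleftrightarrow>
     (\<forall>s\<in>{0..1}. f (circ (fst p + s * (snd p - fst p))) = circ (fst q + s * (snd q - fst q)))"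

section \<open>Thompson's group T\<close>

definition dyadic_subdivision :: "(real \<times> real) set \<Rightarrow> bool" where
  "dyadic_subdivision P \<longleftrightarrow>
     finite P \<and>
     (\<forall>p\<in>P. \<exists>(m::nat) (k::nat). k < 2 ^ m \<and> p = (real k / 2 ^ m, (real k + 1) / 2 ^ m)) \<and>
     (\<Union>(a, b)\<in>P. circ ` {a..b}) = circle \<and>
     pairwise (\<lambda>(a, b) (c, d). disjnt (circ ` {a<..<b}) (circ ` {c<..<d})) P"

definition thompson_T :: "(complex \<Rightarrow> complex) set" where
  "thompson_T = {f. circle_homeo f \<and>
     (\<exists>P Q. dyadic_subdivision P \<and> dyadic_subdivision Q \<and> (\<forall>p\<in>P. \<exists>q\<in>Q. maps_linearly f p q))}"

section \<open>Arcs and arc diagrams\<close>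

text \<open>An arc is given by the set of its two endpoints.  In the Klein model of the disk the
  geodesics are chords; the radial map \<open>z \<mapsto> 2 z / (1 + |z|\<^sup>2)\<close> is the standard isometry from the
  Poincare model to the Klein model and fixes the circle pointwise, so the following set is the
  (closed) geodesic of the Poincare disk with endpoints \<open>A\<close>.\<close>

definition geodesic :: "complex set \<Rightarrow> complex set" where
  "geodesic A = {z \<in> cball 0 1. (2 / (1 + (norm z)\<^sup>2)) *\<^sub>R z \<in> convex hull A}"

definition primary_arc :: "real \<times> real \<Rightarrow> complex set" where
  "primary_arc = (\<lambda>(a, b). {circ (a + (b - a) / 4), circ (b - (b - a) / 4)})"

text \<open>\<open>arc_diagram I \<A>\<close>: \<open>\<A>\<close> is an arc diagram, and \<open>I\<close> is the set of intervals into
  which the endpoints of its arcs divide the circle (all of them are represented inside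
  \<open>[-1/6, 5/6]\<close>).\<close>

inductive arc_diagram :: "(real \<times> real) set \<Rightarrow> complex set set \<Rightarrow> bool" where
  base: "arc_diagram {(1/6, 1/3), (1/3, 2/3), (2/3, 5/6), (-1/6, 1/6)}
           {{circ (1/3), circ (2/3)}, {circ (1/6), circ (5/6)}}"
| step: "arc_diagram I \<A> \<Longrightarrow> (a, b) \<in> I \<Longrightarrow>
         arc_diagram
           (I - {(a, b)} \<union>
             {(a, a + (b - a) / 4), (a + (b - a) / 4, b - (b - a) / 4), (b - (b - a) / 4, b)})
           (insert (primary_arc (a, b)) \<A>)"

text \<open>An orientation-preserving isomorphism of arc diagrams, given on vertices: counterclockwise
  oriented circle intervals go to counterclockwise oriented circle intervals and arcs go to arcs.
  The faces are the regions cut out by the arcs, so the action on faces is determined and needs no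
  separate condition.\<close>

definition diagram_iso ::
  "(real \<times> real) set \<Rightarrow> complex set set \<Rightarrow> (real \<times> real) set \<Rightarrow> complex set set
     \<Rightarrow> (complex \<Rightarrow> complex) \<Rightarrow> bool" where
  "diagram_iso I \<A> J \<B> \<phi> \<longleftrightarrow>
     bij_betw \<phi> (\<Union>\<A>) (\<Union>\<B>) \<and>
     map_prod \<phi> \<phi> ` ends ` I = ends ` J \<and>
     (\<lambda>A. \<phi> ` A) ` \<A> = \<B>"

definition has_arc_pair_diagram ::
  "(complex \<Rightarrow> complex) \<Rightarrow> (real \<times> real) set \<Rightarrow> complex set set
     \<Rightarrow> (real \<times> real) set \<Rightarrow> complex set set \<Rightarrow> (complex \<Rightarrow> complex) \<Rightarrow> bool" where
  "has_arc_pair_diagram f I \<A> J \<B> \<phi> \<longleftrightarrow>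
     arc_diagram I \<A> \<and> arc_diagram J \<B> \<and> diagram_iso I \<A> J \<B> \<phi> \<and> circle_homeo f \<and>
     (\<forall>p\<in>I. \<forall>q\<in>J. map_prod \<phi> \<phi> (ends p) = ends q \<longrightarrow> maps_linearly f p q)"

definition T_B :: "(complex \<Rightarrow> complex) set" where
  "T_B = {f. \<exists>I \<A> J \<B> \<phi>. has_arc_pair_diagram f I \<A> J \<B> \<phi>}"

section \<open>The basilica lamination and its central gap\<close>

definition lamination :: "complex set set" where
  "lamination = {A. \<exists>I \<A>. arc_diagram I \<A> \<and> A \<in> \<A>}"

text \<open>The gaps of the lamination are the connected components of this set.\<close>

definition lamination_complement :: "complex set" where
  "lamination_complement = ball 0 1 - (\<Union>A\<in>lamination. geodesic A)"

definition border :: "complex set \<Rightarrow> complex set set" where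
  "border G = {A \<in> lamination. geodesic A \<subseteq> frontier G}"

text \<open>The action on gaps: \<open>f\<close> sends the gap \<open>G\<close> to the gap \<open>H\<close>.\<close>

definition maps_gap :: "(complex \<Rightarrow> complex) \<Rightarrow> complex set \<Rightarrow> complex set \<Rightarrow> bool" where
  "maps_gap f G H \<longleftrightarrow> (\<lambda>A. f ` A) ` border G = border H"

definition central_gap :: "complex set" where
  "central_gap = connected_component_set lamination_complement 0"

definition central_arcs :: "complex set set" where
  "central_arcs = border central_gap"

definition stab_C :: "(complex \<Rightarrow> complex) set" where
  "stab_C = {f \<in> T_B. maps_gap f central_gap central_gap}"

definition rist_C :: "(complex \<Rightarrow> complex) set" where
  "rist_C = {f. \<exists>I \<A> J \<B> \<phi>. has_arc_pair_diagram f I \<A> J \<B> \<phi> \<and>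
                  \<A> \<subseteq> central_arcs \<and> \<B> \<subseteq> central_arcs}"

section \<open>The Julia set and the boundary of the central component\<close>

text \<open>A point of the Julia set is an equivalence class of points of the circle.  In particular each
  arc, being the set of its two endpoints, is itself a point of the Julia set.\<close>

definition julia_point :: "complex \<Rightarrow> complex set" where
  "julia_point x = {y \<in> circle. y = x \<or> {x, y} \<in> lamination}"

definition julia_space :: "complex set topology" where
  "julia_space = topology (\<lambda>U. U \<subseteq> julia_point ` circle \<and>
     openin (top_of_set circle) {x \<in> circle. julia_point x \<in> U})"

lemma openin_julia_space:
  "openin julia_space U \<longleftrightarrow> U \<subseteq> julia_point ` circle \<and>
     openin (top_of_set circle) {x \<in> circle. julia_point x \<in> U}"
proof -
  have *: "istopology (\<lambda>U. U \<subseteq> g ` C \<and> openin (top_of_set C) {x \<in> C. g x \<in> U})"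
    for g :: "complex \<Rightarrow> complex set" and C
    unfolding istopology_def
  proof (intro conjI allI impI)
    fix S T
    assume S: "S \<subseteq> g ` C \<and> openin (top_of_set C) {x \<in> C. g x \<in> S}"
      and T: "T \<subseteq> g ` C \<and> openin (top_of_set C) {x \<in> C. g x \<in> T}"
    have "{x \<in> C. g x \<in> S \<inter> T} = {x \<in> C. g x \<in> S} \<inter> {x \<in> C. g x \<in> T}" by blast
    then show "openin (top_of_set C) {x \<in> C. g x \<in> S \<inter> T}"
      using openin_Int[OF conjunct2[OF S] conjunct2[OF T]] by (simp only:)
    show "S \<inter> T \<subseteq> g ` C" using S by blast
  next
    fix K assume K: "\<forall>U\<in>K. U \<subseteq> g ` C \<and> openin (top_of_set C) {x \<in> C. g x \<in> U}"
    have "{x \<in> C. g x \<in> \<Union>K} = \<Union>((\<lambda>U. {x \<in> C. g x \<in> U}) ` K)" by blast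
    moreover have "openin (top_of_set C) (\<Union>((\<lambda>U. {x \<in> C. g x \<in> U}) ` K))"
      using K by (intro openin_Union) blast
    ultimately show "openin (top_of_set C) {x \<in> C. g x \<in> \<Union>K}" by (simp only:)
    show "\<Union>K \<subseteq> g ` C" using K by blast
  qed
  show ?thesis
    unfolding julia_space_def topology_inverse'[OF *] by (rule refl)
qed

definition boundary_C :: "complex set set" where
  "boundary_C = julia_point ` (closure central_gap \<inter> circle)"

text \<open>\<open>central_label A d\<close>: the central arc \<open>A\<close> has the label \<open>d\<close>, a point of the circle
  \<open>\<real>/\<int>\<close>.  The condition \<open>1 \<le> m\<close> makes the two labels in the recursive clause distinct.\<close>

inductive central_label :: "complex set \<Rightarrow> complex \<Rightarrow> bool" where
  zero: "central_label {circ (1/6), circ (5/6)} (circ 0)"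
| half: "central_label {circ (1/3), circ (2/3)} (circ (1/2))"
| mid: "central_label A (circ (real_of_int k / 2 ^ m)) \<Longrightarrow>
        central_label B (circ (real_of_int (k + 1) / 2 ^ m)) \<Longrightarrow> 1 \<le> (m::nat) \<Longrightarrow>
        a < b \<Longrightarrow> b < a + 1 \<Longrightarrow>
        circ ` {a..b} \<inter> A = {circ a} \<Longrightarrow> circ ` {a..b} \<inter> B = {circ b} \<Longrightarrow>
        central_label (primary_arc (a, b)) (circ (real_of_int (2 * k + 1) / 2 ^ (m + 1)))"

definition label_chart :: "(complex set \<Rightarrow> complex) \<Rightarrow> bool" where
  "label_chart h \<longleftrightarrow>
     homeomorphic_map (subtopology julia_space boundary_C) (top_of_set circle) h \<and>
     (\<forall>A d. central_label A d \<longrightarrow> h A = d)"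

text \<open>A map \<open>f\<close> that permutes the arcs of the lamination acts on the Julia set by
  \<open>p \<mapsto> f ` p\<close>.  This is that action on the boundary of the central component, transported to the
  circle by \<open>h\<close>.\<close>

definition boundary_action ::
  "(complex set \<Rightarrow> complex) \<Rightarrow> (complex \<Rightarrow> complex) \<Rightarrow> complex \<Rightarrow> complex" where
  "boundary_action h f = (\<lambda>d\<in>circle. h (f ` inv_into boundary_C h d))"

end

theory Submission
  imports Defs "HOL-Library.Sublist"
begin

text \<open>Everything rests on one map of the circle, \<open>collapse\<close>, which shrinks to a point every circle
interval cut off by a central arc.  The intervals of a diagram that border the central gap are
indexed by binary words: the \<^emph>\<open>cell\<close> of the empty word is \<open>[1/6, 5/6]\<close>, and adding the primary
arc of a cell leaves its first and its last quarter as the two cells below it, while the middle half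
becomes a \<^emph>\<open>cap\<close>, the interval cut off by that arc.  So the circle points bordering the central gap
form a middle-half Cantor set, and \<open>collapse\<close> is the staircase function of this set.  Labels are
assigned by bisection, hence the staircase function carries the cell of a word \<open>w\<close> onto the dyadic
interval of \<open>w\<close>, and each cap to the label of its arc.

\<^bold>\<open>The chart.\<close>  In the Klein model the geodesics are chords, and the central gap is the set of points on
the inner side of the chords of all central arcs (\<open>central_gap_eq\<close>); every other arc of the lamination
has both ends strictly inside a cap.  This identifies the central arcs (\<open>central_arcs_eq\<close>) and the
boundary points on the circle (\<open>closure_central_gap_circle\<close>).  As \<open>collapse\<close> identifies the ends of
each arc, it factors through the Julia set, and compactness makes the resulting bijection of the
boundary of the central component with the circle a homeomorphism (\<open>label_chart_label_map\<close>).  No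
other chart exists, because the central arcs are dense (\<open>label_chart_unique\<close>).

\<^bold>\<open>The stabilizer.\<close>  An element \<open>f\<close> of the stabilizer permutes the central arcs, so it acts on the
boundary by the map \<open>g\<close> with \<open>g (collapse x) = collapse (f x)\<close>.  On a cell of its diagram \<open>f\<close> is linear,
and the image is again a cell: it contains a central arc in its interior, which no subinterval of a
cap does.  By self-similarity of the staircase function \<open>g\<close> is linear between the corresponding dyadic
intervals, and the words of the cells of a diagram give a dyadic subdivision (\<open>stab_C_thompson_T\<close>).

\<^bold>\<open>The rigid stabilizer.\<close>  Its elements are exactly the \<^emph>\<open>lifts\<close> of elements of Thompson's group: the
homeomorphisms that cover some \<open>g\<close> under \<open>collapse\<close> and map caps linearly onto caps.  A lift is unique
(\<open>lifts_unique\<close>), because \<open>collapse\<close> is injective off the caps.  It exists for every \<open>g\<close>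
(\<open>thompson_T_lift\<close>), because a dyadic subdivision comes from a binary tree, and hence from a diagram of
central arcs.  Lifts can be composed and inverted, so group structure and isomorphism are inherited
from Thompson's group.\<close>

section \<open>The circle\<close>

lemma circ_eq_iff: "circ s = circ t \<longleftrightarrow> (\<exists>n::int. s = t + of_int n)"
proof -
  have "circ s = circ t \<longleftrightarrow> sin (2*pi * s) = sin (2*pi * t) \<and> cos (2*pi * s) = cos (2*pi * t)"
    by (auto simp: circ_def complex_eq_iff)
  also have "\<dots> \<longleftrightarrow> (\<exists>n::int. 2*pi * s = 2*pi * t + 2 * pi * of_int n)"
    by (rule sin_cos_eq_iff)
  also have "\<dots> \<longleftrightarrow> (\<exists>n::int. s = t + of_int n)"
    by (simp add: distrib_left [symmetric] mult.assoc [symmetric] del: distrib_left)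
  finally show ?thesis .
qed

lemma circ_add_of_int [simp]: "circ (t + of_int n) = circ t"
  by (auto simp: circ_eq_iff)

lemma circ_add_1 [simp]: "circ (t + 1) = circ t"
  using circ_add_of_int[of t 1] by simp

lemma circ_in_circle: "circ t \<in> circle"
  by (simp add: circ_def)

lemma norm_circ [simp]: "norm (circ t) = 1"
  by (simp add: circ_def)

text \<open>Two real parameters of the same point that are less than \<open>1\<close> apart agree.  This is how equations on
the circle are turned into equations of real numbers throughout.\<close>

lemma circ_eq_near: "circ s = circ t \<Longrightarrow> \<bar>s - t\<bar> < 1 \<Longrightarrow> s = t"
  by (auto simp: circ_eq_iff)

lemma circ_surj:
  assumes "z \<in> circle"
  obtains t where "a \<le> t" "t < a + 1" "circ t = z"
proof -
  from assms obtain x where x: "z = cis x"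
    by (metis Arg2pi complex_is_Real_iff dist_0_norm mem_sphere cis_Arg norm_eq_zero sgn_eq zero_neq_one sgn_div_norm scaleR_one inverse_1)
  define s where "s = x / (2*pi)"
  have zs: "z = circ s" by (simp add: x s_def circ_def)
  define t where "t = s - of_int \<lfloor>s - a\<rfloor>"
  have "circ t = circ s" unfolding circ_eq_iff t_def
    by (rule exI[of _ "- \<lfloor>s - a\<rfloor>"]) simp
  moreover have "a \<le> t" "t < a + 1"
    unfolding t_def by linarith+
  ultimately show ?thesis using that zs by metis
qed

lemma continuous_on_circ: "continuous_on S circ"
proof -
  have "continuous_on S (\<lambda>t. cis (2 * pi * t))" by (intro continuous_intros)
  then show ?thesis by (simp add: circ_def [abs_def])
qed

section \<open>The staircase function of the middle-half Cantor set\<close>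

text \<open>One step of the functional equation \<open>F s = (F (4 s) + F (4 s - 3)) / 2\<close> of the staircase function.
The functions are constant outside \<open>[0, 1]\<close>, so at each point at most one of the two copies varies, and
both are constant on the gap \<open>[1/4, 3/4]\<close>.\<close>

primrec stair_step :: "nat \<Rightarrow> real \<Rightarrow> real" where
  "stair_step 0 s = max 0 (min 1 s)"
| "stair_step (Suc n) s = (stair_step n (4 * s) + stair_step n (4 * s - 3)) / 2"

definition stair :: "real \<Rightarrow> real" where
  "stair s = lim (\<lambda>n. stair_step n s)"

lemma stair_step_le_0: "s \<le> 0 \<Longrightarrow> stair_step n s = 0"
  by (induction n arbitrary: s) auto

lemma stair_step_ge_1: "1 \<le> s \<Longrightarrow> stair_step n s = 1"
  by (induction n arbitrary: s) auto

lemma stair_step_mono: "s \<le> t \<Longrightarrow> stair_step n s \<le> stair_step n t"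
proof (induction n arbitrary: s t)
  case (Suc n)
  have "stair_step n (4 * s) \<le> stair_step n (4 * t)" "stair_step n (4 * s - 3) \<le> stair_step n (4 * t - 3)"
    using Suc by auto
  then show ?case by simp
qed auto

text \<open>Of the two copies in the functional equation at most one contributes to the difference, so that the
factor \<open>1/2\<close> acts on the whole difference.\<close>

lemma stair_step_diff: "\<bar>stair_step (Suc n) s - stair_step n s\<bar> \<le> (1/2) ^ n"
proof (induction n arbitrary: s)
  case 0
  have "0 \<le> stair_step n s" "stair_step n s \<le> 1" for n
    using stair_step_mono[of "min s 0" s n] stair_step_mono[of s "max s 1" n]
    by (simp_all add: stair_step_le_0 stair_step_ge_1)
  from this[of 0] this[of "Suc 0"] show ?case unfolding power_0 by linarith
next
  case (Suc n)
  define D where "D u = stair_step (Suc n) u - stair_step n u" for u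
  have D: "\<bar>D u\<bar> \<le> (1/2)^n" for u using Suc.IH unfolding D_def .
  have D0: "D u = 0" if "u \<le> 0 \<or> 1 \<le> u" for u
    using that unfolding D_def by (metis diff_self stair_step_ge_1 stair_step_le_0)
  have eq: "stair_step (Suc (Suc n)) s - stair_step (Suc n) s = (D (4 * s) + D (4 * s - 3)) / 2"
    by (simp add: D_def diff_divide_distrib add_divide_distrib)
  have "D (4 * s) = 0 \<or> D (4 * s - 3) = 0"
    using D0[of "4 * s"] D0[of "4 * s - 3"] by linarith
  then have "\<bar>D (4 * s) + D (4 * s - 3)\<bar> \<le> (1/2)^n" using D by auto
  then show ?case unfolding eq by simp
qed

lemma stair_step_uniform: "uniform_limit UNIV stair_step stair sequentially"
proof -
  define D where "D i s = stair_step (Suc i) s - stair_step i s" for i s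
  have "uniform_limit UNIV (\<lambda>n s. \<Sum>i<n. D i s) (\<lambda>s. \<Sum>i. D i s) sequentially"
    by (rule Weierstrass_m_test[where M = "\<lambda>i. (1/2)^i"])
       (use stair_step_diff in \<open>auto simp: D_def\<close>)
  then have "uniform_limit UNIV (\<lambda>n s. stair_step 0 s + (\<Sum>i<n. D i s))
      (\<lambda>s. stair_step 0 s + (\<Sum>i. D i s)) sequentially"
    by (intro uniform_limit_intros)
  moreover have "stair_step 0 s + (\<Sum>i<n. D i s) = stair_step n s" for n s
    by (induction n) (auto simp: D_def simp del: stair_step.simps)
  ultimately have u: "uniform_limit UNIV stair_step (\<lambda>s. stair_step 0 s + (\<Sum>i. D i s)) sequentially"
    by simp
  have "stair s = stair_step 0 s + (\<Sum>i. D i s)" for s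
    unfolding stair_def using tendsto_uniform_limitI[OF u] by (simp add: limI)
  then have "stair = (\<lambda>s. stair_step 0 s + (\<Sum>i. D i s))" by (rule ext)
  then show ?thesis using u by (simp only:)
qed

lemma stair_step_tendsto: "(\<lambda>n. stair_step n s) \<longlonglongrightarrow> stair s"
  using tendsto_uniform_limitI[OF stair_step_uniform] by simp

lemma continuous_on_stair: "continuous_on S stair"
proof -
  have cs: "continuous_on UNIV (stair_step n)" for n
  proof (induction n)
    case 0
    have "continuous_on UNIV (\<lambda>s::real. max 0 (min 1 s))" by (intro continuous_intros)
    then show ?case by (simp add: fun_eq_iff cong: continuous_on_cong)
  next
    case (Suc n)
    have "continuous_on UNIV (\<lambda>s. stair_step n (4 * s))" "continuous_on UNIV (\<lambda>s. stair_step n (4 * s - 3))"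
      by (rule continuous_on_compose2[OF Suc]; auto intro!: continuous_intros)+
    then have "continuous_on UNIV (\<lambda>s. (stair_step n (4 * s) + stair_step n (4 * s - 3))/2)"
      by (intro continuous_intros) auto
    then show ?case by simp
  qed
  have "continuous_on UNIV stair"
    by (rule uniform_limit_theorem[OF _ stair_step_uniform]) (use cs in auto)
  then show ?thesis using continuous_on_subset by blast
qed

lemma stair_le_0: "s \<le> 0 \<Longrightarrow> stair s = 0"
  using stair_step_tendsto[of s] by (simp add: stair_step_le_0 LIMSEQ_const_iff)

lemma stair_ge_1: "1 \<le> s \<Longrightarrow> stair s = 1"
  using stair_step_tendsto[of s] by (simp add: stair_step_ge_1 LIMSEQ_const_iff)

lemma stair_mono: "s \<le> t \<Longrightarrow> stair s \<le> stair t"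
  by (rule LIMSEQ_le[OF stair_step_tendsto stair_step_tendsto]) (auto intro: stair_step_mono)

lemma stair_ge_0: "0 \<le> stair s"
  using stair_mono[of "min s 0" s] stair_le_0[of "min s 0"] by simp

lemma stair_le_1: "stair s \<le> 1"
  using stair_mono[of s "max s 1"] stair_ge_1[of "max s 1"] by simp

lemma stair_rec: "stair s = (stair (4 * s) + stair (4 * s - 3)) / 2"
proof -
  have "(\<lambda>n. stair_step (Suc n) s) \<longlonglongrightarrow> (stair (4 * s) + stair (4 * s - 3)) / 2"
    unfolding stair_step.simps by (intro tendsto_intros stair_step_tendsto) auto
  moreover have "(\<lambda>n. stair_step (Suc n) s) \<longlonglongrightarrow> stair s"
    by (rule LIMSEQ_Suc[OF stair_step_tendsto])
  ultimately show ?thesis using LIMSEQ_unique by blast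
qed

lemma stair_left: "s \<le> 1 \<Longrightarrow> stair (s / 4) = stair s / 2"
  using stair_rec[of "s / 4"] by (simp add: stair_le_0)

lemma stair_right: "0 \<le> s \<Longrightarrow> stair ((3 + s) / 4) = (1 + stair s) / 2"
proof -
  assume "0 \<le> s"
  moreover have "4 * ((3 + s) / 4) = 3 + s" "4 * ((3 + s) / 4) - 3 = s" by (simp_all add: field_simps)
  ultimately show ?thesis using stair_rec[of "(3 + s) / 4"] stair_ge_1[of "3 + s"] by (simp only:)
qed

lemma stair_middle: "1/4 \<le> s \<Longrightarrow> s \<le> 3/4 \<Longrightarrow> stair s = 1/2"
  using stair_rec[of s] by (simp add: stair_ge_1 stair_le_0)

text \<open>Multiplication by \<open>4\<close> takes \<open>s\<close> beyond \<open>1\<close> after finitely many steps, and the functional equation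
halves the value in each step.\<close>

lemma stair_pos: "0 < s \<Longrightarrow> 0 < stair s"
proof -
  assume s: "0 < s"
  obtain n where "1 / 4 ^ n \<le> s"
    using real_arch_pow_inv[OF s, of "1/4"] by (auto simp: power_divide intro: less_imp_le)
  then show ?thesis using s
  proof (induction n arbitrary: s)
    case 0
    then show ?case by (simp add: stair_ge_1)
  next
    case (Suc n)
    have "0 < stair (4 * s)" by (rule Suc.IH) (use Suc.prems in \<open>auto simp: field_simps\<close>)
    then show ?case using stair_rec[of s] stair_ge_0[of "4 * s - 3"] by simp
  qed
qed

lemma stair_less_1: "s < 1 \<Longrightarrow> stair s < 1"
proof -
  assume s: "s < 1"
  then have "0 < 1 - s" by simp
  then obtain n where "1 / 4 ^ n \<le> 1 - s"
    using real_arch_pow_inv[of "1-s" "1/4"] by (auto simp: power_divide intro: less_imp_le)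
  then show ?thesis using s
  proof (induction n arbitrary: s)
    case 0
    then show ?case by (simp add: stair_le_0)
  next
    case (Suc n)
    have "stair (4 * s - 3) < 1" by (rule Suc.IH) (use Suc.prems in \<open>auto simp: field_simps\<close>)
    then show ?case using stair_rec[of s] stair_le_1[of "4 * s"] by simp
  qed
qed

section \<open>Binary words, gaps and points of the Cantor set\<close>

text \<open>A word records successive choices between a first part (\<open>False\<close>) and a last part (\<open>True\<close>).  Under
bisection of \<open>[0, 1]\<close> the word \<open>w\<close> leads to a dyadic interval that starts at \<open>bin_val w\<close> and has the
midpoint \<open>bin_mid w\<close>.  In the construction of the middle-half Cantor set it leads to an interval that
starts at \<open>cantor_val w\<close>, and the gap removed from this interval runs from \<open>gapl w\<close> to \<open>gapr w\<close>.\<close>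

type_synonym node = "bool list"

primrec cantor_val :: "node \<Rightarrow> real" where
  "cantor_val [] = 0"
| "cantor_val (b # w) = (3 * of_bool b + cantor_val w) / 4"

primrec bin_val :: "node \<Rightarrow> real" where
  "bin_val [] = 0"
| "bin_val (b # w) = (of_bool b + bin_val w) / 2"

primrec bin_mid :: "node \<Rightarrow> real" where
  "bin_mid [] = 1/2"
| "bin_mid (b # w) = (of_bool b + bin_mid w) / 2"

primrec gapl :: "node \<Rightarrow> real" where
  "gapl [] = 1/4"
| "gapl (b # w) = (3 * of_bool b + gapl w) / 4"

primrec gapr :: "node \<Rightarrow> real" where
  "gapr [] = 3/4"
| "gapr (b # w) = (3 * of_bool b + gapr w) / 4"

lemma cantor_val_append: "cantor_val (v @ w) = cantor_val v + cantor_val w / 4 ^ length v"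
  by (induction v) (auto simp: field_simps)

lemma bin_val_append: "bin_val (v @ w) = bin_val v + bin_val w / 2 ^ length v"
  by (induction v) (auto simp: field_simps)

lemma bin_mid_append: "bin_mid (v @ w) = bin_val v + bin_mid w / 2 ^ length v"
  by (induction v) (auto simp: field_simps)

lemma gapl_append: "gapl (v @ w) = cantor_val v + gapl w / 4 ^ length v"
  by (induction v) (auto simp: field_simps)

lemma gapr_append: "gapr (v @ w) = cantor_val v + gapr w / 4 ^ length v"
  by (induction v) (auto simp: field_simps)

lemma bin_mid_eq: "bin_mid v = bin_val v + 1 / (2 * 2 ^ length v)"
  using bin_mid_append[of v "[]"] by simp

lemma gapl_eq: "gapl v = cantor_val v + 1 / (4 * 4 ^ length v)"
  using gapl_append[of v "[]"] by simp

lemma gapr_eq: "gapr v = cantor_val v + 3 / (4 * 4 ^ length v)"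
  using gapr_append[of v "[]"] by simp

lemma gapl_less_gapr: "gapl v < gapr v"
  by (simp add: gapl_eq gapr_eq divide_strict_right_mono)

lemma cantor_val_ge_0: "0 \<le> cantor_val w"
  by (induction w) auto

lemma cantor_val_le_1: "cantor_val w + 1 / 4 ^ length w \<le> 1"
proof (induction w)
  case (Cons b w)
  have "cantor_val (b # w) + 1 / 4 ^ length (b # w) = (3 * of_bool b + (cantor_val w + 1 / 4 ^ length w)) / 4"
    by (simp add: field_simps)
  also have "\<dots> \<le> (3 * of_bool b + 1) / 4" using Cons by (intro divide_right_mono add_left_mono) auto
  also have "\<dots> \<le> 1" by simp
  finally show ?case .
qed simp

lemma bin_val_ge_0: "0 \<le> bin_val w"
  by (induction w) auto

lemma bin_val_le_1: "bin_val w + 1 / 2 ^ length w \<le> 1"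
proof (induction w)
  case (Cons b w)
  have "bin_val (b # w) + 1 / 2 ^ length (b # w) = (of_bool b + (bin_val w + 1 / 2 ^ length w)) / 2"
    by (simp add: field_simps)
  also have "\<dots> \<le> (of_bool b + 1) / 2" using Cons by (intro divide_right_mono add_left_mono) auto
  also have "\<dots> \<le> 1" by simp
  finally show ?case .
qed simp

lemma bin_mid_bounds: "0 < bin_mid v" "bin_mid v < 1"
  by (induction v) (auto simp: of_bool_def)

lemma gapl_pos: "0 < gapl v"
  by (induction v) (auto simp: of_bool_def)

lemma gapr_less_1: "gapr v < 1"
  by (induction v) (auto simp: of_bool_def)

lemma bin_mid_inj: "bin_mid v = bin_mid w \<Longrightarrow> v = w"
proof (induction v arbitrary: w)
  case Nil
  then show ?case using bin_mid_bounds[of "tl w"]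
    by (cases w) (auto simp: of_bool_def split: if_splits)
next
  case (Cons b v)
  show ?case
  proof (cases w)
    case Nil
    then show ?thesis using Cons.prems bin_mid_bounds[of v] by (auto simp: of_bool_def split: if_splits)
  next
    case (Cons c u)
    then have "of_bool b + bin_mid v = of_bool c + bin_mid u" using Cons.prems by simp
    then have "b = c" "bin_mid v = bin_mid u"
      using bin_mid_bounds[of v] bin_mid_bounds[of u] by (auto simp: of_bool_def split: if_splits)
    then show ?thesis using Cons.IH Cons by simp
  qed
qed

text \<open>Self-similarity: on the Cantor interval of \<open>w\<close> the staircase function is a copy of itself, with values
in the dyadic interval of \<open>w\<close>.\<close>

lemma stair_cell:
  "0 \<le> s \<Longrightarrow> s \<le> 1 \<Longrightarrow> stair (cantor_val w + s / 4 ^ length w) = bin_val w + stair s / 2 ^ length w"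
proof (induction w)
  case (Cons b w)
  let ?u = "cantor_val w + s / 4 ^ length w"
  have "s / 4 ^ length w \<le> 1 / 4 ^ length w" using Cons.prems by (simp add: divide_right_mono)
  then have u: "0 \<le> ?u" "?u \<le> 1" using cantor_val_ge_0[of w] cantor_val_le_1[of w] Cons.prems by auto
  have eq: "cantor_val (b # w) + s / 4 ^ length (b # w) = (3 * of_bool b + ?u) / 4"
    by (simp add: field_simps)
  have "stair ((3 * of_bool b + ?u) / 4) = (of_bool b + stair ?u) / 2"
    using stair_left[of ?u] stair_right[of ?u] u by (cases b) auto
  also have "stair ?u = bin_val w + stair s / 2 ^ length w" using Cons by blast
  finally show ?case unfolding eq by (simp add: add_divide_distrib)
qed auto

lemma stair_gap: "gapl v \<le> s \<Longrightarrow> s \<le> gapr v \<Longrightarrow> stair s = bin_mid v"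
proof (induction v arbitrary: s)
  case Nil
  then show ?case by (simp add: stair_middle)
next
  case (Cons b v)
  have "stair (4 * s - 3 * of_bool b) = bin_mid v"
    by (rule Cons.IH) (use Cons.prems in \<open>auto simp: field_simps\<close>)
  moreover have "0 < 4 * s - 3 * of_bool b" "4 * s - 3 * of_bool b < 1"
    using Cons.prems gapl_pos[of v] gapr_less_1[of v] by (auto simp: field_simps)
  ultimately show ?case
    using stair_left[of "4 * s"] stair_right[of "4 * s - 3"] by (cases b) (auto simp: of_bool_def)
qed

text \<open>Two points with the same value that are both left or both right of the first gap can be magnified by
\<open>4\<close>, which cannot go on forever; otherwise both lie in the first gap, since the staircase function
takes the value \<open>1/2\<close> only there.\<close>

lemma stair_fibre:
  assumes "0 \<le> s" "s < t" "t \<le> 1" "stair s = stair t"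
  obtains v where "gapl v \<le> s" "t \<le> gapr v"
proof -
  obtain n where "1 / 4 ^ n \<le> t - s"
    using real_arch_pow_inv[of "t - s" "1/4"] assms by (auto simp: power_divide intro: less_imp_le)
  then have "\<exists>v. gapl v \<le> s \<and> t \<le> gapr v" using assms
  proof (induction n arbitrary: s t)
    case 0
    then have "s = 0" "t = 1" by auto
    then show ?case using 0 by (simp add: stair_le_0 stair_ge_1)
  next
    case (Suc n)
    consider "t \<le> 1/4" | "3/4 \<le> s" | "1/4 \<le> s" "t \<le> 3/4"
      | "s < 1/4" "1/4 < t" | "s < 3/4" "3/4 < t" by linarith
    then show ?case
    proof cases
      case 1
      have "\<exists>v. gapl v \<le> 4 * s \<and> 4 * t \<le> gapr v"
        using stair_left[of "4 * s"] stair_left[of "4 * t"] Suc.prems 1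
        by (intro Suc.IH) (auto simp: field_simps)
      then obtain v where "gapl v \<le> 4 * s \<and> 4 * t \<le> gapr v" by blast
      then show ?thesis by (intro exI[of _ "False # v"]) auto
    next
      case 2
      have "\<exists>v. gapl v \<le> 4 * s - 3 \<and> 4 * t - 3 \<le> gapr v"
        using stair_right[of "4 * s - 3"] stair_right[of "4 * t - 3"] Suc.prems 2
        by (intro Suc.IH) (auto simp: field_simps)
      then obtain v where "gapl v \<le> 4 * s - 3 \<and> 4 * t - 3 \<le> gapr v" by blast
      then show ?thesis by (intro exI[of _ "True # v"]) auto
    next
      case 3
      then show ?thesis by (intro exI[of _ "[]"]) auto
    next
      case 4
      have "stair s < 1/2" using stair_left[of "4 * s"] stair_less_1[of "4 * s"] 4 by auto
      moreover have "1/2 \<le> stair t" using stair_mono[of "1/4" t] stair_middle[of "1/4"] 4 by simp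
      ultimately show ?thesis using Suc.prems by simp
    next
      case 5
      have "1/2 < stair t" using stair_right[of "4 * t - 3"] stair_pos[of "4 * t - 3"] 5 by auto
      moreover have "stair s \<le> 1/2" using stair_mono[of s "3/4"] stair_middle[of "3/4"] 5 by simp
      ultimately show ?thesis using Suc.prems by simp
    qed
  qed
  then show ?thesis using that by blast
qed

lemma stair_eq_bin_mid_iff: "stair s = bin_mid v \<longleftrightarrow> gapl v \<le> s \<and> s \<le> gapr v"
proof
  assume eq: "stair s = bin_mid v"
  have s: "0 < s" "s < 1" using eq bin_mid_bounds[of v] stair_le_0[of s] stair_ge_1[of s] by force+
  have aux: "a \<le> gapr v \<and> gapl v \<le> a" if "gapl u \<le> min a (gapl v)" "max a (gapl v) \<le> gapr u" for u a
  proof -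
    have "bin_mid v = bin_mid u" using stair_gap[of u "gapl v"] stair_gap[of v "gapl v"] gapl_less_gapr[of v] that by auto
    then show ?thesis using that bin_mid_inj by auto
  qed
  have e2: "stair (gapl v) = bin_mid v" using stair_gap gapl_less_gapr[of v] by simp
  show "gapl v \<le> s \<and> s \<le> gapr v"
  proof (cases s "gapl v" rule: linorder_cases)
    case less
    then obtain u where "gapl u \<le> s" "gapl v \<le> gapr u"
      using stair_fibre[of s "gapl v"] s e2 eq gapr_less_1[of v] gapl_less_gapr[of v] by (metis less_imp_le less_trans)
    then show ?thesis using aux[of u s] less by auto
  next
    case greater
    then obtain u where "gapl u \<le> gapl v" "s \<le> gapr u"
      using stair_fibre[of "gapl v" s] s e2 eq gapl_pos[of v] by (metis less_imp_le)
    then show ?thesis using aux[of u s] greater by auto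
  qed (use gapl_less_gapr[of v] in auto)
qed (use stair_gap in auto)

lemma gaps_disjoint: "gapl u \<le> s \<Longrightarrow> s \<le> gapr u \<Longrightarrow> gapl v \<le> s \<Longrightarrow> s \<le> gapr v \<Longrightarrow> u = v"
  using stair_gap bin_mid_inj by metis

definition cantor :: "real set" where
  "cantor = {0..1} - (\<Union>v. {gapl v<..<gapr v})"

lemma cantor_bounds: "s \<in> cantor \<Longrightarrow> 0 \<le> s" "s \<in> cantor \<Longrightarrow> s \<le> 1"
  by (auto simp: cantor_def)

lemma compact_cantor: "compact cantor"
  unfolding cantor_def by (intro compact_diff open_UN ballI) auto

lemma gapl_in_cantor: "gapl v \<in> cantor"
proof -
  have "\<not> (gapl u < gapl v \<and> gapl v < gapr u)" for u
    using gaps_disjoint[of u "gapl v" v] gapl_less_gapr[of v] by auto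
  then show ?thesis
    using gapl_pos[of v] gapr_less_1[of v] gapl_less_gapr[of v] by (auto simp: cantor_def)
qed

lemma one_in_cantor: "1 \<in> cantor"
  using gapr_less_1 by (auto simp: cantor_def) (meson less_asym)

lemma cantor_surj:
  assumes "0 \<le> u" "u \<le> 1"
  obtains s where "s \<in> cantor" "stair s = u"
proof -
  obtain s where s: "0 \<le> s" "s \<le> 1" "stair s = u"
    using IVT'[of stair 0 u 1] assms continuous_on_stair by (auto simp: stair_le_0 stair_ge_1)
  show ?thesis
  proof (cases "s \<in> cantor")
    case False
    then obtain v where "gapl v < s" "s < gapr v" using s by (auto simp: cantor_def)
    then have "stair (gapl v) = u" using s stair_gap[of v s] stair_gap[of v "gapl v"] by simp
    then show ?thesis using that gapl_in_cantor by blast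
  qed (use s that in blast)
qed

lemma cantor_Cons: 
  assumes "s \<in> cantor"
  shows "(3 * of_bool b + s) / 4 \<in> cantor"
proof -
  have s: "0 \<le> s" "s \<le> 1" using assms by (auto simp: cantor_def)
  have "\<not> (gapl v < (3 * of_bool b + s) / 4 \<and> (3 * of_bool b + s) / 4 < gapr v)" for v
  proof (cases v)
    case Nil
    then show ?thesis using s by auto
  next
    case (Cons c u)
    have "\<not> (gapl u < s \<and> s < gapr u)" using assms by (auto simp: cantor_def)
    then show ?thesis using Cons s gapl_pos[of u] gapr_less_1[of u] by (cases b; cases c) auto
  qed
  then show ?thesis using s by (auto simp: cantor_def)
qed

lemma cantor_cell: "s \<in> cantor \<Longrightarrow> cantor_val w + s / 4 ^ length w \<in> cantor"
proof (induction w)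
  case (Cons b w)
  have "cantor_val (b # w) + s / 4 ^ length (b # w) = (3 * of_bool b + (cantor_val w + s / 4 ^ length w)) / 4"
    by (simp add: field_simps)
  then show ?case using Cons cantor_Cons by (simp only:)
qed simp

lemma cantor_in_cell:
  assumes "s \<in> cantor"
  obtains w where "length w = n" "cantor_val w \<le> s" "s \<le> cantor_val w + 1 / 4 ^ n"
proof -
  from assms have "\<exists>w. length w = n \<and> cantor_val w \<le> s \<and> s \<le> cantor_val w + 1 / 4 ^ n"
  proof (induction n arbitrary: s)
    case 0
    then show ?case by (auto simp: cantor_def)
  next
    case (Suc n)
    have s: "0 \<le> s" "s \<le> 1" and g: "\<not> (gapl v < s \<and> s < gapr v)" for v
      using Suc.prems by (auto simp: cantor_def)
    obtain b where b: "0 \<le> 4 * s - 3 * of_bool b" "4 * s - 3 * of_bool b \<le> 1"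
    proof (cases "s \<le> 1/4")
      case True
      then show ?thesis using that[of False] s by simp
    next
      case False
      then show ?thesis using that[of True] s g[of "[]"] by simp
    qed
    have "4 * s - 3 * of_bool b \<in> cantor"
      using b g[of "b # v" for v] by (force simp: cantor_def field_simps)
    then obtain w where "length w = n" "cantor_val w \<le> 4 * s - 3 * of_bool b"
        "4 * s - 3 * of_bool b \<le> cantor_val w + 1 / 4 ^ n"
      using Suc.IH by blast
    then show ?case by (intro exI[of _ "b # w"]) (auto simp: field_simps)
  qed
  then show ?thesis using that by blast
qed

text \<open>So every Cantor interval starts at an end of a cap; the value \<open>0\<close> belongs to the cap of the arc with
label \<open>0\<close>.\<close>

lemma cell_start_gap_end: "cantor_val w = 0 \<or> (\<exists>v. cantor_val w = gapr v)"
proof (induction w)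
  case (Cons b w)
  show ?case
  proof (cases "cantor_val w = 0")
    case True
    then show ?thesis by (cases b) (auto intro: exI[of _ "[]"])
  next
    case False
    then obtain v where "cantor_val w = gapr v" using Cons by blast
    then show ?thesis by (intro disjI2 exI[of _ "b # v"]) simp
  qed
qed simp

lemma bin_val_dyadic: obtains k :: nat where "k < 2 ^ length w" "bin_val w = real k / 2 ^ length w"
proof -
  have "\<exists>k::nat. k < 2 ^ length w \<and> bin_val w = real k / 2 ^ length w"
  proof (induction w)
    case (Cons b w)
    then obtain k :: nat where "k < 2 ^ length w" "bin_val w = real k / 2 ^ length w" by blast
    then show ?case
      by (intro exI[of _ "(if b then 2 ^ length w else 0) + k"]) (auto simp: field_simps)
  qed simp
  then show ?thesis using that by blast
qed

lemma dyadic_bin_val: "k < 2 ^ m \<Longrightarrow> \<exists>w. length w = m \<and> bin_val w = real k / 2 ^ m"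
proof (induction m arbitrary: k)
  case 0
  then show ?case by simp
next
  case (Suc m)
  define b where "b = (2 ^ m \<le> k)"
  define j where "j = k - (if b then 2 ^ m else 0)"
  have "j < 2 ^ m" using Suc.prems by (auto simp: j_def b_def)
  then obtain w where w: "length w = m" "bin_val w = real j / 2 ^ m" using Suc.IH by blast
  have "real k = real j + of_bool b * 2 ^ m" by (auto simp: j_def b_def of_nat_diff)
  then show ?case using w by (intro exI[of _ "b # w"]) (auto simp: field_simps)
qed

section \<open>Collapsing the caps\<close>

text \<open>The coordinate in which \<open>[0, 1]\<close> becomes the cell \<open>[1/6, 5/6]\<close>.  The rest of the circle, the cap of the arc
with label \<open>0\<close>, is \<open>[-1/2, 0]\<close> in this coordinate.\<close>

definition tau :: "real \<Rightarrow> real" where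
  "tau s = 1/6 + 2/3 * s"

definition cell :: "node \<Rightarrow> real \<times> real" where
  "cell w = (tau (cantor_val w), tau (cantor_val w + 1 / 4 ^ length w))"

definition label_cell :: "node \<Rightarrow> real \<times> real" where
  "label_cell w = (bin_val w, bin_val w + 1 / 2 ^ length w)"

text \<open>The central arcs are indexed by \<open>None\<close>, the arc with label \<open>0\<close>, and by \<open>Some w\<close>, the primary arc of the
cell of \<open>w\<close>.  The cap of an arc is the circle interval that it cuts off from the center of the disk.\<close>

fun cap :: "node option \<Rightarrow> real \<times> real" where
  "cap None = (- 1/6, 1/6)"
| "cap (Some v) = (tau (gapl v), tau (gapr v))"

fun lab :: "node option \<Rightarrow> real" where
  "lab None = 0"
| "lab (Some v) = bin_mid v"

definition central_arc :: "node option \<Rightarrow> complex set" where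
  "central_arc e = {circ (fst (cap e)), circ (snd (cap e))}"

definition closed_cap :: "node option \<Rightarrow> complex set" where
  "closed_cap e = circ ` {fst (cap e)..snd (cap e)}"

definition open_cap :: "node option \<Rightarrow> complex set" where
  "open_cap e = circ ` {fst (cap e)<..<snd (cap e)}"

definition limit_set :: "complex set" where
  "limit_set = circ ` tau ` cantor"

text \<open>The half-open interval \<open>[-1/6, 5/6)\<close> is a fundamental domain of the circle; on its part left of \<open>1/6\<close>
the argument of the staircase function is at most \<open>0\<close>, so the cap of the arc with label \<open>0\<close> collapses.\<close>

definition collapse :: "complex \<Rightarrow> complex" where
  "collapse z = circ (stair ((6 * (THE t. - 1/6 \<le> t \<and> t < 5/6 \<and> circ t = z) - 1) / 4))"

lemma tau_simps [simp]: "tau s < tau t \<longleftrightarrow> s < t" "tau s \<le> tau t \<longleftrightarrow> s \<le> t" "tau s = tau t \<longleftrightarrow> s = t"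
  by (auto simp: tau_def)

lemma tau_inverse: "tau ((6 * t - 1) / 4) = t" "(6 * tau s - 1) / 4 = s"
  by (auto simp: tau_def field_simps)

lemma tau_values: "tau 0 = 1/6" "tau 1 = 5/6" "tau (- 1/2) = - 1/6" "tau (- (1/2)) = - (1/6)"
  by (auto simp: tau_def)

lemma continuous_on_tau: "continuous_on S tau"
  unfolding tau_def [abs_def] by (intro continuous_intros)

lemma continuous_on_circ_tau: "continuous_on S (\<lambda>s. circ (tau s))"
  by (rule continuous_on_compose2[OF continuous_on_circ[of UNIV] continuous_on_tau]) simp

lemma circle_param:
  assumes "z \<in> circle"
  obtains s where "- 1/2 \<le> s" "s < 1" "z = circ (tau s)"
proof -
  obtain t where "- 1/6 \<le> t" "t < - 1/6 + 1" "circ t = z" using circ_surj[OF assms] by metis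
  then show ?thesis using that[of "(6 * t - 1) / 4"] by (simp add: tau_inverse)
qed

lemma circ_tau_one: "circ (tau 1) = circ (tau (- 1/2))"
  using circ_add_1[of "- 1/6"] by (simp add: tau_values)

lemma collapse_circ_tau:
  assumes "- 1/2 \<le> s" "s \<le> 1"
  shows "collapse (circ (tau s)) = circ (stair s)"
proof -
  have *: "collapse (circ (tau s)) = circ (stair s)" if s: "- 1/2 \<le> s" "s < 1" for s
  proof -
    have "(THE t. - 1/6 \<le> t \<and> t < 5/6 \<and> circ t = circ (tau s)) = tau s"
    proof (rule the_equality)
      show "- 1/6 \<le> tau s \<and> tau s < 5/6 \<and> circ (tau s) = circ (tau s)"
        using s by (auto simp: tau_def)
      fix t assume t: "- 1/6 \<le> t \<and> t < 5/6 \<and> circ t = circ (tau s)"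
      then have "\<bar>t - tau s\<bar> < 1" using s by (auto simp: tau_def)
      then show "t = tau s" using t circ_eq_near by blast
    qed
    then show ?thesis by (simp add: collapse_def tau_inverse)
  qed
  show ?thesis
  proof (cases "s = 1")
    case True
    have "circ (stair (- 1/2)) = circ (stair 1)"
      using circ_add_1[of 0] by (simp add: stair_le_0 stair_ge_1)
    then show ?thesis unfolding True circ_tau_one using *[of "- 1/2"] by simp
  qed (use * assms in auto)
qed

lemma norm_collapse [simp]: "norm (collapse z) = 1"
  by (simp add: collapse_def)

text \<open>A continuous map from a compact space onto a Hausdorff space is a quotient map.\<close>

lemma continuous_on_compact_image:
  fixes c :: "'a::topological_space \<Rightarrow> 'b::metric_space" and f :: "'b \<Rightarrow> 'c::topological_space"
  assumes "compact S" "continuous_on S c" "continuous_on S (\<lambda>x. f (c x))"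
  shows "continuous_on (c ` S) f"
proof -
  have "quotient_map (top_of_set S) (top_of_set (c ` S)) c"
  proof (rule continuous_imp_quotient_map)
    show "continuous_map (top_of_set S) (top_of_set (c ` S)) c" using assms(2) by auto
    show "compact_space (top_of_set S)" using assms(1) by (simp add: compact_space_subtopology)
    show "Hausdorff_space (top_of_set (c ` S))"
      by (rule Hausdorff_space_subtopology) (rule Hausdorff_space_euclidean)
  qed simp
  moreover have "continuous_map (top_of_set S) euclidean (f \<circ> c)" using assms(3) by (simp add: o_def)
  ultimately have "continuous_map (top_of_set (c ` S)) euclidean f"
    by (simp only: continuous_compose_quotient_map_eq)
  then show ?thesis by simp
qed

lemma circle_eq_image: "circle = (\<lambda>s. circ (tau s)) ` {- 1/2..1}"
proof
  show "circle \<subseteq> (\<lambda>s. circ (tau s)) ` {- 1/2..1}"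
  proof
    fix z assume z: "z \<in> circle"
    obtain s where "- 1/2 \<le> s" "s < 1" "z = circ (tau s)" using circle_param[OF z] by metis
    then show "z \<in> (\<lambda>s. circ (tau s)) ` {- 1/2..1}" by (intro image_eqI[of _ _ s]) auto
  qed
qed auto

lemma continuous_on_collapse: "continuous_on circle collapse"
  unfolding circle_eq_image
proof (rule continuous_on_compact_image)
  have "continuous_on {- 1/2..1} (\<lambda>s. circ (stair s))"
    by (rule continuous_on_compose2[OF continuous_on_circ[of UNIV] continuous_on_stair]) simp
  then show "continuous_on {- 1/2..1} (\<lambda>s. collapse (circ (tau s)))"
    by (rule continuous_on_eq) (simp add: collapse_circ_tau)
qed (auto intro: continuous_on_circ_tau)

lemma lab_bounds: "0 \<le> lab e" "lab e < 1"
  using bin_mid_bounds by (cases e; simp add: less_imp_le)+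

lemma lab_inj: "circ (lab e) = circ (lab e') \<Longrightarrow> e = e'"
proof -
  assume "circ (lab e) = circ (lab e')"
  moreover have "\<bar>lab e - lab e'\<bar> < 1" using lab_bounds[of e] lab_bounds[of e'] by linarith
  ultimately have eq: "lab e = lab e'" by (rule circ_eq_near)
  show ?thesis
  proof (cases e)
    case None
    then show ?thesis using eq bin_mid_bounds(1)[of "the e'"] by (cases e') auto
  next
    case (Some v)
    then show ?thesis using eq bin_mid_bounds(1)[of v] bin_mid_inj by (cases e') auto
  qed
qed

lemma cap_nonempty: "fst (cap e) < snd (cap e)"
  using gapl_less_gapr by (cases e) auto

lemma cap_range: "- 1/6 \<le> fst (cap e)" "snd (cap e) < 5/6"
  using gapl_pos[of "the e"] gapr_less_1[of "the e"] by (cases e; auto simp: tau_def)+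

lemma cap_short: "snd (cap e) - fst (cap e) \<le> 1/3"
proof (cases e)
  case (Some v)
  have "(2/3) * (1 / (2 * 4 ^ length v)) \<le> (1/3::real)"
    by (simp add: field_simps)
  then show ?thesis using Some by (simp add: tau_def gapl_eq gapr_eq field_simps)
qed simp

lemma collapse_eq_lab_iff:
  assumes "- 1/6 \<le> t" "t < 5/6"
  shows "collapse (circ t) = circ (lab e) \<longleftrightarrow> fst (cap e) \<le> t \<and> t \<le> snd (cap e)"
proof -
  define s where "s = (6 * t - 1) / 4"
  have ts: "t = tau s" by (simp add: s_def tau_inverse)
  have s: "- 1/2 \<le> s" "s < 1" using assms by (auto simp: s_def)
  have "collapse (circ t) = circ (stair s)" unfolding ts using s by (intro collapse_circ_tau) auto
  moreover have "\<bar>stair s - lab e\<bar> < 1"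
    using lab_bounds[of e] stair_ge_0[of s] stair_less_1[of s] s by linarith
  ultimately have "collapse (circ t) = circ (lab e) \<longleftrightarrow> stair s = lab e"
    using circ_eq_near by fastforce
  also have "\<dots> \<longleftrightarrow> fst (cap e) \<le> t \<and> t \<le> snd (cap e)"
  proof (cases e)
    case None
    have "stair s = 0 \<longleftrightarrow> s \<le> 0" using stair_le_0[of s] stair_pos[of s] by force
    then show ?thesis using None s by (auto simp: ts tau_def)
  next
    case (Some v)
    then show ?thesis by (simp add: ts stair_eq_bin_mid_iff)
  qed
  finally show ?thesis .
qed

lemma collapse_cap: "fst (cap e) \<le> t \<Longrightarrow> t \<le> snd (cap e) \<Longrightarrow> collapse (circ t) = circ (lab e)"
  using collapse_eq_lab_iff[of t e] cap_range[of e] by auto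

lemma closed_cap_iff: "x \<in> circle \<Longrightarrow> x \<in> closed_cap e \<longleftrightarrow> collapse x = circ (lab e)"
proof -
  assume x: "x \<in> circle"
  obtain t where t: "- 1/6 \<le> t" "t < - 1/6 + 1" "circ t = x" using circ_surj[OF x] by metis
  show ?thesis
  proof
    assume "x \<in> closed_cap e"
    then show "collapse x = circ (lab e)" using collapse_cap by (auto simp: closed_cap_def)
  next
    assume "collapse x = circ (lab e)"
    then have "fst (cap e) \<le> t" "t \<le> snd (cap e)" using t collapse_eq_lab_iff[of t e] by auto
    then show "x \<in> closed_cap e" using t by (auto simp: closed_cap_def)
  qed
qed

lemma open_cap_subset: "open_cap e \<subseteq> closed_cap e"
  by (auto simp: open_cap_def closed_cap_def)

lemma closed_cap_circle: "closed_cap e \<subseteq> circle"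
  by (auto simp: closed_cap_def)

lemma central_arc_subset_closed_cap: "central_arc e \<subseteq> closed_cap e"
  using cap_nonempty[of e] by (auto simp: central_arc_def closed_cap_def)

lemma closed_cap_eq: "closed_cap e = open_cap e \<union> central_arc e"
proof -
  have "{fst (cap e)..snd (cap e)} = {fst (cap e)<..<snd (cap e)} \<union> {fst (cap e), snd (cap e)}"
    using cap_nonempty[of e] by auto
  then show ?thesis unfolding closed_cap_def open_cap_def central_arc_def by (simp only: image_Un) simp
qed

lemma central_arc_circle: "central_arc e \<subseteq> circle"
  using central_arc_subset_closed_cap closed_cap_circle by blast

lemma closed_caps_disjoint: "x \<in> closed_cap e \<Longrightarrow> x \<in> closed_cap e' \<Longrightarrow> e = e'"
  using closed_cap_iff[of x e] closed_cap_iff[of x e'] closed_cap_circle[of e] lab_inj[of e e'] by auto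

lemma central_arc_open_cap_disjoint: "x \<in> central_arc e \<Longrightarrow> x \<notin> open_cap e'"
proof
  assume x: "x \<in> central_arc e" "x \<in> open_cap e'"
  then have e: "e = e'"
    by (intro closed_caps_disjoint[OF subsetD[OF central_arc_subset_closed_cap] subsetD[OF open_cap_subset]])
  from x obtain t where t: "circ t = x" "fst (cap e) < t" "t < snd (cap e)" by (auto simp: open_cap_def e)
  have "circ t \<noteq> circ (fst (cap e))" "circ t \<noteq> circ (snd (cap e))"
    using circ_eq_near[of t "fst (cap e)"] circ_eq_near[of t "snd (cap e)"] t cap_short[of e] by auto
  then show False using x t by (auto simp: central_arc_def)
qed

lemma limit_set_iff: "z \<in> circle \<Longrightarrow> z \<in> limit_set \<longleftrightarrow> (\<forall>e. z \<notin> open_cap e)"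
proof -
  assume z: "z \<in> circle"
  show ?thesis
  proof
    assume "z \<in> limit_set"
    then obtain s where s: "s \<in> cantor" "z = circ (tau s)" by (auto simp: limit_set_def)
    show "\<forall>e. z \<notin> open_cap e"
    proof (rule allI, rule notI)
      fix e assume "z \<in> open_cap e"
      then obtain t where t: "z = circ t" "fst (cap e) < t" "t < snd (cap e)"
        by (auto simp: open_cap_def)
      have "\<bar>t - tau s\<bar> < 1" using t cap_range[of e] cantor_bounds[OF s(1)] by (auto simp: tau_def)
      then have ts: "t = tau s" using t s circ_eq_near by metis
      show False
        using t s cantor_bounds[OF s(1)] unfolding ts
        by (cases e) (auto simp: tau_def cantor_def)
    qed
  next
    assume o: "\<forall>e. z \<notin> open_cap e"
    obtain s where s: "- 1/2 \<le> s" "s < 1" "z = circ (tau s)" using circle_param[OF z] by metis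
    show "z \<in> limit_set"
    proof (cases "s < 0")
      case True
      then have "s = - 1/2" using o[rule_format, of None] s
        by (force simp: open_cap_def tau_def)
      then show ?thesis using s circ_tau_one one_in_cantor unfolding limit_set_def by (metis imageI)
    next
      case False
      have "\<not> (gapl v < s \<and> s < gapr v)" for v
        using o[rule_format, of "Some v"] s by (auto simp: open_cap_def)
      then have "s \<in> cantor" using s False by (auto simp: cantor_def)
      then show ?thesis using s by (auto simp: limit_set_def)
    qed
  qed
qed

lemma limit_set_circle: "limit_set \<subseteq> circle"
  by (auto simp: limit_set_def)

lemma central_arc_limit_set: "central_arc e \<subseteq> limit_set"
proof
  fix x assume x: "x \<in> central_arc e"
  then have "x \<in> circle" using central_arc_circle by blast
  then show "x \<in> limit_set" using limit_set_iff[of x] central_arc_open_cap_disjoint[OF x] by blast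
qed

lemma compact_limit_set: "compact limit_set"
  unfolding limit_set_def
  by (intro compact_continuous_image continuous_on_circ compact_cantor continuous_on_tau)

text \<open>The caps are the only source of non-injectivity, by \<open>stair_fibre\<close> within \<open>[1/6, 5/6]\<close>; points with the
value \<open>circ 0\<close> lie in the cap of the arc with label \<open>0\<close>.\<close>

lemma collapse_fibre:
  assumes "x \<in> circle" "y \<in> circle" "collapse x = collapse y" "x \<noteq> y"
  obtains e where "x \<in> closed_cap e" "y \<in> closed_cap e"
proof -
  obtain s where s: "- 1/2 \<le> s" "s < 1" "x = circ (tau s)" using circle_param[OF assms(1)] by metis
  obtain t where t: "- 1/2 \<le> t" "t < 1" "y = circ (tau t)" using circle_param[OF assms(2)] by metis
  have "circ (stair s) = circ (stair t)" using assms s t by (simp add: collapse_circ_tau)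
  moreover have "\<bar>stair s - stair t\<bar> < 1"
    using stair_ge_0[of s] stair_ge_0[of t] stair_less_1[of s] stair_less_1[of t] s t by linarith
  ultimately have eq: "stair s = stair t" by (rule circ_eq_near)
  have "\<exists>e. lab e = stair s"
  proof (cases "s \<le> 0 \<or> t \<le> 0")
    case True
    then have "stair s = 0" using eq stair_le_0[of s] stair_le_0[of t] by auto
    then show ?thesis by (intro exI[of _ None]) simp
  next
    case False
    have "s \<noteq> t" using assms s t by auto
    then obtain v where "gapl v \<le> min s t" "max s t \<le> gapr v"
    proof (cases s t rule: linorder_cases)
      case less
      then show thesis using stair_fibre[of s t] that False s t eq
        by (metis max.absorb2 min.absorb1 less_imp_le not_le)
    next
      case greater
      then show thesis using stair_fibre[of t s] that False s t eq
        by (metis max.absorb1 min.absorb2 less_imp_le not_le)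
    qed (use \<open>s \<noteq> t\<close> in auto)
    then have "stair s = bin_mid v" using stair_gap[of v s] by simp
    then show ?thesis by (intro exI[of _ "Some v"]) simp
  qed
  then obtain e where e: "lab e = stair s" by blast
  have "collapse x = circ (lab e)" using s e by (simp add: collapse_circ_tau)
  then show ?thesis using that[of e] closed_cap_iff[OF assms(1)] closed_cap_iff[OF assms(2)] assms(3) by simp
qed

lemma collapse_fibre_limit_set:
  assumes "x \<in> limit_set" "y \<in> limit_set" "collapse x = collapse y" "x \<noteq> y"
  obtains e where "{x, y} = central_arc e"
proof -
  obtain e where e: "x \<in> closed_cap e" "y \<in> closed_cap e"
    using collapse_fibre[of x y] assms limit_set_circle by (metis subsetD)
  then have "x \<in> central_arc e" "y \<in> central_arc e"
    using assms closed_cap_eq[of e] limit_set_iff[of x] limit_set_iff[of y] limit_set_circle by auto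
  then have "{x, y} = central_arc e" using assms(4) by (auto simp: central_arc_def)
  then show ?thesis using that by blast
qed

lemma collapse_central_arc: "x \<in> central_arc e \<Longrightarrow> collapse x = circ (lab e)"
  using central_arc_subset_closed_cap[of e] closed_cap_iff[of x e] central_arc_circle[of e] by blast

lemma collapse_limit_set_surj:
  assumes "d \<in> circle"
  obtains x where "x \<in> limit_set" "collapse x = d"
proof -
  obtain u where u: "0 \<le> u" "u < 0 + 1" "circ u = d" using circ_surj[OF assms] by metis
  then obtain s where "s \<in> cantor" "stair s = u" using cantor_surj[of u] by auto
  then show ?thesis using that[of "circ (tau s)"] u cantor_bounds[of s]
    by (simp add: limit_set_def collapse_circ_tau)
qed

text \<open>Each point of the Cantor set lies in cells of all levels, which shrink, and each cell starts at an end
of a central arc.\<close>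

lemma limit_set_eq_closure: "limit_set = closure (\<Union>(range central_arc))"
proof
  show "closure (\<Union>(range central_arc)) \<subseteq> limit_set"
    by (intro closure_minimal compact_imp_closed compact_limit_set UN_least central_arc_limit_set)
  show "limit_set \<subseteq> closure (\<Union>(range central_arc))"
  proof
    fix x assume "x \<in> limit_set"
    then obtain s where s: "s \<in> cantor" "x = circ (tau s)" by (auto simp: limit_set_def)
    have "\<exists>w. length w = n \<and> cantor_val w \<le> s \<and> s \<le> cantor_val w + 1 / 4 ^ n" for n
      by (rule cantor_in_cell[OF s(1), of n]) blast
    then have "\<exists>w. \<forall>n. length (w n) = n \<and> cantor_val (w n) \<le> s \<and> s \<le> cantor_val (w n) + 1 / 4 ^ n"
      by (intro choice allI)
    then obtain w where w: "length (w n) = n" "cantor_val (w n) \<le> s" "s \<le> cantor_val (w n) + 1 / 4 ^ n" for n by blast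
    have p: "circ (tau (cantor_val (w n))) \<in> \<Union>(range central_arc)" for n
    proof -
      from cell_start_gap_end[of "w n"] have "circ (tau (cantor_val (w n))) \<in> central_arc None \<or> (\<exists>v. circ (tau (cantor_val (w n))) \<in> central_arc (Some v))"
        by (auto simp: central_arc_def tau_values)
      then show ?thesis by blast
    qed
    have "(\<lambda>n. cantor_val (w n)) \<longlonglongrightarrow> s"
    proof (rule tendsto_sandwich[of "\<lambda>n. s - 1 / 4 ^ n"])
      have "(\<lambda>n. s - (1/4) ^ n) \<longlonglongrightarrow> s - 0" by (intro tendsto_intros) auto
      then show "(\<lambda>n. s - 1 / 4 ^ n) \<longlonglongrightarrow> s" by (simp add: power_divide)
      show "\<forall>\<^sub>F n in sequentially. s - 1 / 4 ^ n \<le> cantor_val (w n)"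
        using w(3) by (intro always_eventually allI) (simp add: diff_le_eq)
      show "\<forall>\<^sub>F n in sequentially. cantor_val (w n) \<le> s"
        by (intro always_eventually allI w(2))
    qed simp
    then have "(\<lambda>n. circ (tau (cantor_val (w n)))) \<longlonglongrightarrow> circ (tau s)"
      using continuous_on_tendsto_compose[OF continuous_on_circ_tau[of UNIV]] by simp
    then show "x \<in> closure (\<Union>(range central_arc))"
      unfolding closure_sequential s(2)
      by (intro exI[of _ "\<lambda>n. circ (tau (cantor_val (w n)))"] conjI allI p)
  qed
qed

lemma cell_point: "fst (cell w) + s * (snd (cell w) - fst (cell w)) = tau (cantor_val w + s / 4 ^ length w)"
  by (simp add: cell_def tau_def algebra_simps)

lemma label_cell_point:
  "fst (label_cell w) + s * (snd (label_cell w) - fst (label_cell w)) = bin_val w + s / 2 ^ length w"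
  by (simp add: label_cell_def)

lemma cell_point_bounds: "0 \<le> s \<Longrightarrow> s \<le> 1 \<Longrightarrow> 0 \<le> cantor_val w + s / 4 ^ length w"
  "0 \<le> s \<Longrightarrow> s \<le> 1 \<Longrightarrow> cantor_val w + s / 4 ^ length w \<le> 1"
proof -
  assume s: "0 \<le> s" "s \<le> 1"
  have "s / 4 ^ length w \<le> 1 / 4 ^ length w" using s by (simp add: divide_right_mono)
  then show "cantor_val w + s / 4 ^ length w \<le> 1" using cantor_val_le_1[of w] by simp
qed (simp add: cantor_val_ge_0)

lemma collapse_cell:
  assumes "0 \<le> s" "s \<le> 1"
  shows "collapse (circ (tau (cantor_val w + s / 4 ^ length w))) = circ (bin_val w + stair s / 2 ^ length w)"
  using collapse_circ_tau[of "cantor_val w + s / 4 ^ length w"] stair_cell[of s w] assms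
    cell_point_bounds[of s w] by simp

section \<open>The shape of central_arc diagrams\<close>

text \<open>The leaves \<open>S\<close> of a finite binary tree, together with the indices \<open>E\<close> of the central arcs that produce it.
The tree with a single leaf stands for the arc with label \<open>0\<close> alone; this is not an arc diagram yet,
hence the condition \<open>[] \<notin> S\<close> in later statements.\<close>

inductive halved :: "node set \<Rightarrow> node option set \<Rightarrow> bool" where
  root: "halved {[]} {None}"
| split: "halved S E \<Longrightarrow> v \<in> S \<Longrightarrow>
    halved (S - {v} \<union> {v @ [False], v @ [True]}) (insert (Some v) E)"

definition in_cap :: "node option \<Rightarrow> real \<times> real \<Rightarrow> bool" where
  "in_cap e p \<longleftrightarrow> fst (cap e) \<le> fst p \<and> fst p < snd p \<and> snd p \<le> snd (cap e)"

lemma cell_children: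
  "cell (w @ [False]) = (fst (cell w), fst (cell w) + (snd (cell w) - fst (cell w)) / 4)"
  "cell (w @ [True]) = (snd (cell w) - (snd (cell w) - fst (cell w)) / 4, snd (cell w))"
  "cap (Some w) = (fst (cell w) + (snd (cell w) - fst (cell w)) / 4,
    snd (cell w) - (snd (cell w) - fst (cell w)) / 4)"
proof -
  define d :: real where "d = 1 / 4 ^ length w"
  have "gapl w = cantor_val w + d / 4" "gapr w = cantor_val w + 3 * d / 4" "cell w = (tau (cantor_val w), tau (cantor_val w + d))"
    "cell (w @ [False]) = (tau (cantor_val w), tau (cantor_val w + d / 4))"
    "cell (w @ [True]) = (tau (cantor_val w + 3 * d / 4), tau (cantor_val w + 3 * d / 4 + d / 4))"
    by (simp_all add: gapl_eq gapr_eq cell_def cantor_val_append d_def)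
  then show "cell (w @ [False]) = (fst (cell w), fst (cell w) + (snd (cell w) - fst (cell w)) / 4)"
    "cell (w @ [True]) = (snd (cell w) - (snd (cell w) - fst (cell w)) / 4, snd (cell w))"
    "cap (Some w) = (fst (cell w) + (snd (cell w) - fst (cell w)) / 4,
      snd (cell w) - (snd (cell w) - fst (cell w)) / 4)"
    by (simp_all add: tau_def field_simps)
qed

lemmas cap_cell = cell_children(3)

lemma primary_arc_cell: "primary_arc (cell w) = central_arc (Some w)"
  unfolding central_arc_def cap_cell by (simp add: primary_arc_def case_prod_beta)

lemma cell_inj: "cell v = cell w \<Longrightarrow> v = w"
proof -
  assume "cell v = cell w"
  then have "cap (Some v) = cap (Some w)" by (simp only: cap_cell)
  then have "stair (gapl v) = stair (gapl w)" by simp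
  then show ?thesis using bin_mid_inj stair_gap[of v "gapl v"] stair_gap[of w "gapl w"]
      gapl_less_gapr[of v] gapl_less_gapr[of w] by simp
qed

lemma cell_eq_iff [simp]: "cell v = cell w \<longleftrightarrow> v = w"
  using cell_inj by blast

lemma stair_cell_ends: "stair (cantor_val w) = bin_val w" "stair (cantor_val w + 1 / 4 ^ length w) = bin_val w + 1 / 2 ^ length w"
  using stair_cell[of 0 w] stair_cell[of 1 w] by (simp_all add: stair_le_0 stair_ge_1)

text \<open>The staircase function is constant on a cap and takes different values at the ends of a cell.\<close>

lemma cell_not_in_cap: "\<not> in_cap e (cell w)"
proof
  assume c: "in_cap e (cell w)"
  show False
  proof (cases e)
    case None
    then have "tau (cantor_val w + 1 / 4 ^ length w) \<le> tau 0"
      using c by (simp add: in_cap_def cell_def tau_values)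
    moreover have "0 < 1 / (4::real) ^ length w" by simp
    ultimately show False using cantor_val_ge_0[of w] unfolding tau_simps by linarith
  next
    case (Some v)
    then have "gapl v \<le> cantor_val w" "cantor_val w + 1 / 4 ^ length w \<le> gapr v" 
      using c by (auto simp: in_cap_def cell_def)
    moreover have "0 < 1 / (4::real) ^ length w" by simp
    ultimately have "stair (cantor_val w) = bin_mid v" "stair (cantor_val w + 1 / 4 ^ length w) = bin_mid v"
      by (intro stair_gap; linarith)+
    then show False by (simp add: stair_cell_ends)
  qed
qed

lemma in_cap_cap: "in_cap e (cap e)"
  using cap_nonempty by (simp add: in_cap_def)

lemma cell_not_cap: "cell w \<noteq> cap e"
  using cell_not_in_cap in_cap_cap by metis

lemma primary_arc_in_cap:
  assumes "in_cap e (a, b)"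
  shows "primary_arc (a, b) \<noteq> {}" "primary_arc (a, b) \<subseteq> open_cap e"
proof -
  have b: "fst (cap e) \<le> a" "a < b" "b \<le> snd (cap e)" using assms by (auto simp: in_cap_def)
  obtain d where d: "0 < d" "b = a + 4 * d" using b by (intro that[of "(b - a) / 4"]) (simp_all add: field_simps)
  have "a + (b - a) / 4 \<in> {fst (cap e)<..<snd (cap e)} \<and> b - (b - a) / 4 \<in> {fst (cap e)<..<snd (cap e)}"
    using b d by auto
  then show "primary_arc (a, b) \<subseteq> open_cap e"
    unfolding primary_arc_def open_cap_def by auto
qed (simp add: primary_arc_def)

lemma in_cap_pieces:
  assumes "in_cap e (a, b)"
  shows "in_cap e (a, a + (b - a) / 4)" "in_cap e (a + (b - a) / 4, b - (b - a) / 4)"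
    "in_cap e (b - (b - a) / 4, b)"
proof -
  have b: "fst (cap e) \<le> a" "a < b" "b \<le> snd (cap e)" using assms by (auto simp: in_cap_def)
  obtain d where d: "0 < d" "b = a + 4 * d" using b by (intro that[of "(b - a) / 4"]) (simp_all add: field_simps)
  have "in_cap e (a, a + (b - a) / 4) \<and> in_cap e (a + (b - a) / 4, b - (b - a) / 4) \<and>
    in_cap e (b - (b - a) / 4, b)"
    using b d unfolding in_cap_def by auto
  then show "in_cap e (a, a + (b - a) / 4)" "in_cap e (a + (b - a) / 4, b - (b - a) / 4)"
    "in_cap e (b - (b - a) / 4, b)" by blast+
qed

lemma central_arc_None: "central_arc None = {circ (1/6), circ (5/6)}"
  using circ_add_1[of "- (1/6)"] by (auto simp: central_arc_def)

lemma diagram_base: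
  "{(1/6, 1/3), (1/3, 2/3), (2/3, 5/6), (-1/6, 1/6)} = cell ` {[False], [True]} \<union> cap ` {None, Some []}"
  "{{circ (1/3), circ (2/3)}, {circ (1/6), circ (5/6)}} = central_arc ` {None, Some []}"
proof -
  have "cell [False] = (1/6, 1/3)" "cell [True] = (2/3, 5/6)" "cap (Some []) = (1/3, 2/3)"
    by (simp_all add: cell_def tau_def)
  note eqs = this
  show "{(1/6, 1/3), (1/3, 2/3), (2/3, 5/6), (-1/6, 1/6)}
      = cell ` {[False], [True]} \<union> cap ` {None, Some []}"
    unfolding image_insert image_empty cap.simps(1) eqs by blast
  have eq: "central_arc (Some []) = {circ (1/3), circ (2/3)}" by (simp add: central_arc_def tau_def)
  show "{{circ (1/3), circ (2/3)}, {circ (1/6), circ (5/6)}} = central_arc ` {None, Some []}"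
    unfolding image_insert image_empty central_arc_None eq by blast
qed

text \<open>Besides cells and central arcs a diagram has intervals \<open>N\<close> and arcs \<open>M\<close> inside caps.  Subdividing a cell
produces two cells and a cap; subdividing an interval inside a cap stays inside this cap, and the new
arc has both ends strictly inside.  As long as \<open>M\<close> is empty no cap has been subdivided, so that the
intervals in \<open>N\<close> are entire caps.\<close>

lemma arc_diagram_structure:
  assumes "arc_diagram I \<A>"
  obtains S E N M where "halved S E" "[] \<notin> S" "I = cell ` S \<union> N" "\<A> = central_arc ` E \<union> M"
    "\<And>p. p \<in> N \<Longrightarrow> \<exists>e. in_cap e p" "\<And>A. A \<in> M \<Longrightarrow> A \<noteq> {} \<and> (\<exists>e. A \<subseteq> open_cap e)"
    "M = {} \<Longrightarrow> N = cap ` E"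
proof -
  from assms have "\<exists>S E N M. halved S E \<and> [] \<notin> S \<and> I = cell ` S \<union> N \<and> \<A> = central_arc ` E \<union> M \<and>
    (\<forall>p\<in>N. \<exists>e. in_cap e p) \<and> (\<forall>A\<in>M. A \<noteq> {} \<and> (\<exists>e. A \<subseteq> open_cap e)) \<and> (M = {} \<longrightarrow> N = cap ` E)"
  proof induction
    case base
    have "halved {[False], [True]} {None, Some []}"
      using halved.split[OF halved.root, of "[]"] by (simp add: insert_commute)
    then show ?case
      unfolding diagram_base using in_cap_cap
      by (intro exI[of _ "{[False], [True]}"] exI[of _ "{None, Some []}"] exI[of _ "cap ` {None, Some []}"]
          exI[of _ "{}"]) blast
  next
    case (step I \<A> a b)
    then obtain S E N M where h: "halved S E" "[] \<notin> S" and I: "I = cell ` S \<union> N" and A: "\<A> = central_arc ` E \<union> M"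
      and N: "\<forall>p\<in>N. \<exists>e. in_cap e p" and M: "\<forall>A\<in>M. A \<noteq> {} \<and> (\<exists>e. A \<subseteq> open_cap e)"
      and MN: "M = {} \<longrightarrow> N = cap ` E" by blast
    have cN: "cell w \<notin> N" for w using N cell_not_in_cap by blast
    from step.hyps I consider v where "v \<in> S" "(a, b) = cell v" | "(a, b) \<in> N" by blast
    then show ?case
    proof cases
      case 1
      let ?S = "S - {v} \<union> {v @ [False], v @ [True]}" and ?E = "insert (Some v) E"
      let ?N = "insert (cap (Some v)) N"
      have ab: "a = fst (cell v)" "b = snd (cell v)" using 1(2) by (simp_all add: prod_eq_iff)
      have pieces: "{(a, a + (b - a) / 4), (a + (b - a) / 4, b - (b - a) / 4), (b - (b - a) / 4, b)}
          = {cell (v @ [False]), cap (Some v), cell (v @ [True])}"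
        unfolding cell_children ab by simp
      have "I - {(a, b)} = cell ` (S - {v}) \<union> N"
      proof -
        have "cell ` S - {cell v} = cell ` (S - {v})" by auto
        then show ?thesis unfolding I 1(2) using cN[of v] by blast
      qed
      then have "I - {(a, b)} \<union> {(a, a + (b - a) / 4), (a + (b - a) / 4, b - (b - a) / 4),
            (b - (b - a) / 4, b)} = cell ` ?S \<union> ?N"
        unfolding pieces by (simp add: Un_ac insert_commute)
      moreover have "insert (primary_arc (a, b)) \<A> = central_arc ` ?E \<union> M"
        unfolding 1(2) primary_arc_cell A by simp
      moreover have "halved ?S ?E" using h 1 by (intro halved.split)
      moreover have "\<forall>p\<in>?N. \<exists>e. in_cap e p" using N in_cap_cap by blast
      moreover have "M = {} \<longrightarrow> ?N = cap ` ?E" using MN by auto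
      moreover have "[] \<notin> ?S" using h by auto
      ultimately show ?thesis using M
        by (intro exI[of _ ?S] exI[of _ ?E] exI[of _ ?N] exI[of _ M] conjI)
    next
      case 2
      then obtain e where e: "in_cap e (a, b)" using N by blast
      let ?P = "{(a, a + (b - a) / 4), (a + (b - a) / 4, b - (b - a) / 4), (b - (b - a) / 4, b)}"
      let ?N = "N - {(a, b)} \<union> ?P" and ?M = "insert (primary_arc (a, b)) M"
      have "(a, b) \<noteq> cell w" for w using cN[of w] 2 by auto
      then have "(a, b) \<notin> cell ` S" by blast
      then have "I - {(a, b)} \<union> ?P = cell ` S \<union> ?N" unfolding I by blast
      moreover have "insert (primary_arc (a, b)) \<A> = central_arc ` E \<union> ?M" unfolding A by auto
      moreover have "\<forall>p\<in>?N. \<exists>e. in_cap e p" using N in_cap_pieces[OF e] by blast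
      moreover have "\<forall>A\<in>?M. A \<noteq> {} \<and> (\<exists>e. A \<subseteq> open_cap e)" using M primary_arc_in_cap[OF e] by blast
      moreover have "?M \<noteq> {}" by simp
      ultimately show ?thesis using h
        by (intro exI[of _ S] exI[of _ E] exI[of _ ?N] exI[of _ ?M] conjI) blast+
    qed
  qed
  then show ?thesis
  proof (elim exE conjE)
    fix S E N M
    assume h: "halved S E" "[] \<notin> S" "I = cell ` S \<union> N" "\<A> = central_arc ` E \<union> M"
      and N: "\<forall>p\<in>N. \<exists>e. in_cap e p" and M: "\<forall>A\<in>M. A \<noteq> {} \<and> (\<exists>e. A \<subseteq> open_cap e)"
      and MN: "M = {} \<longrightarrow> N = cap ` E"
    show thesis
      by (rule that[OF h N[rule_format] M[rule_format] MN[rule_format]])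
  qed
qed

lemma halved_root: "halved S E \<Longrightarrow> [] \<in> S \<Longrightarrow> S = {[]} \<and> E = {None}"
  by (induction rule: halved.induct) auto

lemma halved_arc_diagram:
  "halved S E \<Longrightarrow> [] \<notin> S \<Longrightarrow> arc_diagram (cell ` S \<union> cap ` E) (central_arc ` E)"
proof (induction rule: halved.induct)
  case (split S E v)
  let ?S = "S - {v} \<union> {v @ [False], v @ [True]}" and ?E = "insert (Some v) E"
  show ?case
  proof (cases "[] \<in> S")
    case True
    have "S = {[]} \<and> E = {None}"
      using halved_root split.hyps(1) True by blast
    then have "?S = {[False], [True]}" "?E = {None, Some []}" using split.hyps by auto
    then show ?thesis using arc_diagram.base unfolding diagram_base by (simp only:)
  next
    case False
    then have IH: "arc_diagram (cell ` S \<union> cap ` E) (central_arc ` E)" using split.IH by blast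
    obtain a b where ab: "cell v = (a, b)" by force
    have ab': "a = fst (cell v)" "b = snd (cell v)" using ab by simp_all
    have pieces: "{(a, a + (b - a) / 4), (a + (b - a) / 4, b - (b - a) / 4), (b - (b - a) / 4, b)}
        = {cell (v @ [False]), cap (Some v), cell (v @ [True])}"
      unfolding cell_children ab' by simp
    have "arc_diagram (cell ` S \<union> cap ` E - {(a, b)} \<union> 
        {cell (v @ [False]), cap (Some v), cell (v @ [True])}) (insert (primary_arc (a, b)) (central_arc ` E))"
    proof -
      have "(a, b) \<in> cell ` S \<union> cap ` E" unfolding ab [symmetric] using split.hyps(2) by blast
      then show ?thesis unfolding pieces [symmetric] by (rule arc_diagram.step[OF IH])
    qed
    moreover have "cell ` S \<union> cap ` E - {(a, b)} \<union> {cell (v @ [False]), cap (Some v), cell (v @ [True])}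
        = cell ` ?S \<union> cap ` ?E"
    proof -
      have "cell ` S \<union> cap ` E - {(a, b)} = cell ` (S - {v}) \<union> cap ` E"
      proof -
        have "cell ` S - {cell v} = cell ` (S - {v})" by auto
        moreover have "cell v \<notin> cap ` E" using cell_not_cap by blast
        ultimately show ?thesis unfolding ab [symmetric] Un_Diff by simp
      qed
      then show ?thesis by auto
    qed
    moreover have "insert (primary_arc (a, b)) (central_arc ` E) = central_arc ` ?E"
      unfolding ab [symmetric] primary_arc_cell by simp
    ultimately show ?thesis by (simp only:)
  qed
qed simp

lemma halved_exists: "\<exists>S E. halved S E \<and> v \<in> S \<and> ([] \<in> S \<longrightarrow> v = [])"
proof (induction v rule: rev_induct)
  case Nil
  then show ?case using halved.root by blast
next
  case (snoc b v)
  then obtain S E where "halved S E" "v \<in> S" "[] \<in> S \<longrightarrow> v = []" by blast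
  then have "halved (S - {v} \<union> {v @ [False], v @ [True]}) (insert (Some v) E)"
    by (intro halved.split)
  then show ?case using \<open>[] \<in> S \<longrightarrow> v = []\<close>
    by (intro exI[of _ "S - {v} \<union> {v @ [False], v @ [True]}"] exI[of _ "insert (Some v) E"]) (cases b; auto)
qed

lemma central_arc_in_lamination: "central_arc e \<in> lamination"
proof -
  obtain S E where h: "halved S E" "[] \<notin> S" "e \<in> E"
  proof (cases e)
    case None
    have "halved {[False], [True]} {None, Some []}"
      using halved.split[OF halved.root, of "[]"] by (simp add: insert_commute)
    then show ?thesis using that None by blast
  next
    case (Some v)
    obtain S E where S: "halved S E" "v \<in> S" "[] \<in> S \<longrightarrow> v = []" using halved_exists by blast
    show ?thesis
      by (rule that[OF halved.split[OF S(1,2)]]) (use Some S in auto)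
  qed
  then show ?thesis using halved_arc_diagram[OF h(1,2)] unfolding lamination_def by blast
qed

lemma lamination_cases:
  assumes "A \<in> lamination"
  obtains e where "A = central_arc e" | e where "A \<noteq> {}" "A \<subseteq> open_cap e"
proof -
  obtain I \<A> where A: "arc_diagram I \<A>" "A \<in> \<A>" using assms by (auto simp: lamination_def)
  obtain E M where "\<A> = central_arc ` E \<union> M" and M: "\<And>A. A \<in> M \<Longrightarrow> A \<noteq> {} \<and> (\<exists>e. A \<subseteq> open_cap e)"
    using A(1) by (rule arc_diagram_structure) blast
  then consider "A \<in> M" | e where "A = central_arc e" using A(2) by blast
  then show ?thesis using that M by cases blast+
qed

text \<open>A split keeps the start of the dyadic interval and adds its midpoint, which is the label of the new arc.\<close>

lemma halved_labels: "halved S E \<Longrightarrow> lab ` E = bin_val ` S"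
proof (induction rule: halved.induct)
  case (split S E v)
  have "bin_val (v @ [False]) = bin_val v" "bin_val (v @ [True]) = bin_mid v"
    by (simp_all add: bin_val_append bin_mid_eq)
  then have "bin_val ` (S - {v} \<union> {v @ [False], v @ [True]}) = insert (bin_mid v) (bin_val ` S)"
    using split.hyps by (force simp: image_iff)
  then show ?case using split.IH by simp
qed simp

lemma disjoint_split:
  assumes S: "\<forall>x\<in>S. \<forall>y\<in>S. x \<noteq> y \<longrightarrow> f x \<inter> f y = {}" "v \<in> S"
    and ab: "f a \<subseteq> f v" "f b \<subseteq> f v" "f a \<inter> f b = {}"
  shows "\<forall>x\<in>S - {v} \<union> {a, b}. \<forall>y\<in>S - {v} \<union> {a, b}. x \<noteq> y \<longrightarrow> f x \<inter> f y = {}"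
proof -
  have "f x \<inter> f v = {}" if "x \<in> S - {v}" for x using S that by blast
  then have "f x \<inter> f a = {}" "f x \<inter> f b = {}" if "x \<in> S - {v}" for x using ab that by blast+
  then show ?thesis using S ab(3) by (simp add: Int_commute ball_Un)
qed

lemma halved_partition:
  assumes "halved S E"
  shows "finite S" "(\<Union>w\<in>S. {bin_val w..bin_val w + 1 / 2 ^ length w}) = {0..1}"
    "v \<in> S \<Longrightarrow> w \<in> S \<Longrightarrow> v \<noteq> w \<Longrightarrow>
      {bin_val v<..<bin_val v + 1 / 2 ^ length v} \<inter> {bin_val w<..<bin_val w + 1 / 2 ^ length w} = {}"
proof -
  let ?c = "\<lambda>w. {bin_val w..bin_val w + 1 / 2 ^ length w}" and ?o = "\<lambda>w. {bin_val w<..<bin_val w + 1 / 2 ^ length w}"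
  have "finite S \<and> (\<Union>w\<in>S. ?c w) = {0..1} \<and> (\<forall>v\<in>S. \<forall>w\<in>S. v \<noteq> w \<longrightarrow> ?o v \<inter> ?o w = {})"
    using assms
  proof induction
    case (split S E v)
    define d where "d = 1 / 2 ^ length v / (2::real)"
    have d: "0 < d" by (simp add: d_def)
    have c1: "?c (v @ [False]) = {bin_val v..bin_val v + d}" and c2: "?c (v @ [True]) = {bin_val v + d..bin_val v + d + d}"
      and c: "?c v = {bin_val v..bin_val v + d + d}"
      by (auto simp: bin_val_append d_def)
    have o1: "?o (v @ [False]) = {bin_val v<..<bin_val v + d}" and o2: "?o (v @ [True]) = {bin_val v + d<..<bin_val v + d + d}"
      and o: "?o v = {bin_val v<..<bin_val v + d + d}"
      by (auto simp: bin_val_append d_def)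
    have "?c v = ?c (v @ [False]) \<union> ?c (v @ [True])"
      unfolding c c1 c2 using d by auto
    then have "(\<Union>w\<in>S - {v} \<union> {v @ [False], v @ [True]}. ?c w) = (\<Union>w\<in>S. ?c w)"
      using split.hyps(2) by auto
    moreover have "?o (v @ [False]) \<subseteq> ?o v" "?o (v @ [True]) \<subseteq> ?o v"
      "?o (v @ [False]) \<inter> ?o (v @ [True]) = {}"
      unfolding o o1 o2 using d by auto
    moreover have "\<forall>x\<in>S. \<forall>y\<in>S. x \<noteq> y \<longrightarrow> ?o x \<inter> ?o y = {}" "finite S" "(\<Union>w\<in>S. ?c w) = {0..1}"
      using split.IH by blast+
    ultimately show ?case
      using disjoint_split[of S ?o v "v @ [False]" "v @ [True]"] split.hyps(2) by simp
  qed auto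
  then show "finite S" "(\<Union>w\<in>S. ?c w) = {0..1}" "v \<in> S \<Longrightarrow> w \<in> S \<Longrightarrow> v \<noteq> w \<Longrightarrow> ?o v \<inter> ?o w = {}"
    by blast+
qed

section \<open>The central gap\<close>

text \<open>The unit vector pointing to the middle of a cap.  The chord of the central arc consists of the points
of the disk whose inner product with this vector is \<open>cap_level\<close>; beyond it the inner product is larger.\<close>

definition cap_axis :: "node option \<Rightarrow> complex" where
  "cap_axis e = circ ((fst (cap e) + snd (cap e)) / 2)"

definition cap_level :: "node option \<Rightarrow> real" where
  "cap_level e = cos (pi * (snd (cap e) - fst (cap e)))"

text \<open>The radial isometry from the Poincare model to the Klein model, which turns geodesics into chords.\<close>

definition klein :: "complex \<Rightarrow> complex" where
  "klein z = (2 / (1 + (norm z)\<^sup>2)) *\<^sub>R z"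

definition inner_region :: "complex set" where
  "inner_region = {z \<in> ball 0 1. \<forall>e. cap_axis e \<bullet> klein z < cap_level e}"

lemma inner_circ: "circ a \<bullet> circ b = cos (2 * pi * (b - a))"
  by (simp add: circ_def inner_complex_def cos_diff right_diff_distrib)

lemma cap_level_pos: "0 < cap_level e"
proof -
  have "pi * (snd (cap e) - fst (cap e)) \<le> pi * (1/3)"
    using cap_short[of e] by (intro mult_left_mono) auto
  moreover have "0 < pi * (snd (cap e) - fst (cap e))" using cap_nonempty[of e] by simp
  ultimately show ?thesis unfolding cap_level_def using pi_gt_zero by (intro cos_gt_zero_pi) linarith+
qed

lemma cap_axis_central_arc: "x \<in> central_arc e \<Longrightarrow> cap_axis e \<bullet> x = cap_level e"
proof -
  define l r where lr: "l = fst (cap e)" "r = snd (cap e)"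
  have "cap_axis e \<bullet> circ l = cos (2 * pi * (l - (l + r) / 2))" "cap_axis e \<bullet> circ r = cos (2 * pi * (r - (l + r) / 2))"
    by (simp_all add: cap_axis_def inner_circ lr)
  moreover have "2 * pi * (l - (l + r) / 2) = - (pi * (r - l))" "2 * pi * (r - (l + r) / 2) = pi * (r - l)"
    by (simp_all add: field_simps)
  ultimately have "cap_axis e \<bullet> circ l = cap_level e" "cap_axis e \<bullet> circ r = cap_level e"
    by (simp_all only: cos_minus cap_level_def lr)
  then show "x \<in> central_arc e \<Longrightarrow> cap_axis e \<bullet> x = cap_level e" by (auto simp: central_arc_def lr)
qed

text \<open>The inner product of two unit vectors is the cosine of the angle between them, and the cosine is
decreasing on \<open>[0, \<pi>]\<close>.\<close>

lemma cap_axis_open_cap_iff: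
  assumes "x \<in> circle"
  shows "cap_level e < cap_axis e \<bullet> x \<longleftrightarrow> x \<in> open_cap e"
proof -
  define l r where lr: "l = fst (cap e)" "r = snd (cap e)"
  define m where "m = (l + r) / 2"
  have w: "0 < r - l" "r - l \<le> 1/3" using cap_nonempty[of e] cap_short[of e] by (auto simp: lr)
  obtain t where t: "m - 1/2 \<le> t" "t < m - 1/2 + 1" "circ t = x" using circ_surj[OF assms] by metis
  have "cap_axis e \<bullet> x = cos (2 * pi * (t - m))"
    unfolding t(3)[symmetric] by (simp add: cap_axis_def inner_circ lr m_def)
  also have "\<dots> = cos (2 * pi * \<bar>t - m\<bar>)"
  proof -
    have "2 * pi * \<bar>t - m\<bar> = \<bar>2 * pi * (t - m)\<bar>" by (simp add: abs_mult)
    then show ?thesis by (simp only: cos_abs_real)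
  qed
  finally have "cap_level e < cap_axis e \<bullet> x \<longleftrightarrow> cos (pi * (r - l)) < cos (2 * pi * \<bar>t - m\<bar>)"
    by (simp add: cap_level_def lr)
  also have "\<dots> \<longleftrightarrow> 2 * pi * \<bar>t - m\<bar> < pi * (r - l)"
  proof (rule cos_mono_less_eq)
    have "\<bar>t - m\<bar> \<le> 1/2" using t by linarith
    then have "2 * pi * \<bar>t - m\<bar> \<le> 2 * pi * (1/2)" by (intro mult_left_mono) auto
    then show "2 * pi * \<bar>t - m\<bar> \<le> pi" by simp
    have "pi * (r - l) \<le> pi * 1" using w by (intro mult_left_mono) auto
    then show "pi * (r - l) \<le> pi" by simp
  qed (use w in auto)
  also have "\<dots> \<longleftrightarrow> 2 * \<bar>t - m\<bar> < r - l"
  proof -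
    have "2 * pi * \<bar>t - m\<bar> = pi * (2 * \<bar>t - m\<bar>)" by simp
    then show ?thesis by (simp only: mult_less_cancel_left_pos[OF pi_gt_zero])
  qed
  also have "\<dots> \<longleftrightarrow> l < t \<and> t < r" unfolding m_def by (auto simp: abs_if field_simps)
  also have "\<dots> \<longleftrightarrow> x \<in> open_cap e"
  proof
    assume "x \<in> open_cap e"
    then obtain u where u: "l < u" "u < r" "x = circ u" by (auto simp: open_cap_def lr)
    have "\<bar>t - u\<bar> < 1" using u t w unfolding m_def by (auto simp: abs_if field_simps)
    then have "t = u" using u t circ_eq_near by metis
    then show "l < t \<and> t < r" using u by simp
  qed (use t in \<open>auto simp: open_cap_def lr\<close>)
  finally show ?thesis .
qed

lemma hull_height:
  assumes "z \<in> convex hull A" "\<And>x. x \<in> A \<Longrightarrow> a \<bullet> x \<le> c"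
  shows "a \<bullet> z \<le> c"
proof -
  have "convex hull A \<subseteq> {x. a \<bullet> x \<le> c}"
    using assms(2) by (intro hull_minimal convex_halfspace_le) auto
  then show ?thesis using assms(1) by auto
qed

lemma geodesic_klein: "z \<in> geodesic A \<longleftrightarrow> z \<in> cball 0 1 \<and> klein z \<in> convex hull A"
  by (auto simp: geodesic_def klein_def)

lemma klein_circle: "norm z = 1 \<Longrightarrow> klein z = z"
  by (simp add: klein_def)

lemma continuous_on_klein: "continuous_on S klein"
proof -
  have "1 + (norm z)\<^sup>2 \<noteq> 0" for z :: complex
    using zero_le_power2[of "norm z"] by linarith
  then show ?thesis unfolding klein_def [abs_def] by (intro continuous_intros) auto
qed

lemma norm_klein_le: "norm (klein z) \<le> 1"
proof -
  have "2 * norm z \<le> 1 + (norm z)\<^sup>2" using sum_squares_bound[of 1 "norm z"] by simp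
  moreover have "0 < 1 + (norm z)\<^sup>2" using zero_le_power2[of "norm z"] by linarith
  ultimately show ?thesis by (simp add: klein_def)
qed

text \<open>With \<open>r = |z|\<^sup>2\<close> the factor is \<open>t (1 + r) / (1 + t\<^sup>2 r)\<close>, which is less than \<open>1\<close> because
\<open>(1 - t) (1 - t r) > 0\<close>.\<close>

lemma klein_scaleR:
  assumes "0 \<le> t" "t < 1" "norm z \<le> 1"
  obtains m where "0 \<le> m" "m < 1" "klein (t *\<^sub>R z) = m *\<^sub>R klein z"
proof
  define r where "r = (norm z)\<^sup>2"
  have r: "0 \<le> r" "r \<le> 1" using assms by (auto simp: r_def power_le_one)
  let ?m = "t * (1 + r) / (1 + t\<^sup>2 * r)"
  have p: "0 < 1 + t\<^sup>2 * r" using r by (intro add_pos_nonneg) auto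
  have "t * r < 1"
  proof (cases "r = 0")
    case False
    then have "t * r < 1 * r" using assms r by (intro mult_strict_right_mono) auto
    then show ?thesis using r by simp
  qed simp
  then have "0 < (1 - t) * (1 - t * r)" using assms by simp
  then have "t * (1 + r) < 1 + t\<^sup>2 * r" by (simp add: algebra_simps power2_eq_square)
  then show "?m < 1" using p by simp
  show "0 \<le> ?m" using assms r p by (intro divide_nonneg_pos mult_nonneg_nonneg) auto
  have "1 + r \<noteq> 0" using r by linarith
  then show "klein (t *\<^sub>R z) = ?m *\<^sub>R klein z"
    using p by (simp add: klein_def power_mult_distrib r_def[symmetric])
qed

text \<open>Moving towards \<open>0\<close> makes each inner product strictly smaller than its level, as the levels are
positive.  This gives both the connectedness of the region and its closure.\<close>

lemma inner_region_starlike: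
  assumes "z \<in> cball 0 1" "\<And>e. cap_axis e \<bullet> klein z \<le> cap_level e" "0 \<le> t" "t < 1"
  shows "t *\<^sub>R z \<in> inner_region"
proof -
  obtain m where m: "0 \<le> m" "m < 1" "klein (t *\<^sub>R z) = m *\<^sub>R klein z"
    using klein_scaleR[of t z] assms by auto
  have "cap_axis e \<bullet> klein (t *\<^sub>R z) < cap_level e" for e
  proof -
    have "cap_axis e \<bullet> klein (t *\<^sub>R z) = m * (cap_axis e \<bullet> klein z)" by (simp add: m)
    also have "\<dots> \<le> m * cap_level e" using m assms by (intro mult_left_mono) auto
    also have "\<dots> < 1 * cap_level e" using m cap_level_pos[of e] by (intro mult_strict_right_mono) auto
    finally show ?thesis by simp
  qed
  moreover have "norm (t *\<^sub>R z) < 1"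
  proof -
    have "t * norm z \<le> t * 1" using assms by (intro mult_left_mono) auto
    then show ?thesis using assms by simp
  qed
  ultimately show ?thesis by (simp add: inner_region_def)
qed

lemma zero_in_inner_region: "0 \<in> inner_region"
  using cap_level_pos by (simp add: inner_region_def klein_def)

lemma connected_inner_region: "connected inner_region"
proof (rule starlike_imp_connected)
  have "closed_segment 0 z \<subseteq> inner_region" if z: "z \<in> inner_region" for z
  proof
    fix y assume "y \<in> closed_segment 0 z"
    then obtain t where t: "0 \<le> t" "t \<le> 1" "y = t *\<^sub>R z" by (auto simp: in_segment)
    show "y \<in> inner_region"
    proof (cases "t = 1")
      case False
      then show ?thesis unfolding t(3) using t z
        by (intro inner_region_starlike) (auto simp: inner_region_def less_imp_le)
    qed (use t z in auto)
  qed
  then show "starlike inner_region" unfolding starlike_def using zero_in_inner_region by blast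
qed

text \<open>After a rotation the ends of the arc are \<open>cos w \<plusminus> i sin w\<close>.  A point of the disk with real part \<open>cos w\<close> has
an imaginary part between \<open>- sin w\<close> and \<open>sin w\<close>, so it is on the chord.\<close>

lemma geodesic_of_level:
  assumes "z \<in> ball 0 1" "cap_axis e \<bullet> klein z = cap_level e"
  shows "z \<in> geodesic (central_arc e)"
proof -
  define l r where lr: "l = fst (cap e)" "r = snd (cap e)"
  define m where "m = (l + r) / 2"
  \<comment> \<open>half of the angle of the cap\<close>
  define w where "w = pi * (r - l)"
  have w: "0 < w" "w < pi"
  proof -
    have "pi * (r - l) \<le> pi * (1/3)" using cap_short[of e] by (intro mult_left_mono) (auto simp: lr)
    then show "w < pi" unfolding w_def using pi_gt_zero by linarith
    show "0 < w" using cap_nonempty[of e] by (simp add: w_def lr)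
  qed
  then have sw: "0 < sin w" by (rule sin_gt_zero)
  define u where "u = klein z * cnj (circ m)"
  have "cnj (circ m) * circ m = 1" by (simp add: circ_def cis_cnj cis_mult)
  then have ku: "klein z = u * circ m" by (simp add: u_def mult.assoc)
  have "Re u = cap_axis e \<bullet> klein z"
    by (simp add: u_def cap_axis_def lr m_def inner_complex_def algebra_simps)
  then have re: "Re u = cos w" using assms by (simp add: cap_level_def w_def lr)
  have "norm u \<le> 1" using norm_klein_le[of z] by (simp add: u_def norm_mult)
  then have "(Re u)\<^sup>2 + (Im u)\<^sup>2 \<le> 1" by (metis cmod_power2 norm_ge_zero power_le_one)
  then have "(Im u)\<^sup>2 \<le> (sin w)\<^sup>2" using re by (simp add: cos_squared_eq)
  then have "\<bar>Im u\<bar> \<le> sin w" using sw abs_le_square_iff[of "Im u" "sin w"] by simp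
  \<comment> \<open>the barycentric coordinate of \<open>u\<close> on the vertical chord through \<open>cos w\<close>\<close>
  define k where "k = (1 - Im u / sin w) / 2"
  have k: "0 \<le> k" "k \<le> 1" using \<open>\<bar>Im u\<bar> \<le> sin w\<close> sw by (auto simp: k_def field_simps abs_le_iff)
  have "u = k *\<^sub>R cis (- w) + (1 - k) *\<^sub>R cis w"
  proof (rule complex_eqI)
    show "Re u = Re (k *\<^sub>R cis (- w) + (1 - k) *\<^sub>R cis w)" using re by (simp add: algebra_simps)
    have "(1 - 2 * k) * sin w = Im u" using sw by (simp add: k_def field_simps)
    then show "Im u = Im (k *\<^sub>R cis (- w) + (1 - k) *\<^sub>R cis w)" by (simp add: algebra_simps)
  qed
  moreover have "cis (- w) * circ m = circ l" "cis w * circ m = circ r"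
  proof -
    have "- w + 2 * pi * m = 2 * pi * l" "w + 2 * pi * m = 2 * pi * r"
      by (simp_all add: w_def m_def field_simps)
    then show "cis (- w) * circ m = circ l" "cis w * circ m = circ r"
      by (simp_all only: circ_def cis_mult)
  qed
  ultimately have "klein z = k *\<^sub>R circ l + (1 - k) *\<^sub>R circ r"
    unfolding ku by (simp add: distrib_right scaleR_conv_of_real mult.assoc)
  then have "klein z \<in> convex hull (central_arc e)"
    unfolding central_arc_def lr[symmetric] convex_hull_2 using k by force
  then show ?thesis using assms by (simp add: geodesic_klein)
qed

lemma inner_region_avoids:
  assumes "A \<in> lamination" "z \<in> inner_region"
  shows "z \<notin> geodesic A"
proof
  assume "z \<in> geodesic A"
  then have h: "klein z \<in> convex hull A" by (simp add: geodesic_klein)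
  have "\<exists>e. \<forall>x\<in>A. cap_level e \<le> cap_axis e \<bullet> x" using assms(1)
  proof (cases rule: lamination_cases)
    case (1 e)
    then show ?thesis using cap_axis_central_arc by (intro exI[of _ e]) auto
  next
    case (2 e)
    have "x \<in> circle" if "x \<in> A" for x
      using that 2 open_cap_subset closed_cap_circle by blast
    then show ?thesis using 2 cap_axis_open_cap_iff[of _ e] by (intro exI[of _ e]) (auto intro: less_imp_le)
  qed
  then obtain e where e: "\<And>x. x \<in> A \<Longrightarrow> cap_level e \<le> cap_axis e \<bullet> x" by blast
  have "(- cap_axis e) \<bullet> klein z \<le> - cap_level e" using e by (intro hull_height[OF h]) auto
  moreover have "cap_axis e \<bullet> klein z < cap_level e" using assms(2) by (simp add: inner_region_def)
  ultimately show False by simp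
qed

text \<open>The region avoids all arcs: at both ends of a central arc the inner product with its own axis equals
the level, and at both ends of any other arc the inner product with the axis of the cap around them
exceeds the level.  Conversely, on a connected set that contains \<open>0\<close> and misses the chord of a central
arc the inner product cannot pass the level.\<close>

lemma central_gap_eq: "central_gap = inner_region"
proof
  have "inner_region \<subseteq> lamination_complement"
    using inner_region_avoids unfolding lamination_complement_def by (auto simp: inner_region_def)
  then show "inner_region \<subseteq> central_gap"
    unfolding central_gap_def
    by (intro connected_component_maximal connected_inner_region zero_in_inner_region)
  show "central_gap \<subseteq> inner_region"
  proof
    fix z assume z: "z \<in> central_gap"
    let ?G = "connected_component_set lamination_complement 0"
    have sub: "?G \<subseteq> lamination_complement" by (rule connected_component_subset)
    have zG: "z \<in> ?G" using z by (simp add: central_gap_def)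
    have 0: "0 \<in> ?G"
    proof -
      have "0 \<in> lamination_complement" using \<open>inner_region \<subseteq> lamination_complement\<close> zero_in_inner_region by blast
      then show ?thesis by simp
    qed
    have "cap_axis e \<bullet> klein z < cap_level e" for e
    proof (rule ccontr)
      assume n: "\<not> cap_axis e \<bullet> klein z < cap_level e"
      have "connected ((\<lambda>y. cap_axis e \<bullet> klein y) ` ?G)"
        by (intro connected_continuous_image connected_connected_component continuous_intros continuous_on_klein)
      then have "{cap_axis e \<bullet> klein 0..cap_axis e \<bullet> klein z} \<subseteq> (\<lambda>y. cap_axis e \<bullet> klein y) ` ?G"
        using 0 zG by (intro connected_contains_Icc) auto
      moreover have "cap_level e \<in> {cap_axis e \<bullet> klein 0..cap_axis e \<bullet> klein z}"
        using n cap_level_pos[of e] by (simp add: klein_def)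
      ultimately obtain y where y: "y \<in> ?G" "cap_axis e \<bullet> klein y = cap_level e" by (auto simp: image_iff)
      then have "y \<in> ball 0 1" "y \<notin> geodesic (central_arc e)"
        using sub central_arc_in_lamination by (auto simp: lamination_complement_def)
      then show False using y geodesic_of_level by blast
    qed
    moreover have "z \<in> ball 0 1" using zG sub by (auto simp: lamination_complement_def)
    ultimately show "z \<in> inner_region" by (simp add: inner_region_def)
  qed
qed

lemma closure_central_gap:
  "z \<in> closure central_gap \<longleftrightarrow> z \<in> cball 0 1 \<and> (\<forall>e. cap_axis e \<bullet> klein z \<le> cap_level e)"
proof
  have "closed {z. \<forall>e. cap_axis e \<bullet> klein z \<le> cap_level e}"
    by (intro closed_Collect_all closed_Collect_le continuous_intros continuous_on_klein)
  then have "closed (cball 0 1 \<inter> {z. \<forall>e. cap_axis e \<bullet> klein z \<le> cap_level e})" by (intro closed_Int) auto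
  then have "closure central_gap \<subseteq> cball 0 1 \<inter> {z. \<forall>e. cap_axis e \<bullet> klein z \<le> cap_level e}"
    unfolding central_gap_eq by (intro closure_minimal) (auto simp: inner_region_def less_imp_le)
  then show "z \<in> closure central_gap \<Longrightarrow> z \<in> cball 0 1 \<and> (\<forall>e. cap_axis e \<bullet> klein z \<le> cap_level e)" by blast
next
  assume z: "z \<in> cball 0 1 \<and> (\<forall>e. cap_axis e \<bullet> klein z \<le> cap_level e)"
  have "(\<lambda>n. (1 - 1 / real (Suc n)) *\<^sub>R z) \<longlonglongrightarrow> (1 - 0) *\<^sub>R z"
    by (intro tendsto_intros LIMSEQ_Suc[OF lim_1_over_n])
  moreover have "(1 - 1 / real (Suc n)) *\<^sub>R z \<in> central_gap" for n
    unfolding central_gap_eq using z by (intro inner_region_starlike) (auto simp: field_simps)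
  ultimately show "z \<in> closure central_gap"
    unfolding closure_sequential by (intro exI[of _ "\<lambda>n. (1 - 1 / real (Suc n)) *\<^sub>R z"]) simp
qed

theorem closure_central_gap_circle: "closure central_gap \<inter> circle = limit_set"
proof -
  have "z \<in> closure central_gap \<longleftrightarrow> z \<in> limit_set" if "z \<in> circle" for z
  proof -
    have "z \<in> closure central_gap \<longleftrightarrow> (\<forall>e. cap_axis e \<bullet> z \<le> cap_level e)"
      using that by (simp add: closure_central_gap klein_circle)
    also have "\<dots> \<longleftrightarrow> (\<forall>e. z \<notin> open_cap e)"
      using cap_axis_open_cap_iff[OF that] by (simp add: not_less[symmetric])
    finally show ?thesis using limit_set_iff[OF that] by simp
  qed
  then show ?thesis using limit_set_circle by blast
qed

text \<open>The chord of a central arc consists of limits of points of the region.  Any other arc has an end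
strictly inside a cap, which is not in the closure of the region.\<close>

theorem central_arcs_eq: "central_arcs = range central_arc"
proof
  show "central_arcs \<subseteq> range central_arc"
  proof
    fix A assume "A \<in> central_arcs"
    then have A: "A \<in> lamination" "geodesic A \<subseteq> frontier central_gap"
      by (auto simp: central_arcs_def border_def)
    show "A \<in> range central_arc" using A(1)
    proof (cases rule: lamination_cases)
      case (2 e)
      then obtain x where x: "x \<in> A" "x \<in> open_cap e" by blast
      have xc: "x \<in> circle" using x open_cap_subset closed_cap_circle by blast
      then have "x \<in> geodesic A" using x hull_inc[of x A] by (simp add: geodesic_klein klein_circle)
      then have "x \<in> closure central_gap" using A by (auto simp: frontier_def)
      then have "cap_axis e \<bullet> x \<le> cap_level e" using xc by (simp add: closure_central_gap klein_circle)
      then show ?thesis using cap_axis_open_cap_iff[OF xc, of e] x by simp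
    qed blast
  qed
  show "range central_arc \<subseteq> central_arcs"
  proof
    fix A assume "A \<in> range central_arc"
    then obtain e where e: "A = central_arc e" by blast
    have "z \<in> frontier central_gap" if z: "z \<in> geodesic (central_arc e)" for z
    proof -
      have h: "z \<in> cball 0 1" "klein z \<in> convex hull (central_arc e)" using z by (auto simp: geodesic_klein)
      have "cap_axis e' \<bullet> klein z \<le> cap_level e'" for e'
      proof (rule hull_height[OF h(2)])
        fix x assume x: "x \<in> central_arc e"
        then have "x \<in> circle" using central_arc_circle by blast
        then show "cap_axis e' \<bullet> x \<le> cap_level e'" using cap_axis_open_cap_iff[of x e'] central_arc_open_cap_disjoint[OF x, of e'] by simp
      qed
      then have "z \<in> closure central_gap" using h by (simp add: closure_central_gap)
      moreover have "z \<notin> interior central_gap"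
        using inner_region_avoids[OF central_arc_in_lamination] z interior_subset central_gap_eq by blast
      ultimately show ?thesis by (simp add: frontier_def)
    qed
    then show "A \<in> central_arcs" using central_arc_in_lamination e by (auto simp: central_arcs_def border_def)
  qed
qed

section \<open>Labels of the central arcs\<close>

lemma central_arc_Some_Nil: "central_arc (Some []) = {circ (1/3), circ (2/3)}"
  by (simp add: central_arc_def tau_def)

lemma circ_diff_of_int [simp]: "circ (t - of_int n) = circ t"
  using circ_add_of_int[of t "- n"] by simp

lemma circ_neq: "s < t \<Longrightarrow> t - s < 1 \<Longrightarrow> circ s \<noteq> circ t" "s < t \<Longrightarrow> t - s < 1 \<Longrightarrow> circ t \<noteq> circ s"
  using circ_eq_near[of s t] by auto

text \<open>The arcs \<open>e\<close> and \<open>e'\<close> start and end the cell of \<open>w\<close>; their other ends \<open>a\<close> and \<open>b\<close> are placed on the real line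
next to the cell.  The condition \<open>b - a < 1\<close> says that the two arcs share no end on the circle, which
fails for the empty word.\<close>

definition flanked :: "node \<Rightarrow> node option \<Rightarrow> node option \<Rightarrow> real \<Rightarrow> real \<Rightarrow> bool" where
  "flanked w e e' a b \<longleftrightarrow> a < fst (cell w) \<and> snd (cell w) < b \<and> b - a < 1 \<and>
     central_arc e = {circ a, circ (fst (cell w))} \<and> central_arc e' = {circ (snd (cell w)), circ b} \<and>
     circ (lab e) = circ (bin_val w) \<and> circ (lab e') = circ (bin_val w + 1 / 2 ^ length w)"

lemma cell_less: "fst (cell w) < snd (cell w)"
  by (simp add: cell_def)

lemma flanked_children:
  assumes "flanked w e e' a b"
  shows "flanked (w @ [False]) e (Some w) a (snd (cap (Some w)))"
    "flanked (w @ [True]) (Some w) e' (fst (cap (Some w))) b"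
proof -
  have c: "fst (cell w) < fst (cap (Some w))" "fst (cap (Some w)) < snd (cap (Some w))"
    "snd (cap (Some w)) < snd (cell w)"
    using cell_less[of w] unfolding cap_cell by (auto simp: field_simps)
  have f: "fst (cell (w @ [False])) = fst (cell w)" "snd (cell (w @ [False])) = fst (cap (Some w))"
    "fst (cell (w @ [True])) = snd (cap (Some w))" "snd (cell (w @ [True])) = snd (cell w)"
    unfolding cell_children by simp_all
  have l: "bin_val (w @ [False]) = bin_val w" "bin_val w + 1 / 2 ^ length (w @ [False]) = bin_mid w"
     "bin_val (w @ [True]) = bin_mid w" "bin_mid w + 1 / 2 ^ length (w @ [True]) = bin_val w + 1 / 2 ^ length w"
    by (simp_all add: bin_val_append bin_mid_eq)
  have s: "central_arc (Some w) = {circ (fst (cap (Some w))), circ (snd (cap (Some w)))}"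
    by (rule central_arc_def)
  show "flanked (w @ [False]) e (Some w) a (snd (cap (Some w)))"
    "flanked (w @ [True]) (Some w) e' (fst (cap (Some w))) b"
    using assms c unfolding flanked_def f l lab.simps s by auto
qed

lemma flanked_base: "flanked [False] None (Some []) (- 1/6) (2/3)" "flanked [True] (Some []) None (1/3) (7/6)"
proof -
  show "flanked [False] None (Some []) (- 1/6) (2/3)"
    unfolding flanked_def central_arc_Some_Nil by (simp add: central_arc_def cell_def tau_def)
  have "circ (- 1/6) = circ (5/6)" "circ (1/6) = circ (7/6)" "circ 1 = circ 0"
    using circ_add_1[of "- 1/6"] circ_add_1[of "1/6"] circ_add_1[of 0] by simp_all
  then show "flanked [True] (Some []) None (1/3) (7/6)"
    unfolding flanked_def central_arc_Some_Nil by (simp add: central_arc_def cell_def tau_def)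
qed

lemma central_label_Some:
  assumes f: "flanked w e e' a b" "w \<noteq> []"
    and l: "central_label (central_arc e) (circ (lab e))" "central_label (central_arc e') (circ (lab e'))"
  shows "central_label (central_arc (Some w)) (circ (lab (Some w)))"
proof -
  let ?L = "fst (cell w)" and ?R = "snd (cell w)"
  obtain k :: nat where k: "bin_val w = real k / 2 ^ length w" using bin_val_dyadic[of w] by metis
  have LR: "?L < ?R" by (rule cell_less)
  have n: "a < ?L" "?R < b" "b - a < 1" and A: "central_arc e = {circ a, circ ?L}" and B: "central_arc e' = {circ ?R, circ b}"
    and le: "circ (lab e) = circ (bin_val w)" "circ (lab e') = circ (bin_val w + 1 / 2 ^ length w)"
    using f(1) by (auto simp: flanked_def)
  have "circ a \<notin> circ ` {?L..?R}"
  proof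
    assume "circ a \<in> circ ` {?L..?R}"
    then obtain t where "?L \<le> t" "t \<le> ?R" "circ a = circ t" by auto
    then show False using circ_neq(1)[of a t] n by auto
  qed
  then have iA: "circ ` {?L..?R} \<inter> central_arc e = {circ ?L}" using LR unfolding A by auto
  have "circ b \<notin> circ ` {?L..?R}"
  proof
    assume "circ b \<in> circ ` {?L..?R}"
    then obtain t where "?L \<le> t" "t \<le> ?R" "circ b = circ t" by auto
    then show False using circ_neq(2)[of t b] n by auto
  qed
  then have iB: "circ ` {?L..?R} \<inter> central_arc e' = {circ ?R}" using LR unfolding B by auto
  have "central_label (primary_arc (?L, ?R)) (circ (real_of_int (2 * int k + 1) / 2 ^ (length w + 1)))"
  proof (rule central_label.mid)
    show "central_label (central_arc e) (circ (real_of_int (int k) / 2 ^ length w))"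
      using l(1) le(1) k by simp
    have "bin_val w + 1 / 2 ^ length w = real_of_int (int k + 1) / 2 ^ length w"
      unfolding k by (simp add: add_divide_distrib)
    then show "central_label (central_arc e') (circ (real_of_int (int k + 1) / 2 ^ length w))"
      using l(2) le(2) by simp
    show "1 \<le> length w" using f(2) by (cases w) auto
    show "?R < ?L + 1" using n by linarith
  qed (use LR iA iB in auto)
  moreover have "real_of_int (2 * int k + 1) / 2 ^ (length w + 1) = bin_mid w"
    by (simp add: bin_mid_eq k add_divide_distrib)
  ultimately show ?thesis using primary_arc_cell[of w] by simp
qed

lemma central_label_None_Nil:
  "central_label (central_arc None) (circ (lab None))" "central_label (central_arc (Some [])) (circ (lab (Some [])))"
  unfolding central_arc_None central_arc_Some_Nil using central_label.zero central_label.half by simp_all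

text \<open>The induction hypothesis for showing that all central arcs are labelled: the two arcs next to a cell
have their labels, hence its primary arc receives one.\<close>

definition labelled_flanks :: "node \<Rightarrow> bool" where
  "labelled_flanks w \<longleftrightarrow> (\<exists>e e' a b. flanked w e e' a b \<and>
     central_label (central_arc e) (circ (lab e)) \<and> central_label (central_arc e') (circ (lab e')))"

lemma labelled_flanks: "w \<noteq> [] \<Longrightarrow> labelled_flanks w"
proof (induction w rule: rev_induct)
  case (snoc c w)
  have "labelled_flanks (w @ [False]) \<and> labelled_flanks (w @ [True])"
  proof (cases "w = []")
    case True
    show ?thesis
      unfolding True append_Nil labelled_flanks_def using flanked_base central_label_None_Nil by blast
  next
    case False
    then obtain e e' a b where w: "flanked w e e' a b" "central_label (central_arc e) (circ (lab e))"
        "central_label (central_arc e') (circ (lab e'))" using snoc unfolding labelled_flanks_def by blast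
    have "central_label (central_arc (Some w)) (circ (lab (Some w)))"
      by (rule central_label_Some[OF w(1) False w(2,3)])
    with flanked_children[OF w(1)] w show ?thesis unfolding labelled_flanks_def by blast
  qed
  then show ?case by (cases c) simp_all
qed simp

lemma central_label_central_arc: "central_label (central_arc e) (circ (lab e))"
proof (cases e)
  case (Some w)
  show ?thesis
  proof (cases "w = []")
    case False
    then obtain e e' a b where "flanked w e e' a b" "central_label (central_arc e) (circ (lab e))"
        "central_label (central_arc e') (circ (lab e'))" using labelled_flanks unfolding labelled_flanks_def by blast
    then show ?thesis unfolding Some using central_label_Some False by blast
  qed (use Some central_label_None_Nil in blast)
qed (use central_label_None_Nil in blast)

text \<open>In the recursive clause the fraction \<open>k / 2^m\<close> need not be reduced, nor lie in \<open>[0, 1]\<close>; reducing \<open>k\<close>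
modulo \<open>2^m\<close> gives a word of length \<open>m\<close>.  The two arcs are those next to the cell of this word.  Of the
four intervals from an end of the first arc to an end of the second one, only the cell meets each arc
in a single point.\<close>

lemma central_label_imp_arc:
  "central_label A d \<Longrightarrow> \<exists>e. A = central_arc e \<and> d = circ (lab e)"
proof (induction rule: central_label.induct)
  case zero
  then show ?case using central_arc_None by (intro exI[of _ None]) simp
next
  case half
  then show ?case using central_arc_Some_Nil by (intro exI[of _ "Some []"]) simp
next
  case (mid A k m B a b)
  define j where "j = nat (k mod 2 ^ m)"
  have j: "int j = k mod 2 ^ m" by (simp add: j_def)
  have "int j < 2 ^ m" unfolding j by simp
  then have "int j < int (2 ^ m)" by simp
  then have "j < 2 ^ m" by (simp only: of_nat_less_iff)
  then obtain w where w: "length w = m" "bin_val w = real j / 2 ^ m" using dyadic_bin_val by blast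
  have "real_of_int k = real j + 2 ^ m * real_of_int (k div 2 ^ m)"
  proof -
    have "k = int j + 2 ^ m * (k div 2 ^ m)" unfolding j by simp
    then have "real_of_int k = real_of_int (int j + 2 ^ m * (k div 2 ^ m))" by (rule arg_cong)
    then show ?thesis by simp
  qed
  then have kw: "real_of_int k / 2 ^ m = bin_val w + real_of_int (k div 2 ^ m)"
    by (simp add: w add_divide_distrib)
  then have kw': "real_of_int (k + 1) / 2 ^ m = bin_val w + 1 / 2 ^ m + real_of_int (k div 2 ^ m)"
    by (simp add: add_divide_distrib)
  have "w \<noteq> []" using w mid.hyps by auto
  then obtain e0 e0' a0 b0 where f: "flanked w e0 e0' a0 b0" using labelled_flanks unfolding labelled_flanks_def by blast
  let ?L = "fst (cell w)" and ?R = "snd (cell w)"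
  obtain e where e: "A = central_arc e" "circ (real_of_int k / 2 ^ m) = circ (lab e)" using mid.IH by blast
  obtain e' where e': "B = central_arc e'" "circ (real_of_int (k + 1) / 2 ^ m) = circ (lab e')" using mid.IH by blast
  have "e = e0"
    using e(2) f unfolding kw circ_add_of_int flanked_def by (intro lab_inj) simp
  have "e' = e0'"
    using e'(2) f unfolding kw' circ_add_of_int flanked_def w(1) by (intro lab_inj) simp
  have A: "A = {circ a0, circ ?L}" and B: "B = {circ ?R, circ b0}" and n: "a0 < ?L" "?R < b0" "b0 - a0 < 1"
    using f e e' \<open>e = e0\<close> \<open>e' = e0'\<close> by (auto simp: flanked_def)
  have LR: "?L < ?R" by (rule cell_less)
  note ab = mid.hyps(4,5) and iA = mid.hyps(6) and iB = mid.hyps(7)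
  have "circ a \<in> A" "circ b \<in> B" using iA iB by auto
  then have cA: "circ a = circ a0 \<or> circ a = circ ?L" and cB: "circ b = circ ?R \<or> circ b = circ b0"
    unfolding A B by auto
  have "\<exists>n::int. a = ?L + n \<and> b = ?R + n"
    using cA
  proof
    assume "circ a = circ a0"
    then obtain n :: int where an: "a = a0 + n" by (auto simp: circ_eq_iff)
    have "circ ?L \<noteq> circ a0" using n LR by (intro circ_neq) auto
    then have "?L + n \<notin> {a..b}" using iA unfolding A an by (metis Int_iff circ_add_of_int image_eqI insertCI singletonD)
    then have bL: "b - n < ?L" using an n by auto
    have "circ (b - n) \<noteq> circ ?R" "circ (b - n) \<noteq> circ b0"
      using bL an ab n LR by (intro circ_neq(1); linarith)+
    then show ?thesis using cB by simp
  next
    assume "circ a = circ ?L"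
    then obtain n :: int where an: "a = ?L + n" by (auto simp: circ_eq_iff)
    have bn: "?L < b - n" "b - n < ?L + 1" using an ab by auto
    show ?thesis using cB
    proof
      assume "circ b = circ ?R"
      then have "circ (b - n) = circ ?R" by simp
      moreover have "\<bar>b - n - ?R\<bar> < 1" using bn n LR by (auto simp: abs_if)
      ultimately have "b - n = ?R" by (rule circ_eq_near)
      then show ?thesis using an by (intro exI[of _ n]) simp
    next
      assume "circ b = circ b0"
      then have "circ (b - n) = circ b0" by simp
      moreover have "\<bar>b - n - b0\<bar> < 1" using bn n LR by (auto simp: abs_if)
      ultimately have bb: "b - n = b0" by (rule circ_eq_near)
      then have "?R + n \<in> {a..b}" using an n LR by auto
      then have "circ ?R \<in> circ ` {a..b} \<inter> B" unfolding B by (metis Int_iff circ_add_of_int image_eqI insertCI)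
      then have "circ ?R = circ b0" using iB \<open>circ b = circ b0\<close> by auto
      then show ?thesis using circ_neq(1)[of ?R b0] n LR by auto
    qed
  qed
  then obtain n :: int where "a = ?L + n" "b = ?R + n" by blast
  then have "a + (b - a) / 4 = ?L + (?R - ?L) / 4 + n" "b - (b - a) / 4 = ?R - (?R - ?L) / 4 + n" by simp_all
  then have "primary_arc (a, b) = primary_arc (?L, ?R)"
    unfolding primary_arc_def by (simp only: prod.case circ_add_of_int)
  then have "primary_arc (a, b) = central_arc (Some w)" using primary_arc_cell[of w] by simp
  moreover have "circ (real_of_int (2 * k + 1) / 2 ^ (m + 1)) = circ (lab (Some w))"
  proof -
    have "real_of_int (2 * k + 1) / 2 ^ (m + 1) = real_of_int k / 2 ^ m + 1 / (2 * 2 ^ m)"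
      by (simp add: add_divide_distrib)
    also have "\<dots> = bin_mid w + real_of_int (k div 2 ^ m)" unfolding kw by (simp add: bin_mid_eq w)
    finally show ?thesis by simp
  qed
  ultimately show ?case by blast
qed

section \<open>The boundary of the central component\<close>

text \<open>No other arc of the lamination touches a central arc: central arcs are disjoint, and the ends of all
other arcs are strictly inside caps.\<close>

lemma julia_point_central_arc:
  assumes "x \<in> central_arc e"
  shows "julia_point x = central_arc e"
proof
  show "julia_point x \<subseteq> central_arc e"
  proof
    fix y assume "y \<in> julia_point x"
    then have y: "y = x \<or> {x, y} \<in> lamination" by (simp add: julia_point_def)
    show "y \<in> central_arc e"
    proof (cases "y = x")
      case False
      then have "{x, y} \<in> lamination" using y by blast
      then show ?thesis
      proof (cases rule: lamination_cases)
        case (1 e')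
        then have "x \<in> central_arc e'" by blast
        then have "e = e'"
          using assms closed_caps_disjoint[of x e e'] central_arc_subset_closed_cap by blast
        then show ?thesis using 1 by blast
      next
        case (2 e')
        then show ?thesis using central_arc_open_cap_disjoint[OF assms, of e'] by blast
      qed
    qed (use assms in simp)
  qed
  show "central_arc e \<subseteq> julia_point x"
  proof
    fix y assume y: "y \<in> central_arc e"
    then have "y = x \<or> {x, y} = central_arc e" using assms by (auto simp: central_arc_def)
    then have "y = x \<or> {x, y} \<in> lamination" using central_arc_in_lamination[of e] by metis
    moreover have "y \<in> circle" using y central_arc_circle[of e] by blast
    ultimately show "y \<in> julia_point x" unfolding julia_point_def by blast
  qed
qed

lemma julia_point_singleton:
  assumes "x \<in> limit_set" "\<And>e. x \<notin> central_arc e"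
  shows "julia_point x = {x}"
proof -
  have xc: "x \<in> circle" using assms limit_set_circle by blast
  have "{x, y} \<notin> lamination" for y
  proof
    assume "{x, y} \<in> lamination"
    then show False
    proof (cases rule: lamination_cases)
      case (1 e)
      then show ?thesis using assms(2)[of e] by blast
    next
      case (2 e)
      then show ?thesis using assms(1) limit_set_iff[OF xc] by blast
    qed
  qed
  then show ?thesis using xc by (auto simp: julia_point_def)
qed

lemma boundary_C_eq: "boundary_C = julia_point ` limit_set"
  unfolding boundary_C_def closure_central_gap_circle by (rule refl)

text \<open>Both ends of any arc of the lamination lie in a common cap.\<close>

lemma collapse_julia_point:
  assumes "x \<in> circle" "y \<in> julia_point x"
  shows "collapse y = collapse x"
proof (cases "y = x")
  case False
  then have "{x, y} \<in> lamination" using assms by (auto simp: julia_point_def)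
  then have "\<exists>e. x \<in> closed_cap e \<and> y \<in> closed_cap e"
  proof (cases rule: lamination_cases)
    case (1 e)
    then show ?thesis using central_arc_subset_closed_cap[of e] by blast
  next
    case (2 e)
    then show ?thesis using open_cap_subset[of e] by blast
  qed
  then obtain e where "x \<in> closed_cap e" "y \<in> closed_cap e" by blast
  then show ?thesis using closed_cap_iff[of _ e] closed_cap_circle[of e] by (metis subsetD)
qed simp

definition label_map :: "complex set \<Rightarrow> complex" where
  "label_map p = collapse (SOME x. x \<in> p)"

lemma label_map_julia_point: "x \<in> circle \<Longrightarrow> label_map (julia_point x) = collapse x"
proof -
  assume x: "x \<in> circle"
  then have "x \<in> julia_point x" by (simp add: julia_point_def)
  then have "(SOME y. y \<in> julia_point x) \<in> julia_point x" by (rule someI)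
  then show ?thesis unfolding label_map_def by (rule collapse_julia_point[OF x])
qed

lemma topspace_julia_space: "topspace julia_space = julia_point ` circle"
proof -
  have "{x \<in> circle. julia_point x \<in> julia_point ` circle} = circle" by blast
  then have "openin julia_space (julia_point ` circle)" unfolding openin_julia_space by simp
  then show ?thesis using openin_julia_space openin_subset openin_topspace by (metis subset_antisym)
qed

lemma continuous_map_julia_point: "continuous_map (top_of_set circle) julia_space julia_point"
  unfolding continuous_map_def topspace_julia_space by (auto simp: openin_julia_space simp del: mem_sphere)

lemma boundary_C_subset: "boundary_C \<subseteq> topspace julia_space"
  unfolding boundary_C_eq topspace_julia_space using limit_set_circle by blast

lemma continuous_map_label_map:
  "continuous_map (subtopology julia_space boundary_C) (top_of_set circle) label_map"
proof -
  have "continuous_map julia_space (top_of_set circle) label_map"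
    unfolding continuous_map_def
  proof (intro conjI allI impI)
    show "label_map \<in> topspace julia_space \<rightarrow> topspace (top_of_set circle)"
      by (auto simp: label_map_def)
    fix U assume U: "openin (top_of_set circle) U"
    have "{x \<in> circle. julia_point x \<in> {p \<in> topspace julia_space. label_map p \<in> U}} = {x \<in> circle. collapse x \<in> U}"
      unfolding topspace_julia_space using label_map_julia_point by auto
    moreover have "openin (top_of_set circle) {x \<in> circle. collapse x \<in> U}"
    proof -
      have "continuous_map (top_of_set circle) (top_of_set circle) collapse"
        using continuous_on_collapse by auto
      then show ?thesis using U unfolding continuous_map_def by simp
    qed
    ultimately show "openin julia_space {p \<in> topspace julia_space. label_map p \<in> U}"
      unfolding openin_julia_space topspace_julia_space[symmetric] by simp
  qed
  then show ?thesis by (rule continuous_map_from_subtopology)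
qed

lemma julia_point_eq:
  assumes "x \<in> limit_set" "y \<in> limit_set" "collapse x = collapse y"
  shows "julia_point x = julia_point y"
proof (cases "x = y")
  case False
  then obtain e where "{x, y} = central_arc e" using collapse_fibre_limit_set assms by blast
  then have "x \<in> central_arc e" "y \<in> central_arc e" by blast+
  then show ?thesis using julia_point_central_arc by simp
qed simp

lemma label_map_inj: "inj_on label_map boundary_C"
proof (rule inj_onI)
  fix p q assume "p \<in> boundary_C" "q \<in> boundary_C" and eq: "label_map p = label_map q"
  then obtain x y where xy: "x \<in> limit_set" "y \<in> limit_set" "p = julia_point x" "q = julia_point y"
    by (auto simp: boundary_C_eq)
  then show "p = q" using julia_point_eq eq label_map_julia_point limit_set_circle by (metis subsetD)
qed

lemma label_map_image: "label_map ` boundary_C = circle"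
proof
  show "label_map ` boundary_C \<subseteq> circle" by (auto simp: label_map_def)
  show "circle \<subseteq> label_map ` boundary_C"
  proof
    fix d assume "d \<in> circle"
    then obtain x where x: "x \<in> limit_set" "collapse x = d" by (rule collapse_limit_set_surj)
    then have "d = label_map (julia_point x)" using label_map_julia_point[of x] limit_set_circle by auto
    then show "d \<in> label_map ` boundary_C" using x by (auto simp: boundary_C_eq)
  qed
qed

lemma central_arc_as_julia_point:
  obtains x where "x \<in> limit_set" "julia_point x = central_arc e" "collapse x = circ (lab e)"
proof -
  have x: "circ (fst (cap e)) \<in> central_arc e" by (simp add: central_arc_def)
  show ?thesis
    using that[OF subsetD[OF central_arc_limit_set x] julia_point_central_arc[OF x] collapse_central_arc[OF x]] .
qed

text \<open>A continuous bijection from a compact space onto the circle is a homeomorphism.\<close>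

theorem label_chart_label_map: "label_chart label_map"
  unfolding label_chart_def
proof (intro conjI allI impI)
  have ts: "topspace (subtopology julia_space boundary_C) = boundary_C"
    using boundary_C_subset by (rule topspace_subtopology_subset)
  have "compactin (top_of_set circle) limit_set"
    using compact_limit_set limit_set_circle by (simp add: compactin_subtopology)
  then have "compactin julia_space boundary_C"
    unfolding boundary_C_eq using continuous_map_julia_point image_compactin by blast
  then have comp: "compact_space (subtopology julia_space boundary_C)"
    by (simp add: compact_space_subtopology)
  show "homeomorphic_map (subtopology julia_space boundary_C) (top_of_set circle) label_map"
  proof (rule continuous_imp_homeomorphic_map[OF continuous_map_label_map comp])
    show "Hausdorff_space (top_of_set circle)"
      by (rule Hausdorff_space_subtopology) (rule Hausdorff_space_euclidean)
  qed (use ts label_map_image label_map_inj in auto)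
next
  fix A d assume "central_label A d"
  then obtain e where e: "A = central_arc e" "d = circ (lab e)" using central_label_imp_arc by blast
  obtain x where "x \<in> limit_set" "julia_point x = central_arc e" "collapse x = circ (lab e)"
    by (rule central_arc_as_julia_point)
  then show "label_map A = d" using e label_map_julia_point[of x] limit_set_circle by auto
qed

text \<open>A chart is prescribed on the central arcs, which are dense in the limit set.\<close>

theorem label_chart_unique:
  assumes h: "label_chart h" and x: "x \<in> limit_set"
  shows "h (julia_point x) = collapse x"
proof -
  have hh: "continuous_map (subtopology julia_space boundary_C) (top_of_set circle) h"
    using h homeomorphic_imp_continuous_map by (auto simp: label_chart_def)
  have "continuous_map (top_of_set limit_set) julia_space julia_point"
    using continuous_map_from_subtopology[OF continuous_map_julia_point, of limit_set] limit_set_circle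
    by (simp add: subtopology_subtopology inf_absorb2)
  then have "continuous_map (top_of_set limit_set) (subtopology julia_space boundary_C) julia_point"
    by (simp add: continuous_map_in_subtopology boundary_C_eq)
  then have "continuous_map (top_of_set limit_set) (top_of_set circle) (h \<circ> julia_point)"
    using hh by (rule continuous_map_compose)
  then have ch: "continuous_on limit_set (\<lambda>x. h (julia_point x))" by (auto simp: o_def)
  moreover have "continuous_on limit_set collapse"
    using continuous_on_collapse continuous_on_subset limit_set_circle by blast
  ultimately have c: "continuous_on (closure (\<Union>(range central_arc))) (\<lambda>x. h (julia_point x) - collapse x)"
    unfolding limit_set_eq_closure[symmetric] by (intro continuous_intros)
  have "h (julia_point y) - collapse y = 0" if y: "y \<in> \<Union>(range central_arc)" for y
  proof -
    obtain e where e: "y \<in> central_arc e" using y by blast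
    have "h (central_arc e) = circ (lab e)" using h central_label_central_arc[of e] by (simp add: label_chart_def)
    then show ?thesis using julia_point_central_arc[OF e] collapse_central_arc[OF e] by simp
  qed
  then have "h (julia_point x) - collapse x = 0"
    by (rule continuous_constant_on_closure[OF c _ x[unfolded limit_set_eq_closure]])
  then show ?thesis by simp
qed

section \<open>Circle homeomorphisms and linear pieces\<close>

lemma circle_homeoI:
  assumes "f \<in> extensional circle" "continuous_on circle f" "inj_on f circle" "f ` circle = circle"
  shows "circle_homeo f"
  unfolding circle_homeo_def
proof (intro conjI assms(1) continuous_imp_homeomorphic_map)
  show "continuous_map (top_of_set circle) (top_of_set circle) f" using assms by auto
  show "compact_space (top_of_set circle)" by (simp add: compact_space_subtopology)
  show "Hausdorff_space (top_of_set circle)"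
    by (rule Hausdorff_space_subtopology) (rule Hausdorff_space_euclidean)
qed (use assms in simp_all)

lemma circle_homeoD:
  assumes "circle_homeo f"
  shows "f \<in> extensional circle" "continuous_on circle f" "inj_on f circle" "f ` circle = circle"
    "bij_betw f circle circle" "f \<in> Bij circle"
proof -
  show ext: "f \<in> extensional circle" using assms by (simp add: circle_homeo_def)
  have h: "homeomorphic_map (top_of_set circle) (top_of_set circle) f" using assms by (simp add: circle_homeo_def)
  then have "continuous_map (top_of_set circle) (top_of_set circle) f" by (rule homeomorphic_imp_continuous_map)
  then show "continuous_on circle f" by simp
  show i: "inj_on f circle" using homeomorphic_imp_injective_map[OF h] by simp
  show s: "f ` circle = circle" using homeomorphic_imp_surjective_map[OF h] by simp
  show b: "bij_betw f circle circle" using i s by (simp add: bij_betw_def)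
  show "f \<in> Bij circle" using b ext by (simp add: Bij_def)
qed

lemma circle_homeo_compose:
  assumes f: "circle_homeo f" and g: "circle_homeo g"
  shows "circle_homeo (compose circle g f)"
proof (rule circle_homeoI)
  have "bij_betw (compose circle g f) circle circle"
    using circle_homeoD(5)[OF f] circle_homeoD(5)[OF g] by (rule bij_betw_compose)
  then show "inj_on (compose circle g f) circle" "compose circle g f ` circle = circle"
    by (simp_all add: bij_betw_def)
  have "continuous_on circle (\<lambda>x. g (f x))"
    by (rule continuous_on_compose2[OF circle_homeoD(2)[OF g] circle_homeoD(2)[OF f]])
       (simp add: circle_homeoD(4)[OF f])
  then show "continuous_on circle (compose circle g f)"
    by (rule continuous_on_eq) (simp add: compose_def)
qed (simp add: compose_def)

lemma circle_homeo_inverse: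
  assumes f: "circle_homeo f"
  shows "circle_homeo (\<lambda>x\<in>circle. inv_into circle f x)"
proof (rule circle_homeoI)
  let ?g = "\<lambda>x\<in>circle. inv_into circle f x"
  have "?g \<in> Bij circle" by (rule restrict_inv_into_Bij[OF circle_homeoD(6)[OF f]])
  then show "inj_on ?g circle" "?g ` circle = circle" by (simp_all add: Bij_def bij_betw_def)
  have "continuous_on (f ` circle) (inv_into circle f)"
    using circle_homeoD[OF f] by (intro continuous_on_inv) (auto simp: inv_into_f_f)
  then have "continuous_on circle (inv_into circle f)" by (simp only: circle_homeoD(4)[OF f])
  then show "continuous_on circle ?g" by (rule continuous_on_eq) simp
qed simp

lemma circle_homeo_id: "circle_homeo (\<lambda>x\<in>circle. x)"
proof (rule circle_homeoI)
  show "continuous_on circle (\<lambda>x\<in>circle. x)" by (rule continuous_on_eq[OF continuous_on_id]) simp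
qed (auto simp: inj_on_def)

lemma maps_linearly_id: "maps_linearly (\<lambda>x\<in>circle. x) p p"
  by (simp add: maps_linearly_def)

lemma maps_linearly_compose:
  "maps_linearly f p q \<Longrightarrow> maps_linearly g q r \<Longrightarrow> maps_linearly (compose circle g f) p r"
  by (simp add: maps_linearly_def compose_def)

lemma maps_linearly_inverse:
  assumes "circle_homeo f" "maps_linearly f p q"
  shows "maps_linearly (\<lambda>x\<in>circle. inv_into circle f x) q p"
  unfolding maps_linearly_def
proof
  fix s :: real assume s: "s \<in> {0..1}"
  have "inv_into circle f (f (circ (fst p + s * (snd p - fst p)))) = circ (fst p + s * (snd p - fst p))"
    using circle_homeoD(3)[OF assms(1)] by (rule inv_into_f_f) simp
  then show "(\<lambda>x\<in>circle. inv_into circle f x) (circ (fst q + s * (snd q - fst q)))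
      = circ (fst p + s * (snd p - fst p))"
    using assms(2) s by (simp add: maps_linearly_def)
qed

definition subinterval :: "real \<times> real \<Rightarrow> real \<Rightarrow> real \<Rightarrow> real \<times> real" where
  "subinterval p a b = (fst p + a * (snd p - fst p), fst p + b * (snd p - fst p))"

lemma maps_linearly_subinterval:
  assumes "maps_linearly f p q" "0 \<le> a" "a \<le> b" "b \<le> 1"
  shows "maps_linearly f (subinterval p a b) (subinterval q a b)"
  unfolding maps_linearly_def
proof
  fix s :: real assume s: "s \<in> {0..1}"
  let ?u = "a + s * (b - a)"
  have "s * (b - a) \<le> 1 * (b - a)" using s assms by (intro mult_right_mono) auto
  then have u: "?u \<in> {0..1}" using s assms by auto
  have *: "fst (subinterval r a b) + s * (snd (subinterval r a b) - fst (subinterval r a b)) = fst r + ?u * (snd r - fst r)" for r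
    by (simp add: subinterval_def algebra_simps)
  show "f (circ (fst (subinterval p a b) + s * (snd (subinterval p a b) - fst (subinterval p a b))))
      = circ (fst (subinterval q a b) + s * (snd (subinterval q a b) - fst (subinterval q a b)))"
    unfolding * using assms(1) u by (simp add: maps_linearly_def)
qed

lemma label_cell_append: "label_cell (v @ s) = subinterval (label_cell v) (bin_val s) (bin_val s + 1 / 2 ^ length s)"
  by (simp add: label_cell_def subinterval_def bin_val_append power_add add_divide_distrib algebra_simps)

lemma cap_append: "cap (Some (v @ s)) = subinterval (cell v) (gapl s) (gapr s)"
  unfolding cap.simps gapl_append gapr_append cell_point[symmetric] by (simp add: subinterval_def)

lemma maps_linearly_label_cell:
  "maps_linearly f (label_cell v) (label_cell w) \<Longrightarrow> maps_linearly f (label_cell (v @ s)) (label_cell (w @ s))"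
  unfolding label_cell_append using bin_val_ge_0[of s] bin_val_le_1[of s] by (intro maps_linearly_subinterval) auto

lemma maps_linearly_cap:
  "maps_linearly f (cell v) (cell w) \<Longrightarrow> maps_linearly f (cap (Some (v @ s))) (cap (Some (w @ s)))"
  unfolding cap_append using gapl_pos[of s] gapr_less_1[of s] gapl_less_gapr[of s]
  by (intro maps_linearly_subinterval) auto

lemma maps_linearly_image:
  assumes "maps_linearly f p q" "fst p < snd p" "fst q < snd q"
  shows "f ` circ ` {fst p..snd p} = circ ` {fst q..snd q}"
    "f ` circ ` {fst p<..<snd p} = circ ` {fst q<..<snd q}"
proof -
  have "{fst r..snd r} = (\<lambda>s. fst r + s * (snd r - fst r)) ` {0..1}"
    "{fst r<..<snd r} = (\<lambda>s. fst r + s * (snd r - fst r)) ` {0<..<1}" if r: "fst r < snd r" for r :: "real \<times> real"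
  proof -
    have d: "0 < snd r - fst r" using r by simp
    have x: "x = fst r + ((x - fst r) / (snd r - fst r)) * (snd r - fst r)" for x using d by simp
    have le: "s * (snd r - fst r) \<le> 1 * (snd r - fst r)" if "s \<le> 1" for s using that d by (intro mult_right_mono) auto
    have lt: "s * (snd r - fst r) < 1 * (snd r - fst r)" if "s < 1" for s using that d by (intro mult_strict_right_mono) auto
    have b: "0 \<le> (x - fst r) / (snd r - fst r) \<longleftrightarrow> fst r \<le> x" "(x - fst r) / (snd r - fst r) \<le> 1 \<longleftrightarrow> x \<le> snd r"
       "0 < (x - fst r) / (snd r - fst r) \<longleftrightarrow> fst r < x" "(x - fst r) / (snd r - fst r) < 1 \<longleftrightarrow> x < snd r" for x
      using d by (simp_all add: zero_le_divide_iff zero_less_divide_iff divide_le_eq_1 divide_less_eq_1)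
    show "{fst r..snd r} = (\<lambda>s. fst r + s * (snd r - fst r)) ` {0..1}"
    proof (intro subset_antisym subsetI)
      fix y assume "y \<in> {fst r..snd r}"
      then show "y \<in> (\<lambda>s. fst r + s * (snd r - fst r)) ` {0..1}"
        by (intro image_eqI[where x = "(y - fst r) / (snd r - fst r)"] x) (simp add: b)
    next
      fix y assume "y \<in> (\<lambda>s. fst r + s * (snd r - fst r)) ` {0..1}"
      then show "y \<in> {fst r..snd r}" proof (elim imageE)
        fix u assume u: "y = fst r + u * (snd r - fst r)" "u \<in> {0..1}"
        have "0 \<le> u * (snd r - fst r)" using u d by simp
        then show ?thesis using le[of u] u by simp
      qed
    qed
    show "{fst r<..<snd r} = (\<lambda>s. fst r + s * (snd r - fst r)) ` {0<..<1}"
    proof (intro subset_antisym subsetI)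
      fix y assume "y \<in> {fst r<..<snd r}"
      then show "y \<in> (\<lambda>s. fst r + s * (snd r - fst r)) ` {0<..<1}"
        by (intro image_eqI[where x = "(y - fst r) / (snd r - fst r)"] x) (simp add: b)
    next
      fix y assume "y \<in> (\<lambda>s. fst r + s * (snd r - fst r)) ` {0<..<1}"
      then show "y \<in> {fst r<..<snd r}" proof (elim imageE)
        fix u assume u: "y = fst r + u * (snd r - fst r)" "u \<in> {0<..<1}"
        have "0 < u * (snd r - fst r)" using u d by simp
        then show ?thesis using lt[of u] u by simp
      qed
    qed
  qed
  note r = this[OF assms(2)] this[OF assms(3)]
  show "f ` circ ` {fst p..snd p} = circ ` {fst q..snd q}"
    "f ` circ ` {fst p<..<snd p} = circ ` {fst q<..<snd q}"
    unfolding r image_image using assms(1) by (auto simp: maps_linearly_def intro!: image_cong)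
qed

lemma maps_linearly_circ:
  assumes "maps_linearly f p q" "fst p < snd p" "fst p \<le> t" "t \<le> snd p"
  shows "f (circ t) = circ (fst q + (t - fst p) / (snd p - fst p) * (snd q - fst q))"
proof -
  have "(t - fst p) / (snd p - fst p) \<in> {0..1}" using assms(2-4) by simp
  moreover have "fst p + (t - fst p) / (snd p - fst p) * (snd p - fst p) = t" using assms(2) by simp
  ultimately show ?thesis using assms(1) unfolding maps_linearly_def by metis
qed

text \<open>Pasting along finitely many closed pieces.\<close>

lemma piecewise_linear_continuous:
  assumes "finite P" "(\<Union>p\<in>P. circ ` {fst p..snd p}) = circle"
    "\<And>p. p \<in> P \<Longrightarrow> fst p < snd p" "\<And>p. p \<in> P \<Longrightarrow> \<exists>q. maps_linearly f p q"
  shows "continuous_on circle f"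
proof -
  have "continuous_on (\<Union>p\<in>P. circ ` {fst p..snd p}) f"
  proof (rule continuous_on_closed_Union[OF assms(1)])
    fix p assume p: "p \<in> P"
    show "closed (circ ` {fst p..snd p})"
      by (intro compact_imp_closed compact_continuous_image continuous_on_circ) auto
    obtain q where q: "maps_linearly f p q" using assms(4)[OF p] by blast
    show "continuous_on (circ ` {fst p..snd p}) f"
    proof (rule continuous_on_compact_image[OF _ continuous_on_circ])
      have "continuous_on {fst p..snd p} (\<lambda>t. circ (fst q + (t - fst p) / (snd p - fst p) * (snd q - fst q)))"
        by (rule continuous_on_compose2[OF continuous_on_circ[of UNIV]])
           (use assms(3)[OF p] in \<open>auto intro!: continuous_intros\<close>)
      then show "continuous_on {fst p..snd p} (\<lambda>t. f (circ t))"
        by (rule continuous_on_eq) (use maps_linearly_circ[OF q assms(3)[OF p]] in simp)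
    qed simp
  qed
  then show ?thesis by (simp only: assms(2))
qed

section \<open>Dyadic subdivisions and Thompson's group\<close>

lemma label_cell_less: "fst (label_cell w) < snd (label_cell w)"
  by (simp add: label_cell_def)

lemma label_cell_inj: "label_cell v = label_cell w \<Longrightarrow> v = w"
proof -
  assume eq: "label_cell v = label_cell w"
  then have n: "bin_val v = bin_val w" by (simp add: label_cell_def)
  then have "1 / 2 ^ length v = 1 / (2::real) ^ length w" using eq by (simp add: label_cell_def)
  then have "bin_mid v = bin_mid w" using n by (simp add: bin_mid_eq)
  then show ?thesis by (rule bin_mid_inj)
qed

text \<open>Two dyadic intervals are nested or have disjoint interiors, and the midpoint of one of them is an end
only of intervals inside it.\<close>

lemma bin_mid_comparable:
  "bin_val w \<le> bin_mid v \<Longrightarrow> bin_mid v \<le> bin_val w + 1 / 2 ^ length w \<Longrightarrow> prefix v w \<or> prefix w v"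
proof (induction w arbitrary: v)
  case (Cons b w)
  show ?case
  proof (cases v)
    case v: (Cons c u)
    have "of_bool b + bin_val w \<le> of_bool c + bin_mid u" "of_bool c + bin_mid u \<le> of_bool b + (bin_val w + 1 / 2 ^ length w)"
      using Cons.prems v by (auto simp: field_simps)
    then have bc: "b = c"
      using bin_mid_bounds[of u] bin_val_ge_0[of w] bin_val_le_1[of w] by (cases b; cases c; simp)
    have "prefix u w \<or> prefix w u"
      using Cons.IH[of u] \<open>of_bool b + bin_val w \<le> _\<close> \<open>of_bool c + bin_mid u \<le> _\<close> bc by simp
    then show ?thesis using bc v by simp
  qed simp
qed simp

lemma prefix_label_cell: "prefix v w \<Longrightarrow> bin_val v < bin_mid w \<and> bin_mid w < bin_val v + 1 / 2 ^ length v"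
proof -
  assume "prefix v w"
  then obtain s where "w = v @ s" by (auto simp: prefix_def)
  then show ?thesis using bin_mid_bounds[of s] by (simp add: bin_mid_append divide_strict_right_mono)
qed

lemma dyadic_interval_iff:
  "(\<exists>(m::nat) (k::nat). k < 2 ^ m \<and> p = (real k / 2 ^ m, (real k + 1) / 2 ^ m)) \<longleftrightarrow> p \<in> range label_cell"
proof
  assume "\<exists>(m::nat) (k::nat). k < 2 ^ m \<and> p = (real k / 2 ^ m, (real k + 1) / 2 ^ m)"
  then obtain m k :: nat where k: "k < 2 ^ m" "p = (real k / 2 ^ m, (real k + 1) / 2 ^ m)" by blast
  then obtain w where "length w = m" "bin_val w = real k / 2 ^ m" using dyadic_bin_val by blast
  then have "p = label_cell w" using k by (simp add: label_cell_def add_divide_distrib)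
  then show "p \<in> range label_cell" by blast
next
  assume "p \<in> range label_cell"
  then obtain w where w: "p = label_cell w" by blast
  obtain k :: nat where "k < 2 ^ length w" "bin_val w = real k / 2 ^ length w" by (rule bin_val_dyadic)
  then show "\<exists>(m::nat) (k::nat). k < 2 ^ m \<and> p = (real k / 2 ^ m, (real k + 1) / 2 ^ m)"
    unfolding w by (intro exI[of _ "length w"] exI[of _ k]) (simp add: label_cell_def add_divide_distrib)
qed

lemma label_cell_range: "0 \<le> fst (label_cell w)" "snd (label_cell w) \<le> 1"
  using bin_val_ge_0 bin_val_le_1 by (simp_all add: label_cell_def)

lemma open_label_cells_disjoint:
  assumes "halved S E" "v \<in> S" "w \<in> S" "v \<noteq> w"
  shows "circ ` {fst (label_cell v)<..<snd (label_cell v)} \<inter> circ ` {fst (label_cell w)<..<snd (label_cell w)} = {}"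
proof -
  have False if s: "s \<in> {fst (label_cell v)<..<snd (label_cell v)}" and t: "t \<in> {fst (label_cell w)<..<snd (label_cell w)}"
    and eq: "circ s = circ t" for s t
  proof -
    have "\<bar>s - t\<bar> < 1"
      using s t label_cell_range[of v] label_cell_range[of w] by auto
    then have "s = t" using eq circ_eq_near by blast
    then show False using s t halved_partition(3)[OF assms] by (auto simp: label_cell_def)
  qed
  then show ?thesis by blast
qed

lemma halved_label_cover:
  assumes "halved S E" "d \<in> circle"
  obtains w s where "w \<in> S" "0 \<le> s" "s \<le> 1" "d = circ (bin_val w + s / 2 ^ length w)"
proof -
  obtain t where t: "0 \<le> t" "t < 0 + 1" "circ t = d" using circ_surj[OF assms(2)] by metis
  then have "t \<in> (\<Union>w\<in>S. {bin_val w..bin_val w + 1 / 2 ^ length w})" using halved_partition(2)[OF assms(1)] by simp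
  then obtain w where w: "w \<in> S" "bin_val w \<le> t" "t \<le> bin_val w + 1 / 2 ^ length w" by auto
  show ?thesis
    by (rule that[of w "(t - bin_val w) * 2 ^ length w"]) (use w t in \<open>auto simp: field_simps\<close>)
qed

lemma halved_dyadic_subdivision:
  assumes "halved S E"
  shows "dyadic_subdivision (label_cell ` S)"
  unfolding dyadic_subdivision_def dyadic_interval_iff
proof (intro conjI)
  show "finite (label_cell ` S)" using halved_partition(1)[OF assms] by simp
  show "\<forall>p\<in>label_cell ` S. p \<in> range label_cell" by blast
  show "(\<Union>(a, b)\<in>label_cell ` S. circ ` {a..b}) = circle"
  proof
    show "(\<Union>(a, b)\<in>label_cell ` S. circ ` {a..b}) \<subseteq> circle" by auto
    show "circle \<subseteq> (\<Union>(a, b)\<in>label_cell ` S. circ ` {a..b})"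
    proof
      fix d assume "d \<in> circle"
      then obtain w s where w: "w \<in> S" "0 \<le> s" "s \<le> 1" "d = circ (bin_val w + s / 2 ^ length w)"
        by (rule halved_label_cover[OF assms])
      then have "bin_val w + s / 2 ^ length w \<in> {bin_val w..bin_val w + 1 / 2 ^ length w}"
        by (auto simp: divide_right_mono)
      then show "d \<in> (\<Union>(a, b)\<in>label_cell ` S. circ ` {a..b})"
        unfolding w(4) by (intro UN_I[OF imageI[OF w(1)]]) (simp add: label_cell_def)
    qed
  qed
  show "pairwise (\<lambda>(a, b) (c, d). disjnt (circ ` {a<..<b}) (circ ` {c<..<d})) (label_cell ` S)"
  proof (rule pairwiseI)
    fix p q assume "p \<in> label_cell ` S" "q \<in> label_cell ` S" "p \<noteq> q"
    then obtain v w where "v \<in> S" "w \<in> S" "p = label_cell v" "q = label_cell w" "v \<noteq> w" by blast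
    then show "(\<lambda>(a, b) (c, d). disjnt (circ ` {a<..<b}) (circ ` {c<..<d})) p q"
      using open_label_cells_disjoint[OF assms, of v w] by (simp add: case_prod_beta disjnt_def)
  qed
qed

text \<open>A finite, complete set of pairwise incomparable words is the set of leaves of a tree.  The induction
runs down from a word \<open>v\<close> above which nothing of \<open>S\<close> lies, with \<open>T\<close> as the other leaves: either \<open>v\<close> is in
\<open>S\<close>, or by completeness words of \<open>S\<close> lie properly below \<open>v\<close>, and \<open>v\<close> is split.\<close>

lemma antichain_halved:
  assumes fin: "finite S" and anti: "\<And>v w. v \<in> S \<Longrightarrow> w \<in> S \<Longrightarrow> prefix v w \<Longrightarrow> v = w"
    and compl: "\<And>v. \<exists>w\<in>S. prefix v w \<or> prefix w v"
  shows "\<exists>E. halved S E"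
proof -
  \<comment> \<open>a bound for the depth of the tree, which makes the induction terminate\<close>
  obtain N where N: "\<And>w. w \<in> S \<Longrightarrow> length w \<le> N"
    using finite_nat_set_iff_bounded_le[of "length ` S"] fin by auto
  define above where "above v = {w \<in> S. prefix v w}" for v
  have main: "\<exists>E'. halved (T \<union> above v) E'"
    if "Suc N - length v = n" "\<And>w. w \<in> S \<Longrightarrow> \<not> strict_prefix w v" "halved (insert v T) E" "\<And>t. t \<in> T \<Longrightarrow> \<not> prefix v t"
    for n v T E
    using that
  proof (induction n arbitrary: v T E rule: less_induct)
    case (less n)
    show ?case
    proof (cases "v \<in> S")
      case True
      then have "above v = {v}" using anti by (auto simp: above_def)
      then show ?thesis using less.prems by auto
    next
      case False
      then obtain w where w: "w \<in> S" "strict_prefix v w"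
        using compl[of v] less.prems(2) by (auto simp: strict_prefix_def)
      have lv: "length v < N" using prefix_length_less[OF w(2)] N[OF w(1)] by linarith
      let ?v0 = "v @ [False]" and ?v1 = "v @ [True]"
      have lt: "Suc N - length (v @ [b]) < n" for b using lv less.prems(1) by simp
      have ns: "\<not> strict_prefix u (v @ [b])" if "u \<in> S" for u b
      proof
        assume "strict_prefix u (v @ [b])"
        then have "prefix u v" by (auto simp: strict_prefix_def prefix_snoc)
        then show False using that False less.prems(2) by (auto simp: strict_prefix_def)
      qed
      have ext: "prefix v t" if "prefix (v @ [b]) t" for b t
        using that by (rule append_prefixD)
      have "v \<notin> T" using less.prems(4) by blast
      then have "insert v T - {v} \<union> {?v0, ?v1} = insert ?v0 (insert ?v1 T)" by auto
      then have "halved (insert ?v0 (insert ?v1 T)) (insert (Some v) E)"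
        using halved.split[OF less.prems(3), of v] by simp
      moreover have "\<not> prefix ?v0 t" if "t \<in> insert ?v1 T" for t
        using that less.prems(4) ext by auto
      ultimately obtain E1 where "halved (insert ?v1 T \<union> above ?v0) E1"
        using less.IH[OF lt refl ns] by blast
      then have "halved (insert ?v1 (T \<union> above ?v0)) E1" by simp
      moreover have "\<not> prefix ?v1 t" if "t \<in> T \<union> above ?v0" for t
      proof
        assume t: "prefix ?v1 t"
        have "t \<notin> T" using ext[OF t] less.prems(4) by blast
        then have "prefix ?v0 t" using that by (auto simp: above_def)
        then show False using t by (auto simp: prefix_def)
      qed
      ultimately obtain E2 where "halved (T \<union> above ?v0 \<union> above ?v1) E2"
        using less.IH[OF lt refl ns] by blast
      moreover have "above v = above ?v0 \<union> above ?v1"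
      proof
        show "above v \<subseteq> above ?v0 \<union> above ?v1"
        proof
          fix u assume u: "u \<in> above v"
          then obtain s where s: "u = v @ s" by (auto simp: above_def prefix_def)
          have "s \<noteq> []" using u s False by (auto simp: above_def)
          then obtain b s' where "s = b # s'" by (cases s) auto
          then show "u \<in> above ?v0 \<union> above ?v1" using u s by (cases b) (auto simp: above_def prefix_def)
        qed
        show "above ?v0 \<union> above ?v1 \<subseteq> above v" using ext by (auto simp: above_def)
      qed
      ultimately show ?thesis by (auto simp: Un_assoc)
    qed
  qed
  have "\<exists>E'. halved ({} \<union> above []) E'"
    by (rule main[OF refl]) (use halved.root in \<open>auto simp: strict_prefix_def\<close>)
  moreover have "above [] = S" by (auto simp: above_def)
  ultimately show ?thesis by simp
qed

lemma dyadic_subdivision_halved: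
  assumes "dyadic_subdivision P"
  obtains S E where "halved S E" "P = label_cell ` S"
proof -
  define S where "S = {w. label_cell w \<in> P}"
  have P: "P = label_cell ` S"
  proof -
    have "\<forall>p\<in>P. p \<in> range label_cell"
      using assms unfolding dyadic_subdivision_def dyadic_interval_iff by (elim conjE)
    then show ?thesis unfolding S_def by auto
  qed
  have "finite S"
  proof (rule finite_imageD)
    show "finite (label_cell ` S)" using assms P by (simp add: dyadic_subdivision_def)
    show "inj_on label_cell S" using label_cell_inj by (auto intro: inj_onI)
  qed
  moreover have "v = w" if "v \<in> S" "w \<in> S" "prefix v w" for v w
  proof (rule ccontr)
    assume "v \<noteq> w"
    then have "label_cell v \<noteq> label_cell w" using label_cell_inj by blast
    moreover have "label_cell v \<in> P" "label_cell w \<in> P" using that by (auto simp: S_def)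
    moreover have "pairwise (\<lambda>(a, b) (c, d). disjnt (circ ` {a<..<b}) (circ ` {c<..<d})) P"
      using assms by (simp add: dyadic_subdivision_def)
    ultimately have "disjnt (circ ` {bin_val v<..<bin_val v + 1 / 2 ^ length v}) (circ ` {bin_val w<..<bin_val w + 1 / 2 ^ length w})"
      by (force simp: pairwise_def label_cell_def)
    moreover have "bin_mid w \<in> {bin_val v<..<bin_val v + 1 / 2 ^ length v}" "bin_mid w \<in> {bin_val w<..<bin_val w + 1 / 2 ^ length w}"
      using prefix_label_cell[OF that(3)] prefix_label_cell[of w w] by auto
    ultimately show False unfolding disjnt_def by blast
  qed
  moreover have "\<exists>w\<in>S. prefix v w \<or> prefix w v" for v
  proof -
    have "circ (bin_mid v) \<in> (\<Union>(a, b)\<in>P. circ ` {a..b})"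
      using assms circ_in_circle unfolding dyadic_subdivision_def by metis
    then obtain w t where w: "w \<in> S" "bin_val w \<le> t" "t \<le> bin_val w + 1 / 2 ^ length w" "circ (bin_mid v) = circ t"
      unfolding P by (auto simp: label_cell_def)
    have "\<bar>bin_mid v - t\<bar> < 1"
      using w bin_mid_bounds[of v] bin_val_ge_0[of w] bin_val_le_1[of w] by auto
    then have "bin_mid v = t" using w(4) circ_eq_near by blast
    then show ?thesis using w bin_mid_comparable[of w v] by auto
  qed
  ultimately obtain E where "halved S E" using antichain_halved by blast
  then show ?thesis using that P by blast
qed

lemma halved_comparable:
  assumes "halved S E"
  obtains w where "w \<in> S" "prefix v w \<or> prefix w v"
proof -
  have "bin_mid v \<in> (\<Union>w\<in>S. {bin_val w..bin_val w + 1 / 2 ^ length w})"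
    using bin_mid_bounds[of v] halved_partition(2)[OF assms] by simp
  then obtain w where "w \<in> S" "bin_val w \<le> bin_mid v" "bin_mid v \<le> bin_val w + 1 / 2 ^ length w" by auto
  then show ?thesis using that[of w] bin_mid_comparable[of w v] by blast
qed

text \<open>Small dyadic intervals go linearly to dyadic intervals, and the level drops by at most \<open>n\<close>.  Unlike
a pair of subdivisions, this passes to composites without common refinements.\<close>

definition eventually_dyadic :: "(complex \<Rightarrow> complex) \<Rightarrow> nat \<Rightarrow> bool" where
  "eventually_dyadic g n \<longleftrightarrow> (\<forall>w. n \<le> length w \<longrightarrow>
     (\<exists>w'. length w \<le> length w' + n \<and> maps_linearly g (label_cell w) (label_cell w')))"

lemma thompson_T_eventually_dyadic:
  assumes "g \<in> thompson_T"
  obtains n where "eventually_dyadic g n"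
proof -
  obtain P Q where PQ: "dyadic_subdivision P" "dyadic_subdivision Q" "\<forall>p\<in>P. \<exists>q\<in>Q. maps_linearly g p q"
    using assms by (auto simp: thompson_T_def)
  obtain S E where S: "halved S E" "P = label_cell ` S" using dyadic_subdivision_halved[OF PQ(1)] by metis
  obtain S' E' where S': "halved S' E'" "Q = label_cell ` S'" using dyadic_subdivision_halved[OF PQ(2)] by metis
  obtain n where n: "\<And>w. w \<in> S \<Longrightarrow> length w \<le> n"
    using finite_nat_set_iff_bounded_le[of "length ` S"] halved_partition(1)[OF S(1)] by auto
  have "\<exists>w'. length w \<le> length w' + n \<and> maps_linearly g (label_cell w) (label_cell w')" if w: "n \<le> length w" for w
  proof -
    obtain v where v: "v \<in> S" "prefix w v \<or> prefix v w" using halved_comparable[OF S(1)] by metis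
    have "prefix v w"
    proof (cases "prefix v w")
      case False
      then have "prefix w v" using v by blast
      then have "length w \<le> length v" by (rule prefix_length_le)
      then have "length w = length v" using n[OF v(1)] w by linarith
      then show ?thesis using \<open>prefix w v\<close> by (auto simp: prefix_def)
    qed
    then obtain s where s: "w = v @ s" by (auto simp: prefix_def)
    obtain v' where "maps_linearly g (label_cell v) (label_cell v')" using PQ(3) v(1) S(2) S'(2) by blast
    then have "maps_linearly g (label_cell w) (label_cell (v' @ s))"
      unfolding s by (rule maps_linearly_label_cell)
    moreover have "length w \<le> length (v' @ s) + n" using n[OF v(1)] s by simp
    ultimately show ?thesis by blast
  qed
  then show ?thesis using that unfolding eventually_dyadic_def by blast
qed

lemma eventually_dyadic_mono: "eventually_dyadic g n \<Longrightarrow> n \<le> m \<Longrightarrow> eventually_dyadic g m"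
  unfolding eventually_dyadic_def by (meson add_left_mono order_trans)

lemma level_halved: "\<exists>E. halved {w. length w = n} E"
proof (rule antichain_halved)
  show "finite {w :: node. length w = n}" using finite_lists_length_eq[of "UNIV :: bool set" n] by simp
  show "\<exists>w\<in>{w. length w = n}. prefix v w \<or> prefix w v" for v :: node
  proof (cases "length v \<le> n")
    case True
    then show ?thesis by (intro bexI[of _ "v @ replicate (n - length v) False"]) auto
  next
    case False
    then show ?thesis by (intro bexI[of _ "take n v"]) (auto simp: take_is_prefix)
  qed
qed (auto simp: prefix_def)

text \<open>The images of the dyadic intervals of level \<open>n\<close> again form a subdivision.\<close>

lemma eventually_dyadic_pieces:
  assumes g: "circle_homeo g" and n: "eventually_dyadic g n" "1 \<le> n"
  obtains S E S' E' \<sigma> where "halved S E" "halved S' E'" "[] \<notin> S" "[] \<notin> S'" "bij_betw \<sigma> S S'"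
    "\<And>w. w \<in> S \<Longrightarrow> maps_linearly g (label_cell w) (label_cell (\<sigma> w))"
proof -
  define S where "S = {w :: node. length w = n}"
  obtain E where S: "halved S E" using level_halved S_def by metis
  have "\<forall>w\<in>S. \<exists>w'. maps_linearly g (label_cell w) (label_cell w')"
    using n(1) unfolding eventually_dyadic_def S_def by auto
  then obtain \<sigma> where lin: "\<And>w. w \<in> S \<Longrightarrow> maps_linearly g (label_cell w) (label_cell (\<sigma> w))" by metis
  define Op where "Op w = circ ` {fst (label_cell w)<..<snd (label_cell w)}" for w
  define K where "K w = circ ` {fst (label_cell w)..snd (label_cell w)}" for w
  have img: "g ` Op w = Op (\<sigma> w)" "g ` K w = K (\<sigma> w)" if "w \<in> S" for w
    unfolding Op_def K_def using maps_linearly_image[OF lin[OF that] label_cell_less label_cell_less] by simp_all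
  have Oc: "Op w \<subseteq> circle" for w by (auto simp: Op_def)
  have disj: "Op (\<sigma> v) \<inter> Op (\<sigma> w) = {}" if "v \<in> S" "w \<in> S" "v \<noteq> w" for v w
  proof -
    have "Op v \<inter> Op w = {}" using open_label_cells_disjoint[OF S that] by (simp add: Op_def)
    then have "g ` Op v \<inter> g ` Op w = {}"
      using inj_on_image_Int[OF circle_homeoD(3)[OF g] Oc Oc, of v w] by simp
    then show ?thesis using img that by simp
  qed
  have One: "Op w \<noteq> {}" for w using label_cell_less[of w] by (auto simp: Op_def)
  have inj: "inj_on \<sigma> S"
  proof (rule inj_onI, rule ccontr)
    fix v w assume "v \<in> S" "w \<in> S" "\<sigma> v = \<sigma> w" "v \<noteq> w"
    then show False using disj[of v w] One by auto
  qed
  have "dyadic_subdivision (label_cell ` \<sigma> ` S)"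
    unfolding dyadic_subdivision_def dyadic_interval_iff
  proof (intro conjI)
    show "finite (label_cell ` \<sigma> ` S)" using halved_partition(1)[OF S] by simp
    show "\<forall>p\<in>label_cell ` \<sigma> ` S. p \<in> range label_cell" by blast
    have "(\<Union>w\<in>S. K w) = circle"
      using halved_dyadic_subdivision[OF S] by (simp add: dyadic_subdivision_def K_def case_prod_beta)
    then have "(\<Union>w\<in>S. g ` K w) = circle"
      using circle_homeoD(4)[OF g] by (simp only: image_UN[symmetric])
    then have "(\<Union>w\<in>S. K (\<sigma> w)) = circle" using img by simp
    then show "(\<Union>(a, b)\<in>label_cell ` \<sigma> ` S. circ ` {a..b}) = circle"
      by (simp add: K_def case_prod_beta)
    show "pairwise (\<lambda>(a, b) (c, d). disjnt (circ ` {a<..<b}) (circ ` {c<..<d})) (label_cell ` \<sigma> ` S)"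
    proof (rule pairwiseI)
      fix p q assume "p \<in> label_cell ` \<sigma> ` S" "q \<in> label_cell ` \<sigma> ` S" "p \<noteq> q"
      then obtain v w where "v \<in> S" "w \<in> S" "p = label_cell (\<sigma> v)" "q = label_cell (\<sigma> w)" "v \<noteq> w" by blast
      then show "(\<lambda>(a, b) (c, d). disjnt (circ ` {a<..<b}) (circ ` {c<..<d})) p q"
        using disj[of v w] by (simp add: case_prod_beta disjnt_def Op_def)
    qed
  qed
  then obtain S' E' where S': "halved S' E'" "label_cell ` \<sigma> ` S = label_cell ` S'"
    by (rule dyadic_subdivision_halved)
  have "inj label_cell" using label_cell_inj by (rule injI)
  then have "\<sigma> ` S = S'" using S'(2) by (simp add: inj_image_eq_iff)
  have "[] \<notin> S" using n by (simp add: S_def)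
  moreover have "[] \<notin> S'"
  proof
    assume "[] \<in> S'"
    then have "S' = {[]}" using halved_root[OF S'(1)] by blast
    moreover have "replicate n False \<in> S" "replicate n True \<in> S" by (simp_all add: S_def)
    ultimately have "\<sigma> (replicate n False) \<in> {[]}" "\<sigma> (replicate n True) \<in> {[]}"
      using \<open>\<sigma> ` S = S'\<close> imageI[of _ S \<sigma>] by simp_all
    then have "\<sigma> (replicate n False) = \<sigma> (replicate n True)" by simp
    then have "replicate n False = replicate n True"
      using inj \<open>replicate n False \<in> S\<close> \<open>replicate n True \<in> S\<close> by (simp add: inj_on_eq_iff)
    then show False using n by (cases n) auto
  qed
  moreover have "bij_betw \<sigma> S S'" using inj \<open>\<sigma> ` S = S'\<close> by (simp add: bij_betw_def)
  ultimately show ?thesis by (rule that[OF S S'(1) _ _ _ lin])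
qed

lemma thompson_T_pieces:
  assumes "g \<in> thompson_T"
  obtains S E S' E' \<sigma> where "halved S E" "halved S' E'" "[] \<notin> S" "[] \<notin> S'" "bij_betw \<sigma> S S'"
    "\<And>w. w \<in> S \<Longrightarrow> maps_linearly g (label_cell w) (label_cell (\<sigma> w))"
proof -
  obtain n where "eventually_dyadic g n" using thompson_T_eventually_dyadic[OF assms] .
  \<comment> \<open>a positive level excludes the trivial tree, which is not an arc diagram\<close>
  then have n: "eventually_dyadic g (Suc n)" by (rule eventually_dyadic_mono) simp
  have g: "circle_homeo g" using assms by (simp add: thompson_T_def)
  show ?thesis by (rule eventually_dyadic_pieces[OF g n]) (simp, rule that)
qed

lemma thompson_T_homeo: "g \<in> thompson_T \<Longrightarrow> circle_homeo g"
  by (simp add: thompson_T_def)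

lemma thompson_TI:
  assumes "circle_homeo g" "halved S E" "halved S' E'"
    "\<And>w. w \<in> S \<Longrightarrow> \<exists>w'\<in>S'. maps_linearly g (label_cell w) (label_cell w')"
  shows "g \<in> thompson_T"
  unfolding thompson_T_def
  using assms halved_dyadic_subdivision[OF assms(2)] halved_dyadic_subdivision[OF assms(3)] by blast

lemma thompson_T_compose:
  assumes f: "f \<in> thompson_T" and g: "g \<in> thompson_T"
  shows "compose circle g f \<in> thompson_T"
proof -
  have h: "circle_homeo (compose circle g f)"
    using circle_homeo_compose thompson_T_homeo f g by blast
  obtain n where n: "eventually_dyadic f n" using thompson_T_eventually_dyadic[OF f] .
  obtain m where m: "eventually_dyadic g m" using thompson_T_eventually_dyadic[OF g] .
  have "eventually_dyadic (compose circle g f) (Suc (n + m))"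
    unfolding eventually_dyadic_def
  proof (intro allI impI)
    fix w :: node assume w: "Suc (n + m) \<le> length w"
    then obtain w' where w': "length w \<le> length w' + n" "maps_linearly f (label_cell w) (label_cell w')"
      using n unfolding eventually_dyadic_def by (meson Suc_leD le_trans le_add1)
    then obtain w'' where w'': "length w' \<le> length w'' + m" "maps_linearly g (label_cell w') (label_cell w'')"
      using m w unfolding eventually_dyadic_def by (metis add_le_imp_le_left add.commute Suc_leD le_trans)
    show "\<exists>w''. length w \<le> length w'' + Suc (n + m) \<and>
        maps_linearly (compose circle g f) (label_cell w) (label_cell w'')"
      using w' w'' maps_linearly_compose by (intro exI[of _ w'']) auto
  qed
  then obtain S E S' E' \<sigma> where "halved S E" "halved S' E'" "bij_betw \<sigma> S S'"
    "\<And>w. w \<in> S \<Longrightarrow> maps_linearly (compose circle g f) (label_cell w) (label_cell (\<sigma> w))"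
    using eventually_dyadic_pieces[OF h] by (metis le_add1 plus_1_eq_Suc)
  then show ?thesis using thompson_TI[OF h] bij_betwE by metis
qed

lemma thompson_T_inverse:
  assumes g: "g \<in> thompson_T"
  shows "(\<lambda>x\<in>circle. inv_into circle g x) \<in> thompson_T"
proof -
  obtain S E S' E' \<sigma> where S: "halved S E" "halved S' E'" "bij_betw \<sigma> S S'"
    and lin: "\<And>w. w \<in> S \<Longrightarrow> maps_linearly g (label_cell w) (label_cell (\<sigma> w))"
    using thompson_T_pieces[OF g] by metis
  show ?thesis
  proof (rule thompson_TI[OF circle_homeo_inverse S(2) S(1)])
    fix w assume "w \<in> S'"
    then obtain v where v: "v \<in> S" "w = \<sigma> v" using S(3) by (auto simp: bij_betw_def)
    then show "\<exists>w'\<in>S. maps_linearly (\<lambda>x\<in>circle. inv_into circle g x) (label_cell w) (label_cell w')"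
      using maps_linearly_inverse[OF thompson_T_homeo[OF g] lin] by blast
  qed (use g thompson_T_homeo in blast)
qed

lemma thompson_T_id: "(\<lambda>x\<in>circle. x) \<in> thompson_T"
  using thompson_TI[OF circle_homeo_id halved.root halved.root] maps_linearly_id by blast

lemma subgroup_BijGroupI:
  assumes "\<And>f. f \<in> H \<Longrightarrow> circle_homeo f" "(\<lambda>x\<in>circle. x) \<in> H"
    "\<And>f g. f \<in> H \<Longrightarrow> g \<in> H \<Longrightarrow> compose circle g f \<in> H"
    "\<And>f. f \<in> H \<Longrightarrow> (\<lambda>x\<in>circle. inv_into circle f x) \<in> H"
  shows "subgroup H (BijGroup circle)"
proof
  have B: "f \<in> Bij circle" if "f \<in> H" for f using assms(1)[OF that] by (rule circle_homeoD(6))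
  then show "H \<subseteq> carrier (BijGroup circle)" by (auto simp: BijGroup_def)
  show "x \<otimes>\<^bsub>BijGroup circle\<^esub> y \<in> H" if "x \<in> H" "y \<in> H" for x y
    using that B assms(3) by (simp add: BijGroup_def)
  show "\<one>\<^bsub>BijGroup circle\<^esub> \<in> H" using assms(2) by (simp add: BijGroup_def)
  show "inv\<^bsub>BijGroup circle\<^esub> x \<in> H" if "x \<in> H" for x
    using inv_BijGroup[OF B[OF that]] assms(4)[OF that] by simp
qed

theorem subgroup_thompson_T: "subgroup thompson_T (BijGroup circle)"
  by (intro subgroup_BijGroupI thompson_T_homeo thompson_T_id thompson_T_compose thompson_T_inverse)

section \<open>The action on the boundary of the central component\<close>

definition permutes_arcs :: "(complex \<Rightarrow> complex) \<Rightarrow> bool" where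
  "permutes_arcs f \<longleftrightarrow> circle_homeo f \<and> (\<lambda>A. f ` A) ` range central_arc = range central_arc"

lemma stab_C_iff: "f \<in> stab_C \<longleftrightarrow> f \<in> T_B \<and> permutes_arcs f"
proof -
  have "f \<in> T_B \<Longrightarrow> circle_homeo f" by (auto simp: T_B_def has_arc_pair_diagram_def)
  moreover have "border central_gap = range central_arc" using central_arcs_eq by (simp only: central_arcs_def)
  then have "f \<in> stab_C \<longleftrightarrow> f \<in> T_B \<and> (\<lambda>A. f ` A) ` range central_arc = range central_arc"
    by (simp only: stab_C_def maps_gap_def mem_Collect_eq)
  ultimately show ?thesis unfolding permutes_arcs_def by argo
qed

lemma permutes_arcs_arc: "permutes_arcs f \<Longrightarrow> \<exists>e'. f ` central_arc e = central_arc e'"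
proof -
  assume "permutes_arcs f"
  then have "(\<lambda>A. f ` A) ` range central_arc = range central_arc" by (simp add: permutes_arcs_def)
  moreover have "f ` central_arc e \<in> (\<lambda>A. f ` A) ` range central_arc" by (intro imageI rangeI)
  ultimately have "f ` central_arc e \<in> range central_arc" by (simp only:)
  then show ?thesis by (rule imageE) blast
qed

lemma permutes_arcs_arc_surj: "permutes_arcs f \<Longrightarrow> \<exists>e. f ` central_arc e = central_arc e'"
  unfolding permutes_arcs_def by (metis (no_types, lifting) imageE rangeI)

text \<open>The limit set is the closure of the union of the central arcs.\<close>

lemma permutes_arcs_limit_set:
  assumes "permutes_arcs f"
  shows "f ` limit_set = limit_set"
proof
  have f: "circle_homeo f" using assms by (simp add: permutes_arcs_def)
  have c: "continuous_on limit_set f"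
    using circle_homeoD(2)[OF f] limit_set_circle by (rule continuous_on_subset)
  have im: "f ` \<Union>(range central_arc) = \<Union>(range central_arc)"
  proof -
    have "f ` \<Union>(range central_arc) = \<Union>((\<lambda>A. f ` A) ` range central_arc)" by blast
    moreover have "(\<lambda>A. f ` A) ` range central_arc = range central_arc" using assms by (simp add: permutes_arcs_def)
    ultimately show ?thesis by (simp only:)
  qed
  have cl: "closed limit_set" using compact_limit_set by (rule compact_imp_closed)
  have "\<Union>(range central_arc) \<subseteq> limit_set" using central_arc_limit_set by blast
  then show "f ` limit_set \<subseteq> limit_set"
    using image_closure_subset[of "\<Union>(range central_arc)" f limit_set] c cl im
    unfolding limit_set_eq_closure[symmetric] by simp
  have "closed (f ` limit_set)"
    using c compact_limit_set by (intro compact_imp_closed compact_continuous_image)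
  moreover have "\<Union>(range central_arc) \<subseteq> f ` limit_set"
    using im image_mono[OF \<open>\<Union>(range central_arc) \<subseteq> limit_set\<close>, of f] by simp
  ultimately show "limit_set \<subseteq> f ` limit_set"
    using closure_minimal[of "\<Union>(range central_arc)" "f ` limit_set"] limit_set_eq_closure by simp
qed

lemma julia_point_image:
  assumes f: "permutes_arcs f" and x: "x \<in> limit_set"
  shows "julia_point (f x) = f ` julia_point x"
proof (cases "\<exists>e. x \<in> central_arc e")
  case True
  then obtain e where e: "x \<in> central_arc e" by blast
  obtain e' where e': "f ` central_arc e = central_arc e'" using permutes_arcs_arc[OF f] by blast
  then have "f x \<in> central_arc e'" using e by blast
  then show ?thesis using julia_point_central_arc e e' by simp
next
  case False
  have h: "circle_homeo f" using f by (simp add: permutes_arcs_def)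
  have "f x \<notin> central_arc e'" for e'
  proof
    assume "f x \<in> central_arc e'"
    then obtain e y where y: "y \<in> central_arc e" "f x = f y" using permutes_arcs_arc_surj[OF f, of e'] by blast
    then have "x = y"
      using circle_homeoD(3)[OF h] x limit_set_circle central_arc_circle[of e] by (simp add: inj_on_def subset_iff)
    then show False using False y by blast
  qed
  moreover have "f x \<in> limit_set" using permutes_arcs_limit_set[OF f] x by blast
  ultimately show ?thesis using julia_point_singleton x False by auto
qed

lemma label_chart_inj:
  assumes "label_chart h"
  shows "inj_on h boundary_C"
proof (rule inj_onI)
  fix p q assume pq: "p \<in> boundary_C" "q \<in> boundary_C" and eq: "h p = h q"
  obtain x where x: "x \<in> limit_set" "p = julia_point x" using pq(1) unfolding boundary_C_eq by (rule imageE)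
  obtain y where y: "y \<in> limit_set" "q = julia_point y" using pq(2) unfolding boundary_C_eq by (rule imageE)
  note xy = x(1) y(1) x(2) y(2)
  have "collapse x = collapse y"
    using eq label_chart_unique[OF assms xy(1)] label_chart_unique[OF assms xy(2)] xy(3,4) by simp
  then show "p = q" using julia_point_eq[OF xy(1,2)] xy(3,4) by simp
qed

lemma boundary_action_collapse:
  assumes h: "label_chart h" and f: "permutes_arcs f" and x: "x \<in> limit_set"
  shows "boundary_action h f (collapse x) = collapse (f x)"
proof -
  have "julia_point x \<in> boundary_C" using x by (simp add: boundary_C_eq)
  then have "inv_into boundary_C h (h (julia_point x)) = julia_point x"
    by (rule inv_into_f_f[OF label_chart_inj[OF h]])
  then have "inv_into boundary_C h (collapse x) = julia_point x"
    using label_chart_unique[OF h x] by simp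
  then have "boundary_action h f (collapse x) = h (julia_point (f x))"
    using julia_point_image[OF f x] by (simp add: boundary_action_def)
  moreover have "f x \<in> limit_set" using permutes_arcs_limit_set[OF f] x by blast
  ultimately show ?thesis using label_chart_unique[OF h] by simp
qed

lemma boundary_action_bij:
  assumes f: "permutes_arcs f" and g: "\<And>x. x \<in> limit_set \<Longrightarrow> g (collapse x) = collapse (f x)"
  shows "inj_on g circle" "g ` circle = circle"
proof -
  have h: "circle_homeo f" using f by (simp add: permutes_arcs_def)
  show "inj_on g circle"
  proof (rule inj_onI)
    fix d d' assume dd: "d \<in> circle" "d' \<in> circle" "g d = g d'"
    obtain x where x: "x \<in> limit_set" "collapse x = d" using collapse_limit_set_surj[OF dd(1)] by metis
    obtain y where y: "y \<in> limit_set" "collapse y = d'" using collapse_limit_set_surj[OF dd(2)] by metis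
    have "collapse (f x) = collapse (f y)" using g dd x y by metis
    moreover have "f x \<in> limit_set" "f y \<in> limit_set" using permutes_arcs_limit_set[OF f] x y by blast+
    ultimately have "julia_point (f x) = julia_point (f y)" by (intro julia_point_eq)
    then have "f ` julia_point x = f ` julia_point y" using julia_point_image[OF f] x y by simp
    moreover have "julia_point x \<subseteq> circle" "julia_point y \<subseteq> circle" by (auto simp: julia_point_def)
    ultimately have "julia_point x = julia_point y"
      using inj_on_image_eq_iff[OF circle_homeoD(3)[OF h]] by blast
    then show "d = d'"
      using label_map_julia_point[OF subsetD[OF limit_set_circle x(1)]]
        label_map_julia_point[OF subsetD[OF limit_set_circle y(1)]] x(2) y(2) by simp
  qed
  have surj: "collapse ` limit_set = circle"
  proof
    show "circle \<subseteq> collapse ` limit_set"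
    proof
      fix d assume d: "d \<in> circle"
      show "d \<in> collapse ` limit_set" by (rule collapse_limit_set_surj[OF d]) blast
    qed
  qed auto
  have "g ` circle = g ` collapse ` limit_set" by (simp only: surj)
  also have "\<dots> = collapse ` f ` limit_set" unfolding image_image using g by (intro image_cong) auto
  also have "\<dots> = collapse ` limit_set" using permutes_arcs_limit_set[OF f] by simp
  also have "\<dots> = circle" by (rule surj)
  finally show "g ` circle = circle" .
qed

lemma T_B_pieces:
  assumes "f \<in> T_B"
  obtains I \<A> J \<B> where "arc_diagram I \<A>" "arc_diagram J \<B>"
    "\<And>p. p \<in> I \<Longrightarrow> \<exists>q\<in>J. maps_linearly f p q"
proof -
  obtain I \<A> J \<B> \<phi> where d: "has_arc_pair_diagram f I \<A> J \<B> \<phi>" using assms by (auto simp: T_B_def)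
  then have im: "map_prod \<phi> \<phi> ` ends ` I = ends ` J"
    and lin: "\<forall>p\<in>I. \<forall>q\<in>J. map_prod \<phi> \<phi> (ends p) = ends q \<longrightarrow> maps_linearly f p q"
    by (auto simp: has_arc_pair_diagram_def diagram_iso_def)
  have "\<exists>q\<in>J. maps_linearly f p q" if "p \<in> I" for p
  proof -
    have "map_prod \<phi> \<phi> (ends p) \<in> ends ` J" unfolding im[symmetric] using that by blast
    then show ?thesis using lin that by blast
  qed
  then show ?thesis using that d by (auto simp: has_arc_pair_diagram_def)
qed

text \<open>The primary arc of the cell would go to a central arc with an end strictly inside a cap.\<close>

lemma cell_image_not_in_cap:
  assumes f: "permutes_arcs f" and lin: "maps_linearly f (cell w) q"
  shows "\<not> in_cap e q"
proof
  assume q: "in_cap e q"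
  have "maps_linearly f (subinterval (cell w) (gapl []) (gapr [])) (subinterval q (gapl []) (gapr []))"
    by (rule maps_linearly_subinterval[OF lin]) auto
  then have lin': "maps_linearly f (cap (Some w)) (subinterval q (1/4) (3/4))"
    using cap_append[of w "[]"] by simp
  have "f (circ (fst (cap (Some w)))) = circ (fst (subinterval q (1/4) (3/4)))"
    using lin'[unfolded maps_linearly_def, rule_format, of 0] by simp
  moreover have "fst (subinterval q (1/4) (3/4)) \<in> {fst (cap e)<..<snd (cap e)}"
    using q by (auto simp: subinterval_def in_cap_def field_simps)
  ultimately have "f (circ (fst (cap (Some w)))) \<in> open_cap e" by (simp add: open_cap_def)
  moreover obtain e' where "f ` central_arc (Some w) = central_arc e'" using permutes_arcs_arc[OF f] by blast
  then have "f (circ (fst (cap (Some w)))) \<in> central_arc e'" by (auto simp: central_arc_def)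
  ultimately show False using central_arc_open_cap_disjoint by blast
qed

text \<open>The staircase function restricted to a cell depends only on the relative position in the cell, and
every value is attained on the Cantor set.\<close>

lemma maps_linearly_collapse:
  assumes lin: "maps_linearly f (cell w) (cell w')"
    and g: "\<And>x. x \<in> limit_set \<Longrightarrow> g (collapse x) = collapse (f x)"
  shows "maps_linearly g (label_cell w) (label_cell w')"
  unfolding maps_linearly_def label_cell_point
proof
  fix u :: real assume u: "u \<in> {0..1}"
  then obtain s where s: "s \<in> cantor" "stair s = u" using cantor_surj[of u] by auto
  have s01: "0 \<le> s" "s \<le> 1" using cantor_bounds s by auto
  let ?x = "circ (tau (cantor_val w + s / 4 ^ length w))"
  have "?x \<in> limit_set" using cantor_cell[OF s(1)] by (auto simp: limit_set_def)
  then have "g (collapse ?x) = collapse (f ?x)" by (rule g)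
  moreover have "f ?x = circ (tau (cantor_val w' + s / 4 ^ length w'))"
    using lin s01 by (simp add: maps_linearly_def cell_point)
  ultimately show "g (circ (bin_val w + u / 2 ^ length w)) = circ (bin_val w' + u / 2 ^ length w')"
    using collapse_cell[OF s01] s(2) by simp
qed

lemma halved_cover: "halved S E \<Longrightarrow> (\<Union>p\<in>label_cell ` S. circ ` {fst p..snd p}) = circle"
  using halved_dyadic_subdivision by (simp add: dyadic_subdivision_def case_prod_beta)

theorem stab_C_thompson_T:
  assumes h: "label_chart h" and f: "f \<in> stab_C"
  shows "boundary_action h f \<in> thompson_T"
proof -
  let ?g = "boundary_action h f"
  have p: "permutes_arcs f" and TB: "f \<in> T_B" using f by (auto simp: stab_C_iff)
  note g = boundary_action_collapse[OF h p]
  obtain I \<A> J \<B> where D: "arc_diagram I \<A>" "arc_diagram J \<B>"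
    and lin: "\<And>p. p \<in> I \<Longrightarrow> \<exists>q\<in>J. maps_linearly f p q" using T_B_pieces[OF TB] by metis
  obtain S E N where S: "halved S E" "I = cell ` S \<union> N"
    by (rule arc_diagram_structure[OF D(1)]) blast
  obtain S' E' N' where S': "halved S' E'" "J = cell ` S' \<union> N'" and N': "\<And>p. p \<in> N' \<Longrightarrow> \<exists>e. in_cap e p"
    by (rule arc_diagram_structure[OF D(2)]) blast
  have pieces: "\<exists>w'\<in>S'. maps_linearly ?g (label_cell w) (label_cell w')" if "w \<in> S" for w
  proof -
    have "cell w \<in> I" using S(2) that by blast
    then obtain q where q: "q \<in> J" "maps_linearly f (cell w) q" using lin by blast
    have "q \<notin> N'" using N'[of q] cell_image_not_in_cap[OF p q(2)] by blast
    then obtain w' where "w' \<in> S'" "q = cell w'" using q(1) S'(2) by blast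
    then have "maps_linearly f (cell w) (cell w')" using q(2) by simp
    then have "maps_linearly ?g (label_cell w) (label_cell w')" by (rule maps_linearly_collapse) (rule g)
    then show ?thesis using \<open>w' \<in> S'\<close> by blast
  qed
  have "circle_homeo ?g"
  proof (rule circle_homeoI)
    show "?g \<in> extensional circle" by (simp add: boundary_action_def)
    show "inj_on ?g circle" by (rule boundary_action_bij(1)[OF p]) (rule g)
    show "?g ` circle = circle" by (rule boundary_action_bij(2)[OF p]) (rule g)
    show "continuous_on circle ?g"
    proof (rule piecewise_linear_continuous[OF _ halved_cover[OF S(1)]])
      show "finite (label_cell ` S)" using halved_partition(1)[OF S(1)] by simp
      show "fst p < snd p" if "p \<in> label_cell ` S" for p using that label_cell_less by blast
      show "\<exists>q. maps_linearly ?g p q" if "p \<in> label_cell ` S" for p using that pieces by blast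
    qed
  qed
  then show ?thesis using thompson_TI[OF _ S(1) S'(1)] pieces by blast
qed

section \<open>Lifting elements of Thompson's group\<close>

text \<open>The second condition says that all caps are images of caps, so that inverses have the same property.\<close>

definition cap_linear :: "(complex \<Rightarrow> complex) \<Rightarrow> bool" where
  "cap_linear f \<longleftrightarrow> (\<forall>e. \<exists>e'. maps_linearly f (cap e) (cap e')) \<and> (\<forall>e'. \<exists>e. maps_linearly f (cap e) (cap e'))"

definition lifts :: "(complex \<Rightarrow> complex) \<Rightarrow> (complex \<Rightarrow> complex) \<Rightarrow> bool" where
  "lifts f g \<longleftrightarrow> circle_homeo f \<and> cap_linear f \<and> (\<forall>x\<in>circle. collapse (f x) = g (collapse x))"

lemma maps_linearly_ends:
  assumes "maps_linearly f p q"
  shows "f (circ (fst p)) = circ (fst q)" "f (circ (snd p)) = circ (snd q)"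
  using assms[unfolded maps_linearly_def, rule_format, of 0] assms[unfolded maps_linearly_def, rule_format, of 1]
  by simp_all

lemma maps_linearly_closed_cap:
  assumes "maps_linearly f (cap e) (cap e')"
  shows "f ` closed_cap e = closed_cap e'"
  unfolding closed_cap_def by (rule maps_linearly_image(1)[OF assms cap_nonempty cap_nonempty])

lemma cap_linear_permutes_arcs:
  assumes "circle_homeo f" "cap_linear f"
  shows "permutes_arcs f"
proof -
  have img: "f ` central_arc e = central_arc e'" if "maps_linearly f (cap e) (cap e')" for e e'
    using maps_linearly_ends[OF that] by (simp add: central_arc_def)
  have "(\<lambda>A. f ` A) ` range central_arc \<subseteq> range central_arc"
  proof (intro subsetI, elim imageE)
    fix B A e assume "B = f ` A" "A = central_arc e"
    moreover obtain e' where "maps_linearly f (cap e) (cap e')" using assms(2) by (auto simp: cap_linear_def)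
    ultimately show "B \<in> range central_arc" using img by simp
  qed
  moreover have "range central_arc \<subseteq> (\<lambda>A. f ` A) ` range central_arc"
  proof (intro subsetI, elim imageE)
    fix B e' assume "B = central_arc e'"
    moreover obtain e where "maps_linearly f (cap e) (cap e')" using assms(2) by (auto simp: cap_linear_def)
    ultimately have "B = f ` central_arc e" using img by simp
    then show "B \<in> (\<lambda>A. f ` A) ` range central_arc" by (intro image_eqI[of _ _ "central_arc e"]) auto
  qed
  ultimately show ?thesis unfolding permutes_arcs_def using assms(1) by (intro conjI subset_antisym)
qed

lemma lifts_permutes_arcs: "lifts f g \<Longrightarrow> permutes_arcs f"
  unfolding lifts_def using cap_linear_permutes_arcs by simp

text \<open>On a cap both maps are linear, onto the same cap because its label is prescribed.  A point off the caps
goes off the caps, where \<open>collapse\<close> is injective.\<close>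

lemma lifts_unique:
  assumes f: "lifts f g" and f': "lifts f' g"
  shows "f = f'"
proof (rule extensionalityI)
  have h: "circle_homeo f" "circle_homeo f'" and l: "cap_linear f" "cap_linear f'"
    and c: "\<And>x. x \<in> circle \<Longrightarrow> collapse (f x) = g (collapse x)" "\<And>x. x \<in> circle \<Longrightarrow> collapse (f' x) = g (collapse x)"
    using f f' by (auto simp: lifts_def)
  show "f \<in> extensional circle" "f' \<in> extensional circle" using h circle_homeoD(1) by auto
  fix x assume x: "x \<in> circle"
  show "f x = f' x"
  proof (cases "\<exists>e. x \<in> closed_cap e")
    case True
    then obtain e where e: "x \<in> closed_cap e" by blast
    then obtain t where t: "fst (cap e) \<le> t" "t \<le> snd (cap e)" "x = circ t" by (auto simp: closed_cap_def)
    obtain e1 where e1: "maps_linearly f (cap e) (cap e1)" using l(1) by (auto simp: cap_linear_def)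
    obtain e2 where e2: "maps_linearly f' (cap e) (cap e2)" using l(2) by (auto simp: cap_linear_def)
    have "f x \<in> closed_cap e1" "f' x \<in> closed_cap e2"
      using maps_linearly_closed_cap[OF e1] maps_linearly_closed_cap[OF e2] e by blast+
    moreover have "f x \<in> circle" "f' x \<in> circle" using circle_homeoD(4)[OF h(1)] circle_homeoD(4)[OF h(2)] x by blast+
    ultimately have "circ (lab e1) = circ (lab e2)"
      using closed_cap_iff[of "f x" e1] closed_cap_iff[of "f' x" e2] c[OF x] by simp
    then have "e1 = e2" by (rule lab_inj)
    then show ?thesis
      using maps_linearly_circ[OF e1 cap_nonempty t(1,2)] maps_linearly_circ[OF e2 cap_nonempty t(1,2)] t(3) by simp
  next
    case False
    have "f x \<notin> closed_cap e'" for e'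
    proof
      assume fx: "f x \<in> closed_cap e'"
      obtain e where e: "maps_linearly f (cap e) (cap e')" using l(1) by (auto simp: cap_linear_def)
      then obtain y where y: "y \<in> closed_cap e" "f x = f y" using maps_linearly_closed_cap[OF e] fx by blast
      then have "x = y" using circle_homeoD(3)[OF h(1)] x closed_cap_circle[of e] by (simp add: inj_on_def subset_iff)
      then show False using False y by blast
    qed
    moreover have "f x \<in> circle" "f' x \<in> circle" using circle_homeoD(4)[OF h(1)] circle_homeoD(4)[OF h(2)] x by blast+
    ultimately show ?thesis using collapse_fibre[of "f x" "f' x"] c x by metis
  qed
qed

lemma lifts_compose:
  assumes f: "lifts f g" and f': "lifts f' g'"
  shows "lifts (compose circle f' f) (compose circle g' g)"
proof -
  have h: "circle_homeo f" "circle_homeo f'" and l: "cap_linear f" "cap_linear f'"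
    and c: "\<And>x. x \<in> circle \<Longrightarrow> collapse (f x) = g (collapse x)" "\<And>x. x \<in> circle \<Longrightarrow> collapse (f' x) = g' (collapse x)"
    using f f' by (auto simp: lifts_def)
  have "cap_linear (compose circle f' f)"
    using l maps_linearly_compose unfolding cap_linear_def by meson
  moreover have "collapse (compose circle f' f x) = compose circle g' g (collapse x)" if x: "x \<in> circle" for x
  proof -
    have "f x \<in> circle" using circle_homeoD(4)[OF h(1)] x by blast
    then show ?thesis using c x by (simp add: compose_def)
  qed
  ultimately show ?thesis using circle_homeo_compose[OF h] by (simp add: lifts_def)
qed

lemma lifts_inverse:
  assumes f: "lifts f g" and g: "inj_on g circle"
  shows "lifts (\<lambda>x\<in>circle. inv_into circle f x) (\<lambda>x\<in>circle. inv_into circle g x)"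
proof -
  have h: "circle_homeo f" and l: "cap_linear f" and c: "\<And>x. x \<in> circle \<Longrightarrow> collapse (f x) = g (collapse x)"
    using f by (auto simp: lifts_def)
  have "cap_linear (\<lambda>x\<in>circle. inv_into circle f x)"
    using l maps_linearly_inverse[OF h] unfolding cap_linear_def by meson
  moreover have "collapse (inv_into circle f y) = inv_into circle g (collapse y)" if y: "y \<in> circle" for y
  proof -
    obtain x where x: "x \<in> circle" "y = f x" using circle_homeoD(4)[OF h] y by blast
    have "collapse x \<in> circle" by simp
    then show ?thesis unfolding x(2) c[OF x(1)]
      using inv_into_f_f[OF circle_homeoD(3)[OF h] x(1)] inv_into_f_f[OF g] by simp
  qed
  ultimately show ?thesis using circle_homeo_inverse[OF h] by (simp add: lifts_def)
qed

lemma lifts_id: "lifts (\<lambda>x\<in>circle. x) (\<lambda>x\<in>circle. x)"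
proof -
  have "cap_linear (\<lambda>x\<in>circle. x)" unfolding cap_linear_def using maps_linearly_id by blast
  then show ?thesis using circle_homeo_id by (simp add: lifts_def)
qed

section \<open>Elements of the rigid stabilizer\<close>

text \<open>A central arc that is not in the diagram lies below one of its cells.\<close>

lemma halved_cap_cases: "halved S E \<Longrightarrow> e \<in> E \<or> (\<exists>w\<in>S. \<exists>s. e = Some (w @ s))"
proof (induction rule: halved.induct)
  case root
  show ?case by (cases e) auto
next
  case (split S E v)
  show ?case
  proof (cases "\<exists>s. e = Some (v @ s)")
    case True
    then obtain s where s: "e = Some (v @ s)" by blast
    show ?thesis
    proof (cases s)
      case (Cons b s')
      then have "e = Some ((v @ [b]) @ s')" using s by simp
      moreover have "v @ [b] \<in> S - {v} \<union> {v @ [False], v @ [True]}" by (cases b) auto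
      ultimately show ?thesis by blast
    qed (use s in auto)
  qed (use split.IH in blast)
qed

lemma halved_vertices: "halved S E \<Longrightarrow> w \<in> S \<Longrightarrow> {circ (fst (cell w)), circ (snd (cell w))} \<subseteq> \<Union>(central_arc ` E)"
proof (induction arbitrary: w rule: halved.induct)
  case root
  then show ?case by (auto simp: central_arc_None cell_def tau_values)
next
  case (split S E v)
  have v: "{circ (fst (cell v)), circ (snd (cell v))} \<subseteq> \<Union>(central_arc ` E)" using split.IH split.hyps by blast
  have "fst (cell (v @ [False])) = fst (cell v)" "snd (cell (v @ [False])) = fst (cap (Some v))"
    "fst (cell (v @ [True])) = snd (cap (Some v))" "snd (cell (v @ [True])) = snd (cell v)"
    unfolding cell_children by simp_all
  moreover have "circ (fst (cap (Some v))) \<in> central_arc (Some v)" "circ (snd (cap (Some v))) \<in> central_arc (Some v)"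
    by (simp_all add: central_arc_def)
  moreover have "w \<in> S \<or> w = v @ [False] \<or> w = v @ [True]" using split.prems by blast
  ultimately show ?case using split.IH[of w] v
    by (elim disjE) (simp_all only: image_insert Union_insert insert_subset empty_subsetI, blast+)
qed

text \<open>\<open>collapse\<close> separates the two ends of a cell, except for the cell of the empty word, and identifies the
two ends of an arc.\<close>

lemma cell_ends_not_arc:
  assumes "w \<noteq> []" "{circ (fst (cell w)), circ (snd (cell w))} = central_arc e"
  shows False
proof -
  have "circ (fst (cell w)) \<in> central_arc e" "circ (snd (cell w)) \<in> central_arc e" using assms(2) by blast+
  then have "collapse (circ (fst (cell w))) = collapse (circ (snd (cell w)))"
    using collapse_central_arc by simp
  moreover have "collapse (circ (fst (cell w))) = circ (bin_val w)"
    using collapse_cell[of 0 w] by (simp add: cell_def stair_le_0)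
  moreover have "collapse (circ (snd (cell w))) = circ (bin_val w + 1 / 2 ^ length w)"
    using collapse_cell[of 1 w] by (simp add: cell_def stair_ge_1)
  ultimately have "circ (bin_val w) = circ (bin_val w + 1 / 2 ^ length w)" by simp
  moreover have "1 / 2 ^ length w < (1::real)"
    using assms(1) one_less_power[of "2::real" "length w"] by simp
  ultimately show False using circ_neq(1)[of "bin_val w" "bin_val w + 1 / 2 ^ length w"] by simp
qed

lemma central_diagram_structure:
  assumes "arc_diagram I \<A>" "\<A> \<subseteq> central_arcs"
  obtains S E where "halved S E" "[] \<notin> S" "I = cell ` S \<union> cap ` E" "\<A> = central_arc ` E"
proof (rule arc_diagram_structure[OF assms(1)])
  fix S E N M
  assume h: "halved S E" "[] \<notin> S" "I = cell ` S \<union> N" "\<A> = central_arc ` E \<union> M"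
    and M: "\<And>A. A \<in> M \<Longrightarrow> A \<noteq> {} \<and> (\<exists>e. A \<subseteq> open_cap e)" and MN: "M = {} \<Longrightarrow> N = cap ` E"
  have "M = {}"
  proof (rule ccontr)
    assume "M \<noteq> {}"
    then obtain A where "A \<in> M" by blast
    then obtain x e where x: "x \<in> A" "x \<in> open_cap e" using M[of A] by blast
    have "A \<in> range central_arc" using \<open>A \<in> M\<close> h(4) assms(2) unfolding central_arcs_eq by blast
    then obtain e' where "x \<in> central_arc e'" using x(1) by blast
    then show False using central_arc_open_cap_disjoint x(2) by blast
  qed
  then show thesis using that[OF h(1,2)] h(3,4) MN by simp
qed

text \<open>An isomorphism of diagrams maps arcs to arcs, so by \<open>cell_ends_not_arc\<close> it takes cells to cells and
caps to caps.\<close>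

lemma rist_C_pieces:
  assumes "f \<in> rist_C"
  obtains S E S' E' where "halved S E" "halved S' E'"
    "\<And>w. w \<in> S \<Longrightarrow> \<exists>w'\<in>S'. maps_linearly f (cell w) (cell w')"
    "\<And>e. e \<in> E \<Longrightarrow> \<exists>e'\<in>E'. maps_linearly f (cap e) (cap e')"
    "\<And>w'. w' \<in> S' \<Longrightarrow> \<exists>w\<in>S. maps_linearly f (cell w) (cell w')"
    "\<And>e'. e' \<in> E' \<Longrightarrow> \<exists>e\<in>E. maps_linearly f (cap e) (cap e')"
    "circle_homeo f" "f \<in> T_B"
proof -
  obtain I \<A> J \<B> \<phi> where d: "has_arc_pair_diagram f I \<A> J \<B> \<phi>" "\<A> \<subseteq> central_arcs" "\<B> \<subseteq> central_arcs"
    using assms by (auto simp: rist_C_def)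
  have D: "arc_diagram I \<A>" "arc_diagram J \<B>" and f: "circle_homeo f" "f \<in> T_B"
    and bij: "inj_on \<phi> (\<Union>\<A>)" and im: "map_prod \<phi> \<phi> ` ends ` I = ends ` J" and imA: "(\<lambda>A. \<phi> ` A) ` \<A> = \<B>"
    and lin: "\<And>p q. p \<in> I \<Longrightarrow> q \<in> J \<Longrightarrow> map_prod \<phi> \<phi> (ends p) = ends q \<Longrightarrow> maps_linearly f p q"
  proof -
    show "f \<in> T_B" using d(1) unfolding T_B_def by blast
  qed (use d in \<open>auto simp: has_arc_pair_diagram_def diagram_iso_def bij_betw_def\<close>)
  obtain S E where S: "halved S E" "[] \<notin> S" and I: "I = cell ` S \<union> cap ` E" and A: "\<A> = central_arc ` E"
    by (rule central_diagram_structure[OF D(1) d(2)])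
  obtain S' E' where S': "halved S' E'" "[] \<notin> S'" and J: "J = cell ` S' \<union> cap ` E'" and B: "\<B> = central_arc ` E'"
    by (rule central_diagram_structure[OF D(2) d(3)])
  define verts where "verts r = {circ (fst r), circ (snd r)}" for r
  have verts: "\<phi> ` verts p = verts q" if "map_prod \<phi> \<phi> (ends p) = ends q" for p q
    using that by (auto simp: verts_def ends_def map_prod_def case_prod_beta prod_eq_iff)
  have vcap: "verts (cap e) = central_arc e" for e by (simp add: verts_def central_arc_def)
  have no_cell_cap: False if "w \<in> S" "e' \<in> E'" "map_prod \<phi> \<phi> (ends (cell w)) = ends (cap e')" for w e'
  proof -
    have "central_arc e' \<in> (\<lambda>A. \<phi> ` A) ` \<A>" using that(2) unfolding imA B by blast
    then obtain e where e: "e \<in> E" "central_arc e' = \<phi> ` central_arc e" unfolding A by blast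
    have "\<phi> ` verts (cell w) = \<phi> ` central_arc e" using verts[OF that(3)] vcap e(2) by simp
    moreover have "verts (cell w) \<subseteq> \<Union>\<A>" unfolding verts_def A by (rule halved_vertices[OF S(1) that(1)])
    moreover have "central_arc e \<subseteq> \<Union>\<A>" using e(1) unfolding A by blast
    ultimately have "verts (cell w) = central_arc e" using inj_on_image_eq_iff[OF bij] by blast
    then show False using cell_ends_not_arc[of w e] that(1) S(2) unfolding verts_def by metis
  qed
  have no_cap_cell: False if "e \<in> E" "w' \<in> S'" "map_prod \<phi> \<phi> (ends (cap e)) = ends (cell w')" for e w'
  proof -
    have "\<phi> ` central_arc e = verts (cell w')" using verts[OF that(3)] vcap by simp
    moreover have "\<phi> ` central_arc e \<in> central_arc ` E'" using that(1) imA unfolding A B by blast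
    ultimately obtain e' where "verts (cell w') = central_arc e'" by auto
    then show False using cell_ends_not_arc[of w' e'] that(2) S'(2) unfolding verts_def by metis
  qed
  have fw: "\<exists>q\<in>J. map_prod \<phi> \<phi> (ends p) = ends q" if "p \<in> I" for p
  proof -
    have "map_prod \<phi> \<phi> (ends p) \<in> ends ` J" unfolding im[symmetric] using that by blast
    then show ?thesis by blast
  qed
  have bw: "\<exists>p\<in>I. map_prod \<phi> \<phi> (ends p) = ends q" if "q \<in> J" for q
  proof -
    have "ends q \<in> map_prod \<phi> \<phi> ` ends ` I" unfolding im using that by blast
    then show ?thesis by (elim imageE) metis
  qed
  show ?thesis
  proof (rule that[OF S(1) S'(1) _ _ _ _ f])
    fix w assume w: "w \<in> S"
    then obtain q where q: "q \<in> J" "map_prod \<phi> \<phi> (ends (cell w)) = ends q" using fw[of "cell w"] I by blast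
    then obtain w' where "w' \<in> S'" "q = cell w'" using no_cell_cap[OF w] J by blast
    then show "\<exists>w'\<in>S'. maps_linearly f (cell w) (cell w')" using lin[of "cell w" q] q w I by blast
  next
    fix e assume e: "e \<in> E"
    then obtain q where q: "q \<in> J" "map_prod \<phi> \<phi> (ends (cap e)) = ends q" using fw[of "cap e"] I by blast
    then obtain e' where "e' \<in> E'" "q = cap e'" using no_cap_cell[OF e] J by blast
    then show "\<exists>e'\<in>E'. maps_linearly f (cap e) (cap e')" using lin[of "cap e" q] q e I by blast
  next
    fix w' assume w': "w' \<in> S'"
    then obtain p where p: "p \<in> I" "map_prod \<phi> \<phi> (ends p) = ends (cell w')" using bw[of "cell w'"] J by blast
    then obtain w where "w \<in> S" "p = cell w" using no_cap_cell[OF _ w'] I by blast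
    then show "\<exists>w\<in>S. maps_linearly f (cell w) (cell w')" using lin[of p "cell w'"] p w' J by blast
  next
    fix e' assume e': "e' \<in> E'"
    then obtain p where p: "p \<in> I" "map_prod \<phi> \<phi> (ends p) = ends (cap e')" using bw[of "cap e'"] J by blast
    then obtain e where "e \<in> E" "p = cap e" using no_cell_cap[OF _ e'] I by blast
    then show "\<exists>e\<in>E. maps_linearly f (cap e) (cap e')" using lin[of p "cap e'"] p e' J by blast
  qed
qed

lemma rist_C_cap_linear:
  assumes "f \<in> rist_C"
  shows "circle_homeo f" "cap_linear f" "f \<in> T_B"
proof -
  obtain S E S' E' where S: "halved S E" "halved S' E'"
    and c: "\<And>w. w \<in> S \<Longrightarrow> \<exists>w'\<in>S'. maps_linearly f (cell w) (cell w')"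
    and e: "\<And>e. e \<in> E \<Longrightarrow> \<exists>e'\<in>E'. maps_linearly f (cap e) (cap e')"
    and c': "\<And>w'. w' \<in> S' \<Longrightarrow> \<exists>w\<in>S. maps_linearly f (cell w) (cell w')"
    and e': "\<And>e'. e' \<in> E' \<Longrightarrow> \<exists>e\<in>E. maps_linearly f (cap e) (cap e')"
    and f: "circle_homeo f" "f \<in> T_B"
    using assms by (rule rist_C_pieces) (rule that)
  show "circle_homeo f" "f \<in> T_B" by (fact f)+
  have "\<exists>a'. maps_linearly f (cap a) (cap a')" for a
    using halved_cap_cases[OF S(1), of a] e[of a] c maps_linearly_cap by blast
  moreover have "\<exists>a. maps_linearly f (cap a) (cap a')" for a'
    using halved_cap_cases[OF S(2), of a'] e'[of a'] c' maps_linearly_cap by blast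
  ultimately show "cap_linear f" by (simp add: cap_linear_def)
qed

text \<open>The relation with \<open>g\<close> extends from the limit set to the caps, because \<open>collapse\<close> is constant on each cap.\<close>

lemma cap_linear_lifts:
  assumes f: "circle_homeo f" "cap_linear f"
    and g: "\<And>x. x \<in> limit_set \<Longrightarrow> g (collapse x) = collapse (f x)"
  shows "lifts f g"
proof -
  have "collapse (f x) = g (collapse x)" if x: "x \<in> circle" for x
  proof (cases "x \<in> limit_set")
    case False
    then obtain e where "x \<in> open_cap e" using limit_set_iff[OF x] by blast
    then have xe: "x \<in> closed_cap e" using open_cap_subset by blast
    obtain e' where e': "maps_linearly f (cap e) (cap e')" using f(2) by (auto simp: cap_linear_def)
    define y where "y = circ (fst (cap e))"
    have y: "y \<in> central_arc e" by (simp add: y_def central_arc_def)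
    then have ye: "y \<in> closed_cap e" using central_arc_subset_closed_cap by blast
    have fim: "z \<in> closed_cap e \<Longrightarrow> collapse (f z) = circ (lab e')" for z
      using maps_linearly_closed_cap[OF e'] closed_cap_circle[of e'] closed_cap_iff[of "f z" e'] by blast
    have "y \<in> circle" by (simp add: y_def)
    then have "collapse x = collapse y"
      using xe ye closed_cap_iff[OF x, of e] closed_cap_iff[of y e] by simp
    then have "g (collapse x) = collapse (f y)" using g[of y] y central_arc_limit_set by auto
    then show ?thesis using fim[OF xe] fim[OF ye] by simp
  qed (use g in simp)
  then show ?thesis using f by (simp add: lifts_def)
qed

lemma rist_C_lifts:
  assumes "label_chart h" "f \<in> rist_C"
  shows "lifts f (boundary_action h f)" "boundary_action h f \<in> thompson_T" "f \<in> stab_C"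
proof -
  note f = rist_C_cap_linear[OF assms(2)]
  have p: "permutes_arcs f" by (rule cap_linear_permutes_arcs[OF f(1,2)])
  show "f \<in> stab_C" using p f(3) by (simp add: stab_C_iff)
  then show "boundary_action h f \<in> thompson_T" by (rule stab_C_thompson_T[OF assms(1)])
  show "lifts f (boundary_action h f)"
    by (rule cap_linear_lifts[OF f(1,2)]) (rule boundary_action_collapse[OF assms(1) p])
qed

section \<open>Ends of cells and caps\<close>

lemma bin_mid_in_label_cell:
  "bin_val w < bin_mid v \<Longrightarrow> bin_mid v < bin_val w + 1 / 2 ^ length w \<Longrightarrow> prefix w v"
proof (induction w arbitrary: v)
  case (Cons b w)
  show ?case
  proof (cases v)
    case Nil
    then have "of_bool b + bin_val w < 1" "1 < of_bool b + (bin_val w + 1 / 2 ^ length w)"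
      using Cons.prems by (auto simp: field_simps)
    then show ?thesis using bin_val_ge_0[of w] bin_val_le_1[of w] by (cases b) auto
  next
    case v: (Cons c u)
    have *: "of_bool b + bin_val w < of_bool c + bin_mid u" "of_bool c + bin_mid u < of_bool b + (bin_val w + 1 / 2 ^ length w)"
      using Cons.prems v by (auto simp: field_simps)
    then have bc: "b = c"
      using bin_mid_bounds[of u] bin_val_ge_0[of w] bin_val_le_1[of w] by (cases b; cases c; simp)
    then show ?thesis using Cons.IH[of u] * v by simp
  qed
qed simp

lemma cell_end_gap_start: "cantor_val w + 1 / 4 ^ length w = 1 \<or> (\<exists>v. cantor_val w + 1 / 4 ^ length w = gapl v)"
proof (induction w)
  case (Cons b w)
  have eq: "cantor_val (b # w) + 1 / 4 ^ length (b # w) = (3 * of_bool b + (cantor_val w + 1 / 4 ^ length w)) / 4"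
    by (simp add: field_simps)
  show ?case
  proof (cases "cantor_val w + 1 / 4 ^ length w = 1")
    case True
    then show ?thesis unfolding eq by (cases b) (auto intro: exI[of _ "[]"])
  next
    case False
    then obtain v where "cantor_val w + 1 / 4 ^ length w = gapl v" using Cons by blast
    then show ?thesis unfolding eq by (intro disjI2 exI[of _ "b # v"]) simp
  qed
qed simp

text \<open>A cell starts where a cap ends, and the cap is determined by its label.\<close>

lemma cell_first_end:
  assumes "circ (lab e) = circ (bin_val w)"
  shows "circ (tau (cantor_val w)) = circ (snd (cap e))"
proof -
  have "\<exists>e'. tau (cantor_val w) = snd (cap e')"
    using cell_start_gap_end[of w] tau_values(1) by (metis cap.simps snd_conv)
  then obtain e' where e': "tau (cantor_val w) = snd (cap e')" by blast
  have "circ (lab e') = collapse (circ (tau (cantor_val w)))"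
    unfolding e' using collapse_cap[of e' "snd (cap e')"] cap_nonempty[of e'] by simp
  also have "\<dots> = circ (bin_val w)" using collapse_cell[of 0 w] by (simp add: stair_le_0)
  finally have "e' = e" using assms by (intro lab_inj) simp
  then show ?thesis using e' by simp
qed

lemma cell_last_end:
  assumes "circ (lab e) = circ (bin_val w + 1 / 2 ^ length w)"
  shows "circ (tau (cantor_val w + 1 / 4 ^ length w)) = circ (fst (cap e))"
proof -
  have "\<exists>e'. circ (tau (cantor_val w + 1 / 4 ^ length w)) = circ (fst (cap e'))"
    using cell_end_gap_start[of w]
  proof
    assume "cantor_val w + 1 / 4 ^ length w = 1"
    then have "circ (tau (cantor_val w + 1 / 4 ^ length w)) = circ (fst (cap None))"
      using circ_tau_one by (simp add: tau_values)
    then show ?thesis by blast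
  next
    assume "\<exists>v. cantor_val w + 1 / 4 ^ length w = gapl v"
    then obtain v where "cantor_val w + 1 / 4 ^ length w = gapl v" by blast
    then show ?thesis by (intro exI[of _ "Some v"]) simp
  qed
  then obtain e' where e': "circ (tau (cantor_val w + 1 / 4 ^ length w)) = circ (fst (cap e'))" by blast
  have "circ (lab e') = collapse (circ (tau (cantor_val w + 1 / 4 ^ length w)))"
    unfolding e' using collapse_cap[of e' "fst (cap e')"] cap_nonempty[of e'] by simp
  also have "\<dots> = circ (bin_val w + 1 / 2 ^ length w)" using collapse_cell[of 1 w] by (simp add: stair_ge_1)
  finally have "e' = e" using assms by (intro lab_inj) simp
  then show ?thesis using e' by simp
qed

text \<open>The label of the cap lies strictly inside the dyadic interval of \<open>w\<close>, so the cap belongs to an arc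
below \<open>w\<close>.\<close>

lemma cell_meets_cap:
  assumes s: "0 < s" "s < 1" and x: "circ (tau (cantor_val w + s / 4 ^ length w)) \<in> closed_cap e"
  obtains v where "e = Some (w @ v)" "gapl v \<le> s" "s \<le> gapr v"
proof -
  let ?u = "cantor_val w + s / 4 ^ length w"
  have st: "0 < stair s" "stair s < 1" using stair_pos stair_less_1 s by auto
  have "circ (lab e) = collapse (circ (tau ?u))" using x closed_cap_iff[of "circ (tau ?u)" e] by simp
  also have "\<dots> = circ (bin_val w + stair s / 2 ^ length w)" using s by (intro collapse_cell) auto
  finally have eq: "circ (lab e) = circ (bin_val w + stair s / 2 ^ length w)" .
  have b: "bin_val w < bin_val w + stair s / 2 ^ length w" "bin_val w + stair s / 2 ^ length w < bin_val w + 1 / 2 ^ length w"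
    using st by (simp_all add: divide_strict_right_mono)
  have "\<bar>lab e - (bin_val w + stair s / 2 ^ length w)\<bar> < 1"
    using b bin_val_ge_0[of w] bin_val_le_1[of w] lab_bounds[of e] by linarith
  then have lab: "lab e = bin_val w + stair s / 2 ^ length w" using eq circ_eq_near by blast
  obtain u where u: "e = Some u" using lab b bin_val_ge_0[of w] by (cases e) auto
  have "prefix w u" using lab b u by (intro bin_mid_in_label_cell) auto
  then obtain v where v: "u = w @ v" by (auto simp: prefix_def)
  have "stair s = bin_mid v" using lab unfolding u v by (simp add: bin_mid_append)
  then show ?thesis using that[of v] u v by (simp add: stair_eq_bin_mid_iff)
qed

text \<open>A cap either belongs to the diagram or lies in one of its cells.  A point off the caps is determined by
its image under \<open>collapse\<close>, and the dyadic intervals of the leaves cover the circle.\<close>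

lemma halved_cells_caps_cover:
  assumes "halved S E"
  shows "(\<Union>p\<in>cell ` S \<union> cap ` E. circ ` {fst p..snd p}) = circle"
proof
  show "(\<Union>p\<in>cell ` S \<union> cap ` E. circ ` {fst p..snd p}) \<subseteq> circle" by auto
  show "circle \<subseteq> (\<Union>p\<in>cell ` S \<union> cap ` E. circ ` {fst p..snd p})"
  proof
    fix x assume x: "x \<in> circle"
    show "x \<in> (\<Union>p\<in>cell ` S \<union> cap ` E. circ ` {fst p..snd p})"
    proof (cases "\<exists>e. x \<in> closed_cap e")
      case True
      then obtain e where e: "x \<in> closed_cap e" by blast
      from halved_cap_cases[OF assms, of e] show ?thesis
      proof
        assume "e \<in> E"
        then show ?thesis using e unfolding closed_cap_def by blast
      next
        assume "\<exists>w\<in>S. \<exists>s. e = Some (w @ s)"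
        then obtain w s where w: "w \<in> S" "e = Some (w @ s)" by blast
        have "fst (cell w) \<le> fst (cap e)" "snd (cap e) \<le> snd (cell w)"
        proof -
          have "gapl s * (snd (cell w) - fst (cell w)) \<ge> 0"
            using gapl_pos[of s] cell_less[of w] by (intro mult_nonneg_nonneg) auto
          moreover have "gapr s * (snd (cell w) - fst (cell w)) \<le> 1 * (snd (cell w) - fst (cell w))"
            using gapr_less_1[of s] cell_less[of w] by (intro mult_right_mono) auto
          ultimately show "fst (cell w) \<le> fst (cap e)" "snd (cap e) \<le> snd (cell w)"
            unfolding w(2) cap_append subinterval_def by simp_all
        qed
        then have "closed_cap e \<subseteq> circ ` {fst (cell w)..snd (cell w)}"
          unfolding closed_cap_def by (intro image_mono) auto
        then show ?thesis using e w(1) by blast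
      qed
    next
      case False
      obtain w u where w: "w \<in> S" "0 \<le> u" "u \<le> 1" "collapse x = circ (bin_val w + u / 2 ^ length w)"
        by (rule halved_label_cover[OF assms, of "collapse x"]) simp_all
      obtain s where s: "s \<in> cantor" "stair s = u" using cantor_surj[OF w(2,3)] by metis
      have s01: "0 \<le> s" "s \<le> 1" using cantor_bounds s by auto
      let ?y = "circ (tau (cantor_val w + s / 4 ^ length w))"
      have "collapse x = collapse ?y" using collapse_cell[OF s01, of w] s w by simp
      then have "x = ?y" using collapse_fibre[OF x, of ?y] False by fastforce
      moreover have "tau (cantor_val w + s / 4 ^ length w) \<in> {fst (cell w)..snd (cell w)}"
        using s01 by (simp add: cell_def divide_right_mono)
      ultimately show ?thesis using w(1) by blast
    qed
  qed
qed

section \<open>Construction of the lift\<close>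

text \<open>A bijection \<open>g\<close> of the circle that permutes the dyadic labels; \<open>\<gamma>\<close> is the induced permutation of the
central arcs.\<close>

locale label_permutation =
  fixes g :: "complex \<Rightarrow> complex" and \<gamma> :: "node option \<Rightarrow> node option"
  assumes inj_g: "inj_on g circle" and surj_g: "g ` circle = circle"
    and g_lab: "\<And>e. g (circ (lab e)) = circ (lab (\<gamma> e))" and surj_\<gamma>: "surj \<gamma>"
begin

definition cap_map :: "node option \<Rightarrow> real \<Rightarrow> real" where
  "cap_map e t = fst (cap (\<gamma> e)) + (t - fst (cap e)) / (snd (cap e) - fst (cap e)) * (snd (cap (\<gamma> e)) - fst (cap (\<gamma> e)))"

text \<open>The value of the lift at \<open>x\<close> is determined by linearity if \<open>x\<close> is on a cap, and by \<open>collapse\<close> otherwise.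
Defining the lift in this way, independently of any diagram, avoids all compatibility conditions at the
ends of the pieces of a diagram.\<close>

definition lift_value :: "complex \<Rightarrow> complex \<Rightarrow> bool" where
  "lift_value x y \<longleftrightarrow> y \<in> circle \<and> collapse y = g (collapse x) \<and>
     (\<forall>e t. fst (cap e) \<le> t \<longrightarrow> t \<le> snd (cap e) \<longrightarrow> x = circ t \<longrightarrow> y = circ (cap_map e t))"

definition lift :: "complex \<Rightarrow> complex" where
  "lift = (\<lambda>x\<in>circle. THE y. lift_value x y)"

lemma cap_map_range:
  assumes "fst (cap e) \<le> t" "t \<le> snd (cap e)"
  shows "fst (cap (\<gamma> e)) \<le> cap_map e t" "cap_map e t \<le> snd (cap (\<gamma> e))"
proof -
  let ?q = "(t - fst (cap e)) / (snd (cap e) - fst (cap e))" and ?d = "snd (cap (\<gamma> e)) - fst (cap (\<gamma> e))"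
  have q: "0 \<le> ?q" "?q \<le> 1" using assms cap_nonempty[of e] by simp_all
  have d: "0 < ?d" using cap_nonempty[of "\<gamma> e"] by simp
  have "0 \<le> ?q * ?d" using q d by (intro mult_nonneg_nonneg) auto
  moreover have "?q * ?d \<le> 1 * ?d" using q d by (intro mult_right_mono) auto
  then have "fst (cap (\<gamma> e)) + ?q * ?d \<le> fst (cap (\<gamma> e)) + 1 * ?d" by (rule add_left_mono)
  ultimately show "fst (cap (\<gamma> e)) \<le> cap_map e t" "cap_map e t \<le> snd (cap (\<gamma> e))"
    unfolding cap_map_def by simp_all
qed

lemma cap_param_unique:
  assumes "fst (cap e) \<le> t" "t \<le> snd (cap e)" "fst (cap e') \<le> t'" "t' \<le> snd (cap e')" "circ t = circ t'"
  shows "e = e'" "t = t'"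
proof -
  have "circ t \<in> closed_cap e" "circ t' \<in> closed_cap e'"
    unfolding closed_cap_def using assms(1-4) by (intro imageI; simp)+
  then show "e = e'" using closed_caps_disjoint assms(5) by metis
  then have "\<bar>t - t'\<bar> < 1" using assms cap_short[of e] by auto
  then show "t = t'" using assms(5) circ_eq_near by blast
qed

lemma lift_value_cap:
  assumes "fst (cap e) \<le> t" "t \<le> snd (cap e)"
  shows "lift_value (circ t) (circ (cap_map e t))"
  unfolding lift_value_def
proof (intro conjI allI impI)
  show "collapse (circ (cap_map e t)) = g (collapse (circ t))"
    using collapse_cap[OF assms] collapse_cap[OF cap_map_range[OF assms]] g_lab by simp
  fix e' t' assume "fst (cap e') \<le> t'" "t' \<le> snd (cap e')" "circ t = circ t'"
  then show "circ (cap_map e t) = circ (cap_map e' t')" using cap_param_unique[OF assms] by blast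
qed simp

lemma lift_value_off_caps:
  assumes "x \<in> circle" "\<And>e. x \<notin> closed_cap e" "lift_value x y"
  shows "y \<notin> closed_cap e'"
proof
  assume "y \<in> closed_cap e'"
  moreover obtain e where "e' = \<gamma> e" using surj_\<gamma> by (metis surjE)
  moreover have "y \<in> circle" "collapse y = g (collapse x)" using assms(3) by (auto simp: lift_value_def)
  ultimately have "g (collapse x) = g (circ (lab e))" using closed_cap_iff[of y e'] g_lab by simp
  then have "collapse x = circ (lab e)" using inj_g by (simp add: inj_on_def)
  then show False using closed_cap_iff[OF assms(1), of e] assms(2) by blast
qed

lemma lift_value_unique:
  assumes x: "x \<in> circle" and y: "lift_value x y" "lift_value x y'"
  shows "y = y'"
proof (cases "\<exists>e. x \<in> closed_cap e")
  case True
  then obtain e t where t: "fst (cap e) \<le> t" "t \<le> snd (cap e)" "x = circ t" by (auto simp: closed_cap_def)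
  have "y = circ (cap_map e t)" "y' = circ (cap_map e t)"
    using y t unfolding lift_value_def by blast+
  then show ?thesis by simp
next
  case False
  then have n: "y \<notin> closed_cap e" for e using lift_value_off_caps[OF x _ y(1)] by blast
  have "y \<in> circle" "y' \<in> circle" "collapse y = collapse y'" using y by (auto simp: lift_value_def)
  then show ?thesis using collapse_fibre[of y y'] n by blast
qed

lemma lift_value_exists:
  assumes x: "x \<in> circle"
  shows "\<exists>y. lift_value x y"
proof (cases "\<exists>e. x \<in> closed_cap e")
  case True
  then obtain e t where t: "fst (cap e) \<le> t" "t \<le> snd (cap e)" "x = circ t" by (auto simp: closed_cap_def)
  then show ?thesis using lift_value_cap by blast
next
  case False
  have "collapse x \<in> circle" by simp
  then have "g (collapse x) \<in> circle" using surj_g by blast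
  then obtain y where y: "y \<in> limit_set" "collapse y = g (collapse x)" by (rule collapse_limit_set_surj)
  have "lift_value x y"
    unfolding lift_value_def
  proof (intro conjI allI impI)
    show "y \<in> circle" using y limit_set_circle by blast
    fix e t assume "fst (cap e) \<le> t" "t \<le> snd (cap e)" "x = circ t"
    then have "x \<in> closed_cap e" by (auto simp: closed_cap_def)
    then show "y = circ (cap_map e t)" using False by blast
  qed (rule y(2))
  then show ?thesis by blast
qed

lemma lift_eqI: "x \<in> circle \<Longrightarrow> lift_value x y \<Longrightarrow> lift x = y"
  unfolding lift_def using lift_value_unique by (simp add: the_equality)

lemma lift_value_lift: "x \<in> circle \<Longrightarrow> lift_value x (lift x)"
  using lift_value_exists lift_eqI by metis

lemma lift_in_circle: "x \<in> circle \<Longrightarrow> lift x \<in> circle"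
  and collapse_lift: "x \<in> circle \<Longrightarrow> collapse (lift x) = g (collapse x)"
  using lift_value_lift by (auto simp: lift_value_def)

lemma lift_cap: "maps_linearly lift (cap e) (cap (\<gamma> e))"
  unfolding maps_linearly_def
proof
  fix s :: real assume s: "s \<in> {0..1}"
  let ?d = "snd (cap e) - fst (cap e)"
  let ?t = "fst (cap e) + s * ?d"
  have d: "0 < ?d" using cap_nonempty[of e] by simp
  have "0 \<le> s * ?d" "s * ?d \<le> 1 * ?d" using s d by (auto intro!: mult_right_mono mult_nonneg_nonneg)
  then have t: "fst (cap e) \<le> ?t" "?t \<le> snd (cap e)"
    using add_left_mono[of "s * ?d" "1 * ?d" "fst (cap e)"] by simp_all
  have "cap_map e ?t = fst (cap (\<gamma> e)) + s * (snd (cap (\<gamma> e)) - fst (cap (\<gamma> e)))"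
    using d by (simp add: cap_map_def)
  then show "lift (circ ?t) = circ (fst (cap (\<gamma> e)) + s * (snd (cap (\<gamma> e)) - fst (cap (\<gamma> e))))"
    using lift_eqI[OF _ lift_value_cap[OF t]] by simp
qed

lemma cap_linear_lift: "cap_linear lift"
  unfolding cap_linear_def using lift_cap surj_\<gamma> by (metis surjE)

lemma lift_inj: "inj_on lift circle"
proof (rule inj_onI)
  fix x y assume x: "x \<in> circle" and y: "y \<in> circle" and eq: "lift x = lift y"
  have "g (collapse x) = g (collapse y)" using collapse_lift x y eq by metis
  then have c: "collapse x = collapse y" using inj_g by (simp add: inj_on_def)
  show "x = y"
  proof (rule ccontr)
    assume "x \<noteq> y"
    then obtain e where e: "x \<in> closed_cap e" "y \<in> closed_cap e" using collapse_fibre[OF x y c] by blast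
    then obtain s where s: "fst (cap e) \<le> s" "s \<le> snd (cap e)" "x = circ s" by (auto simp: closed_cap_def)
    from e obtain t where t: "fst (cap e) \<le> t" "t \<le> snd (cap e)" "y = circ t" by (auto simp: closed_cap_def)
    have "circ (cap_map e s) = circ (cap_map e t)"
      using eq lift_eqI[OF x] lift_eqI[OF y] lift_value_cap[OF s(1,2)] lift_value_cap[OF t(1,2)] s(3) t(3) by metis
    then have "cap_map e s = cap_map e t"
      using cap_param_unique(2)[OF cap_map_range[OF s(1,2)] cap_map_range[OF t(1,2)]] by simp
    then have "s = t" using cap_nonempty[of e] cap_nonempty[of "\<gamma> e"] by (simp add: cap_map_def)
    then show False using \<open>x \<noteq> y\<close> s t by simp
  qed
qed

lemma lift_surj: "lift ` circle = circle"
proof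
  show "lift ` circle \<subseteq> circle" using lift_in_circle by blast
  show "circle \<subseteq> lift ` circle"
  proof
    fix y assume y: "y \<in> circle"
    show "y \<in> lift ` circle"
    proof (cases "\<exists>e'. y \<in> closed_cap e'")
      case True
      then obtain e where e: "y \<in> closed_cap (\<gamma> e)" using surj_\<gamma> by (metis surjE)
      then have "y \<in> lift ` closed_cap e" using maps_linearly_closed_cap[OF lift_cap] by simp
      then show ?thesis using closed_cap_circle[of e] by blast
    next
      case False
      have "collapse y \<in> g ` circle" unfolding surj_g by simp
      then obtain d where d: "d \<in> circle" "collapse y = g d" by blast
      obtain x where x: "x \<in> limit_set" "collapse x = d" by (rule collapse_limit_set_surj[OF d(1)])
      have xc: "x \<in> circle" using x limit_set_circle by blast
      have "collapse y = collapse (lift x)" using collapse_lift[OF xc] d x by simp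
      then have "y = lift x" using collapse_fibre[OF y lift_in_circle[OF xc]] False by blast
      then show ?thesis using xc by blast
    qed
  qed
qed

text \<open>The linear map from cell to cell satisfies the conditions on the value of the lift: it is compatible
with \<open>collapse\<close> by self-similarity; a cap that meets the interior of the cell comes from an arc below the
cell, and such caps correspond linearly; the ends of the cell are ends of caps.\<close>

lemma lift_cell:
  assumes g: "maps_linearly g (label_cell w) (label_cell w')"
  shows "maps_linearly lift (cell w) (cell w')"
  unfolding maps_linearly_def cell_point
proof
  fix s :: real assume s: "s \<in> {0..1}"
  then have s01: "0 \<le> s" "s \<le> 1" by auto
  let ?x = "circ (tau (cantor_val w + s / 4 ^ length w))" and ?y = "circ (tau (cantor_val w' + s / 4 ^ length w'))"
  have glin: "g (circ (bin_val w + u / 2 ^ length w)) = circ (bin_val w' + u / 2 ^ length w')" if "0 \<le> u" "u \<le> 1" for u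
    using g that unfolding maps_linearly_def label_cell_point by simp
  have c: "collapse ?y = g (collapse ?x)"
    using collapse_cell[OF s01, of w] collapse_cell[OF s01, of w'] glin[OF stair_ge_0 stair_le_1] by simp
  have "lift_value ?x ?y"
    unfolding lift_value_def
  proof (intro conjI allI impI c)
    fix e t assume t: "fst (cap e) \<le> t" "t \<le> snd (cap e)" "?x = circ t"
    have xe: "?x \<in> closed_cap e" unfolding t(3) closed_cap_def using t by auto
    then have le: "collapse ?x = circ (lab e)" using closed_cap_iff[of ?x e] by simp
    have r: "circ (lab (\<gamma> e)) = g (collapse ?x)" unfolding le g_lab ..
    consider "s = 0" | "s = 1" | "0 < s" "s < 1" using s01 by linarith
    then show "?y = circ (cap_map e t)"
    proof cases
      case 1
      have "circ (lab e) = circ (bin_val w)" using le 1 collapse_cell[of 0 w] by (simp add: stair_le_0)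
      then have "circ t = circ (snd (cap e))" using cell_first_end[of e w] t(3) 1 by simp
      then have "t = snd (cap e)" using cap_param_unique(2)[OF t(1,2), of e "snd (cap e)"] cap_nonempty[of e] by simp
      then have "cap_map e t = snd (cap (\<gamma> e))" using cap_nonempty[of e] by (simp add: cap_map_def)
      moreover have "circ (lab (\<gamma> e)) = circ (bin_val w')"
        using r c 1 collapse_cell[of 0 w'] by (simp add: stair_le_0)
      ultimately show ?thesis using cell_first_end[of "\<gamma> e" w'] 1 by simp
    next
      case 2
      have "circ (lab e) = circ (bin_val w + 1 / 2 ^ length w)" using le 2 collapse_cell[of 1 w] by (simp add: stair_ge_1)
      then have "circ t = circ (fst (cap e))" using cell_last_end[of e w] t(3) 2 by simp
      then have "t = fst (cap e)" using cap_param_unique(2)[OF t(1,2), of e "fst (cap e)"] cap_nonempty[of e] by simp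
      then have "cap_map e t = fst (cap (\<gamma> e))" using cap_nonempty[of e] by (simp add: cap_map_def)
      moreover have "circ (lab (\<gamma> e)) = circ (bin_val w' + 1 / 2 ^ length w')"
        using r c 2 collapse_cell[of 1 w'] by (simp add: stair_ge_1)
      ultimately show ?thesis using cell_last_end[of "\<gamma> e" w'] 2 by simp
    next
      case 3
      obtain v where v: "e = Some (w @ v)" "gapl v \<le> s" "s \<le> gapr v" by (rule cell_meets_cap[OF 3 xe])
      have m: "0 \<le> bin_mid v" "bin_mid v \<le> 1" using bin_mid_bounds[of v] by auto
      have "circ (lab (\<gamma> e)) = g (circ (bin_val w + bin_mid v / 2 ^ length w))"
        unfolding g_lab[symmetric] v(1) by (simp add: bin_mid_append)
      also have "\<dots> = circ (lab (Some (w' @ v)))" using glin[OF m] by (simp add: bin_mid_append)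
      finally have \<gamma>e: "\<gamma> e = Some (w' @ v)" by (rule lab_inj)
      have cp: "fst (cap (Some (z @ v))) = tau (cantor_val z + gapl v / 4 ^ length z)"
        "snd (cap (Some (z @ v))) = tau (cantor_val z + gapr v / 4 ^ length z)" for z
        by (simp_all add: gapl_append gapr_append)
      let ?t = "tau (cantor_val w + s / 4 ^ length w)"
      have "fst (cap e) \<le> ?t" "?t \<le> snd (cap e)"
        unfolding v(1) cp using v by (simp_all add: divide_right_mono)
      then have tt: "t = ?t" using cap_param_unique(2)[OF t(1,2), of e ?t] t(3) by simp
      have diff: "tau (a + p / r) - tau (a + q / r) = 2/3 * ((p - q) / r)" for a p q r
      proof -
        have "tau (a + p / r) - tau (a + q / r) = 2/3 * (a + p / r - (a + q / r))"
          unfolding tau_def by (simp only: right_diff_distrib)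
        then show ?thesis by (simp add: diff_divide_distrib)
      qed
      have ratio: "(2/3 * (p / r)) / (2/3 * (q / r)) = p / q" if "r \<noteq> 0" for p q r :: real
        using that by simp
      have cancel: "p / q * (2/3 * (q / r)) = 2/3 * (p / r)" if "q \<noteq> 0" for p q r :: real
        using that by simp
      have "gapr v - gapl v \<noteq> 0" using gapl_less_gapr[of v] by simp
      then have "cap_map e t = tau (cantor_val w' + gapl v / 4 ^ length w') + 2/3 * ((s - gapl v) / 4 ^ length w')"
        unfolding cap_map_def \<gamma>e unfolding v(1) cp tt diff by (simp only: ratio cancel power_not_zero zero_neq_numeral not_False_eq_True)
      also have "\<dots> = tau (cantor_val w' + s / 4 ^ length w')"
        using diff[of "cantor_val w'" s "4 ^ length w'" "gapl v"] by linarith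
      finally show ?thesis by simp
    qed
  qed simp
  then show "lift ?x = ?y" by (rule lift_eqI[rotated]) simp
qed

text \<open>The lift is linear on the finitely many cells and caps of a diagram, hence continuous.\<close>

lemma lift_homeo:
  assumes "halved S E" "\<And>w. w \<in> S \<Longrightarrow> \<exists>w'. maps_linearly g (label_cell w) (label_cell w')"
  shows "circle_homeo lift"
proof (rule circle_homeoI[OF _ _ lift_inj lift_surj])
  show "lift \<in> extensional circle" by (simp add: lift_def)
  have "finite E" using assms(1) by induction auto
  show "continuous_on circle lift"
  proof (rule piecewise_linear_continuous[OF _ halved_cells_caps_cover[OF assms(1)]])
    show "finite (cell ` S \<union> cap ` E)" using halved_partition(1)[OF assms(1)] \<open>finite E\<close> by simp
    show "fst p < snd p" if "p \<in> cell ` S \<union> cap ` E" for p using that cell_less cap_nonempty by blast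
    show "\<exists>q. maps_linearly lift p q" if "p \<in> cell ` S \<union> cap ` E" for p
      using that assms(2) lift_cell lift_cap by blast
  qed
qed

end

lemma ends_inj:
  assumes "- 1/6 \<le> fst p" "fst p < snd p" "snd p \<le> 5/6" "- 1/6 \<le> fst q" "fst q < snd q" "snd q \<le> 5/6" "ends p = ends q"
  shows "p = q"
proof -
  have "circ (fst p) = circ (fst q)" "circ (snd p) = circ (snd q)"
    using assms(7) by (simp_all add: ends_def map_prod_def case_prod_beta)
  moreover have "\<bar>fst p - fst q\<bar> < 1" "\<bar>snd p - snd q\<bar> < 1" using assms(1-6) by linarith+
  ultimately show ?thesis using circ_eq_near by (simp add: prod_eq_iff)
qed

lemma cell_range: "- 1/6 \<le> fst (cell w)" "snd (cell w) \<le> 5/6"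
  using cantor_val_ge_0[of w] cantor_val_le_1[of w] by (simp_all add: cell_def tau_def)

lemma map_prod_ends: "maps_linearly f p q \<Longrightarrow> map_prod f f (ends p) = ends q"
  using maps_linearly_ends[of f p q] by (simp add: ends_def map_prod_def case_prod_beta)

text \<open>The two dyadic subdivisions of \<open>g\<close> give two diagrams of central arcs.  Left ends of dyadic intervals are
the labels of the arcs of the diagram, so \<open>g\<close> matches the arcs of the two diagrams, and the lift is linear
on all their cells and caps.\<close>

theorem thompson_T_lift:
  assumes T: "g \<in> thompson_T"
  obtains f where "f \<in> rist_C" "lifts f g"
proof -
  obtain S E S' E' \<sigma> where S: "halved S E" "halved S' E'" "[] \<notin> S" "[] \<notin> S'" "bij_betw \<sigma> S S'"
    and lin: "\<And>w. w \<in> S \<Longrightarrow> maps_linearly g (label_cell w) (label_cell (\<sigma> w))"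
    using T by (rule thompson_T_pieces) (rule that)
  have gh: "circle_homeo g" using T by (rule thompson_T_homeo)
  have gnum: "g (circ (bin_val w)) = circ (bin_val (\<sigma> w))" if "w \<in> S" for w
    using maps_linearly_ends(1)[OF lin[OF that]] by (simp add: label_cell_def)
  have gmid: "g (circ (lab (Some (w @ s)))) = circ (lab (Some (\<sigma> w @ s)))" if "w \<in> S" for w s
  proof -
    have "bin_mid s \<in> {0..1}" using bin_mid_bounds[of s] by simp
    then have "g (circ (bin_val w + bin_mid s / 2 ^ length w)) = circ (bin_val (\<sigma> w) + bin_mid s / 2 ^ length (\<sigma> w))"
      using lin[OF that] unfolding maps_linearly_def label_cell_point by blast
    then show ?thesis by (simp add: bin_mid_append)
  qed
  have E: "\<exists>w\<in>S. lab e = bin_val w" if "e \<in> E" for e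
    using halved_labels[OF S(1)] that by (metis imageE imageI)
  have E': "\<exists>w\<in>S'. lab e = bin_val w" if "e \<in> E'" for e
    using halved_labels[OF S(2)] that by (metis imageE imageI)
  have numE: "\<exists>e\<in>E. lab e = bin_val w" if "w \<in> S" for w
    using halved_labels[OF S(1)] that by (metis imageE imageI)
  have numE': "\<exists>e\<in>E'. lab e = bin_val w" if "w \<in> S'" for w
    using halved_labels[OF S(2)] that by (metis imageE imageI)
  have \<sigma>S: "\<sigma> ` S = S'" using S(5) by (simp add: bij_betw_def)
  have onE: "\<exists>e'\<in>E'. g (circ (lab e)) = circ (lab e')" if "e \<in> E" for e
  proof -
    obtain w where w: "w \<in> S" "lab e = bin_val w" using E \<open>e \<in> E\<close> by blast
    obtain e' where "e' \<in> E'" "lab e' = bin_val (\<sigma> w)" using numE'[of "\<sigma> w"] w \<sigma>S by blast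
    then show ?thesis using gnum[OF w(1)] w(2) by (intro bexI[of _ e']) simp_all
  qed
  have ontoE: "\<exists>e\<in>E. g (circ (lab e)) = circ (lab e')" if "e' \<in> E'" for e'
  proof -
    obtain w' where w': "w' \<in> S'" "lab e' = bin_val w'" using E' \<open>e' \<in> E'\<close> by blast
    obtain w where w: "w \<in> S" "w' = \<sigma> w" using w'(1) \<sigma>S by blast
    obtain e where "e \<in> E" "lab e = bin_val w" using numE[OF w(1)] by blast
    then show ?thesis using gnum[OF w(1)] w' w by (intro bexI[of _ e]) simp_all
  qed
  have "\<exists>e'. g (circ (lab e)) = circ (lab e')" for e
    using halved_cap_cases[OF S(1), of e] onE[of e] gmid by blast
  then have "\<exists>\<gamma>. \<forall>e. g (circ (lab e)) = circ (lab (\<gamma> e))" by (intro choice allI)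
  then obtain \<gamma> where \<gamma>: "\<And>e. g (circ (lab e)) = circ (lab (\<gamma> e))" by blast
  have \<gamma>eq: "\<gamma> e = e'" if "g (circ (lab e)) = circ (lab e')" for e e'
    using that \<gamma>[of e] by (intro lab_inj) simp
  have surj: "surj \<gamma>"
  proof -
    have "\<exists>e. \<gamma> e = e'" for e'
      using halved_cap_cases[OF S(2), of e']
    proof
      assume "e' \<in> E'"
      then show ?thesis using ontoE \<gamma>eq by blast
    next
      assume "\<exists>w'\<in>S'. \<exists>s. e' = Some (w' @ s)"
      then obtain w s where "w \<in> S" "e' = Some (\<sigma> w @ s)" using \<sigma>S by blast
      then show ?thesis using \<gamma>eq[OF gmid] by blast
    qed
    then show ?thesis by (metis surjI)
  qed
  have \<gamma>E: "\<gamma> ` E = E'"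
  proof
    show "\<gamma> ` E \<subseteq> E'" using onE \<gamma>eq by blast
    show "E' \<subseteq> \<gamma> ` E"
    proof
      fix e' assume "e' \<in> E'"
      then obtain e where "e \<in> E" "g (circ (lab e)) = circ (lab e')" using ontoE by blast
      then show "e' \<in> \<gamma> ` E" using \<gamma>eq by blast
    qed
  qed
  interpret label_permutation g \<gamma>
    using circle_homeoD(3,4)[OF gh] \<gamma> surj by unfold_locales
  have homeo: "circle_homeo lift" by (rule lift_homeo[OF S(1)]) (use lin in blast)
  have lifts: "lifts lift g" unfolding lifts_def using homeo cap_linear_lift collapse_lift by blast
  let ?I = "cell ` S \<union> cap ` E" and ?J = "cell ` S' \<union> cap ` E'"
  have fw: "\<exists>q\<in>?J. maps_linearly lift p q" if "p \<in> ?I" for p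
    using that
  proof
    assume "p \<in> cell ` S"
    then obtain w where w: "w \<in> S" "p = cell w" by blast
    then show ?thesis using lift_cell[OF lin[OF w(1)]] \<sigma>S by blast
  next
    assume "p \<in> cap ` E"
    then obtain e where e: "e \<in> E" "p = cap e" by blast
    then show ?thesis using lift_cap[of e] \<gamma>E by blast
  qed
  have bw: "\<exists>p\<in>?I. maps_linearly lift p q" if "q \<in> ?J" for q
    using that
  proof
    assume "q \<in> cell ` S'"
    then obtain w where w: "w \<in> S" "q = cell (\<sigma> w)" using \<sigma>S by blast
    then show ?thesis using lift_cell[OF lin[OF w(1)]] by blast
  next
    assume "q \<in> cap ` E'"
    then obtain e where e: "e \<in> E" "q = cap (\<gamma> e)" using \<gamma>E by blast
    then show ?thesis using lift_cap[of e] by blast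
  qed
  have range: "- 1/6 \<le> fst q \<and> fst q < snd q \<and> snd q \<le> 5/6" if "q \<in> ?J" for q
    using that
  proof
    assume "q \<in> cell ` S'"
    then show ?thesis using cell_range cell_less by blast
  next
    assume "q \<in> cap ` E'"
    then show ?thesis using cap_range cap_nonempty less_imp_le by blast
  qed
  have larc: "lift ` central_arc e = central_arc (\<gamma> e)" for e
    using maps_linearly_ends[OF lift_cap[of e]] by (simp add: central_arc_def)
  have im: "(\<lambda>A. lift ` A) ` central_arc ` E = central_arc ` E'"
    unfolding \<gamma>E[symmetric] image_image larc by simp
  have "diagram_iso ?I (central_arc ` E) ?J (central_arc ` E') lift"
    unfolding diagram_iso_def
  proof (intro conjI im)
    have "\<Union>(central_arc ` E) \<subseteq> circle" using central_arc_circle by blast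
    then have "inj_on lift (\<Union>(central_arc ` E))" using lift_inj inj_on_subset by blast
    moreover have "lift ` \<Union>(central_arc ` E) = \<Union>(central_arc ` E')" unfolding im[symmetric] by blast
    ultimately show "bij_betw lift (\<Union>(central_arc ` E)) (\<Union>(central_arc ` E'))" by (simp add: bij_betw_def)
    have "map_prod lift lift (ends p) \<in> ends ` ?J" if p: "p \<in> ?I" for p
    proof -
      obtain q where q: "q \<in> ?J" "maps_linearly lift p q" using fw[OF p] by blast
      show ?thesis unfolding map_prod_ends[OF q(2)] using q(1) by (rule imageI)
    qed
    moreover have "ends q \<in> (\<lambda>p. map_prod lift lift (ends p)) ` ?I" if q: "q \<in> ?J" for q
    proof -
      obtain p where p: "p \<in> ?I" "maps_linearly lift p q" using bw[OF q] by blast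
      show ?thesis unfolding map_prod_ends[OF p(2), symmetric] using p(1) by (rule imageI)
    qed
    ultimately show "map_prod lift lift ` ends ` ?I = ends ` ?J"
      unfolding image_image by (intro subset_antisym image_subsetI)
  qed
  moreover have "maps_linearly lift p q" if pq: "p \<in> ?I" "q \<in> ?J" "map_prod lift lift (ends p) = ends q" for p q
  proof -
    obtain q' where q': "q' \<in> ?J" "maps_linearly lift p q'" using fw[OF pq(1)] by blast
    have "ends q' = ends q" using map_prod_ends[OF q'(2)] pq(3) by simp
    then have "q' = q" using range[OF q'(1)] range[OF pq(2)] by (intro ends_inj) auto
    then show ?thesis using q'(2) by simp
  qed
  ultimately have "has_arc_pair_diagram lift ?I (central_arc ` E) ?J (central_arc ` E') lift"
    unfolding has_arc_pair_diagram_def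
    using halved_arc_diagram[OF S(1,3)] halved_arc_diagram[OF S(2,4)] homeo by blast
  moreover have "central_arc ` E \<subseteq> central_arcs" "central_arc ` E' \<subseteq> central_arcs" unfolding central_arcs_eq by blast+
  ultimately have "lift \<in> rist_C" unfolding rist_C_def by blast
  then show ?thesis using that lifts by blast
qed

lemma lifts_in_rist_C: "lifts f g \<Longrightarrow> g \<in> thompson_T \<Longrightarrow> f \<in> rist_C"
  using thompson_T_lift lifts_unique by metis

lemma subgroup_rist_C: "subgroup rist_C (BijGroup circle)"
proof -
  note L = rist_C_lifts[OF label_chart_label_map]
  let ?a = "boundary_action label_map"
  show ?thesis
  proof (rule subgroup_BijGroupI)
    show "circle_homeo f" if "f \<in> rist_C" for f using rist_C_cap_linear(1)[OF that] .
    show "(\<lambda>x\<in>circle. x) \<in> rist_C" by (rule lifts_in_rist_C[OF lifts_id thompson_T_id])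
    show "compose circle g f \<in> rist_C" if "f \<in> rist_C" "g \<in> rist_C" for f g
      using lifts_in_rist_C[OF lifts_compose[OF L(1)[OF that(1)] L(1)[OF that(2)]]
          thompson_T_compose[OF L(2)[OF that(1)] L(2)[OF that(2)]]] .
    show "(\<lambda>x\<in>circle. inv_into circle f x) \<in> rist_C" if f: "f \<in> rist_C" for f
    proof -
      have "inj_on (?a f) circle" using circle_homeoD(3)[OF thompson_T_homeo[OF L(2)[OF f]]] .
      then show ?thesis
        using lifts_in_rist_C[OF lifts_inverse[OF L(1)[OF f]] thompson_T_inverse[OF L(2)[OF f]]] by blast
    qed
  qed
qed

lemma boundary_action_eqI:
  assumes h: "label_chart h" and f: "lifts f g" and g: "g \<in> extensional circle"
  shows "boundary_action h f = g"
proof (rule extensionalityI[OF _ g])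
  show "boundary_action h f \<in> extensional circle" by (simp add: boundary_action_def)
  fix d assume "d \<in> circle"
  then obtain x where x: "x \<in> limit_set" "collapse x = d" by (rule collapse_limit_set_surj)
  have "x \<in> circle" using x limit_set_circle by blast
  then show "boundary_action h f d = g d"
    using boundary_action_collapse[OF h lifts_permutes_arcs[OF f] x(1)] f x(2) by (simp add: lifts_def)
qed

text \<open>The action of a lift of \<open>g\<close> is \<open>g\<close>, so the action inherits bijectivity from existence and uniqueness of
lifts.\<close>

theorem boundary_action_iso:
  assumes h: "label_chart h"
  shows "boundary_action h \<in>
    iso (BijGroup circle\<lparr>carrier := rist_C\<rparr>) (BijGroup circle\<lparr>carrier := thompson_T\<rparr>)"
proof (rule isoI)
  note L = rist_C_lifts[OF h]
  show "boundary_action h \<in> hom (BijGroup circle\<lparr>carrier := rist_C\<rparr>) (BijGroup circle\<lparr>carrier := thompson_T\<rparr>)"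
  proof (rule homI)
    show "boundary_action h f \<in> carrier (BijGroup circle\<lparr>carrier := thompson_T\<rparr>)"
      if "f \<in> carrier (BijGroup circle\<lparr>carrier := rist_C\<rparr>)" for f
      using that L(2) by simp
    fix f f' assume "f \<in> carrier (BijGroup circle\<lparr>carrier := rist_C\<rparr>)" "f' \<in> carrier (BijGroup circle\<lparr>carrier := rist_C\<rparr>)"
    then have f: "f \<in> rist_C" "f' \<in> rist_C" by simp_all
    have B: "f \<in> Bij circle" "f' \<in> Bij circle"
      using circle_homeoD(6) rist_C_cap_linear(1) f by blast+
    have B': "boundary_action h f \<in> Bij circle" "boundary_action h f' \<in> Bij circle"
      using circle_homeoD(6) thompson_T_homeo L(2) f by blast+
    have "boundary_action h (compose circle f f') = compose circle (boundary_action h f) (boundary_action h f')"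
      by (rule boundary_action_eqI[OF h lifts_compose[OF L(1)[OF f(2)] L(1)[OF f(1)]]]) (simp add: compose_def)
    then show "boundary_action h (f \<otimes>\<^bsub>BijGroup circle\<lparr>carrier := rist_C\<rparr>\<^esub> f') =
        boundary_action h f \<otimes>\<^bsub>BijGroup circle\<lparr>carrier := thompson_T\<rparr>\<^esub> boundary_action h f'"
      using B B' by (simp add: BijGroup_def)
  qed
  have "inj_on (boundary_action h) rist_C"
  proof (rule inj_onI)
    fix f f' assume f: "f \<in> rist_C" "f' \<in> rist_C" "boundary_action h f = boundary_action h f'"
    show "f = f'" by (rule lifts_unique[OF L(1)[OF f(1)]]) (use L(1)[OF f(2)] f(3) in simp)
  qed
  moreover have "boundary_action h ` rist_C = thompson_T"
  proof
    show "boundary_action h ` rist_C \<subseteq> thompson_T" using L(2) by blast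
    show "thompson_T \<subseteq> boundary_action h ` rist_C"
    proof
      fix g assume g: "g \<in> thompson_T"
      obtain f where f: "f \<in> rist_C" "lifts f g" by (rule thompson_T_lift[OF g])
      have "boundary_action h f = g"
        by (rule boundary_action_eqI[OF h f(2) circle_homeoD(1)[OF thompson_T_homeo[OF g]]])
      then show "g \<in> boundary_action h ` rist_C" using f(1) by blast
    qed
  qed
  ultimately show "bij_betw (boundary_action h) (carrier (BijGroup circle\<lparr>carrier := rist_C\<rparr>))
      (carrier (BijGroup circle\<lparr>carrier := thompson_T\<rparr>))"
    by (simp add: bij_betw_def)
qed

theorem theorem6p3:
  shows "(\<exists>h. label_chart h) \<and>
    (\<forall>h. label_chart h \<longrightarrow>
       (\<forall>f\<in>stab_C. boundary_action h f \<in> thompson_T) \<and>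
       subgroup rist_C (BijGroup circle) \<and>
       subgroup thompson_T (BijGroup circle) \<and>
       boundary_action h \<in>
         iso (BijGroup circle\<lparr>carrier := rist_C\<rparr>) (BijGroup circle\<lparr>carrier := thompson_T\<rparr>))"
  using label_chart_label_map stab_C_thompson_T subgroup_rist_C subgroup_thompson_T boundary_action_iso
  by blast

end
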